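(* Let $X\subset\mathbb{R}^d$ be nonempty, $Y\subset\mathbb{R}^p$ nonempty and compact, $S:X\rightrightarrows Y$ a set-valued map with nonempty closed convex values, and $\bar{x}\in X$. Let $\beta:X\to\mathscr{P}(Y)$ be a belief over $S$ admitting a density function $\rho:X\times Y\to[0,+\infty)$ that is continuous. If $S$ is rectangularly continuous at $\bar{x}$, then $\beta$ is weak continuous at $\bar{x}$. In particular, the Neutral belief $\iota:X\to\mathscr{P}(Y)$ over $S$ is weak continuous under rectangular continuity of $S$.
   Context: Notation: $\operatorname{adim}(A)$ is the dimension of the affine hull of $A$; $d_x:=\operatorname{adim}(S(x))$; $\lambda_k$ is the $k$-dimensional Hausdorff measure, normalized so that it is Lebesgue measure on $k$-dimensional affine subspaces ($\lambda_0$ is counting measure). $\mathscr{P}(Y)$ is the set of Borel probability measures on $Y$ with weak convergence (integrals of continuous functions with bounded support converge). $\beta$ is weak continuous at $\bar x$ if $\beta_{x_n}\to\beta_{\bar x}$ weakly whenever $x_n\to\bar x$ in $X$. Belief: a belief over $S$ is a map $\beta:X\to\mathscr{P}(Y)$ with $\beta_x(S(x))=1$ for all $x\in X$. It admits a density function if there is $\rho:X\times Y\to[0,+\infty)$ such that for all $x\in X$, $\rho(x,\cdot)|_{S(x)}$ is $\lambda_{d_x}$-measurable with $0<\int_{S(x)}\rho(x,y)\,d\lambda_{d_x}(y)<+\infty$, and $\beta_x(A)=\int_{A\cap S(x)}\rho(x,y)\,d\lambda_{d_x}(y)\big/\int_{S(x)}\rho(x,y)\,d\lambda_{d_x}(y)$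 for all Borel $A\subset Y$. The Neutral belief is $\iota_x(A)=\lambda_{d_x}(A\cap S(x))/\lambda_{d_x}(S(x))$. Rectangular continuity: $S:X\rightrightarrows Y$ with nonempty bounded values is rectangularly continuous at $\bar x\in X$ if there exist set-valued maps $T_0,T_1,R_0,R_1:X\rightrightarrows\mathbb{R}^p$ such that 1. for every $x$ near $\bar x$, $T_0(x)+R_0(x)\subset S(x)\subset T_1(x)+R_1(x)$ (Minkowski sums); 2. for $j=0,1$, $R_j(x)\subset \operatorname{span}(T_j(x)-T_j(x))^{\perp}\cap\operatorname{span}(S(x)-S(x))$, and $T_j$ has constant affine dimension equal to $d_{\bar x}$; 3. for $j=0,1$, $\lim_{x\to\bar x}R_j(x)=\{0\}$ and $\lim_{x\to\bar x}T_j(x)=S(\bar x)$ (Painlevé–Kuratowski set limits); 4. $R_0,R_1$ have measurable values and $\lim_{x\to\bar x}\dfrac{\lambda_{d_x-d_{\bar x}}(R_0(x))}{\lambda_{d_x-d_{\bar x}}(R_1(x))}=1$. $S$ is rectangularly continuous on $X$ if it is so at each point of $X$. *)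

theory Defs
  imports "HOL-Analysis.Analysis" "HOL-Probability.Probability_Measure"
begin

section \<open>Normalized Hausdorff measure\<close>

text \<open>
  The contribution of a covering set is \<open>\<omega>\<^sub>k (diam U / 2)\<^sup>k\<close>, with \<open>\<omega>\<^sub>k\<close> the volume of the
  \<open>k\<close>-dimensional Euclidean unit ball; this is the normalization for which the measure is
  Lebesgue measure on \<open>k\<close>-dimensional affine subspaces. For \<open>k = 0\<close> a nonempty set
  contributes \<open>1\<close> (also when its diameter is \<open>0\<close>, as \<open>0 ^ 0 = 1\<close>) and the empty set \<open>0\<close>,
  so that one gets counting measure.
\<close>

definition hausdorff_gauge :: "nat \<Rightarrow> 'a::metric_space set \<Rightarrow> ennreal" where
  "hausdorff_gauge k U =
     (if U = {} then 0 else ennreal (unit_ball_vol (real k) * (diameter U / 2) ^ k))"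

text \<open>Boundedness is required separately because \<^const>\<open>diameter\<close> is unspecified on unbounded sets.\<close>

definition fine_covers :: "real \<Rightarrow> 'a::metric_space set \<Rightarrow> (nat \<Rightarrow> 'a set) set" where
  "fine_covers \<delta> A =
     {U. (\<forall>i. bounded (U i) \<and> diameter (U i) \<le> \<delta>) \<and> A \<subseteq> (\<Union>i. U i)}"

definition hausdorff_outer :: "nat \<Rightarrow> 'a::metric_space set \<Rightarrow> ennreal" where
  "hausdorff_outer k A =
     (SUP \<delta>\<in>{0<..}. INF U\<in>fine_covers \<delta> A. \<Sum>i. hausdorff_gauge k (U i))"

text \<open>The measurable sets are all Caratheodory-measurable sets, not only the Borel sets.\<close>

definition hausdorff_measure :: "nat \<Rightarrow> 'a::metric_space measure" where
  "hausdorff_measure k =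
     measure_of UNIV (lambda_system UNIV UNIV (hausdorff_outer k)) (hausdorff_outer k)"

lemma outer_measure_space_hausdorff_outer:
  "outer_measure_space UNIV (hausdorff_outer k :: 'a::metric_space set \<Rightarrow> ennreal)"
  unfolding outer_measure_space_def
proof (intro conjI)
  let ?s = "\<lambda>U :: nat \<Rightarrow> 'a set. \<Sum>i. hausdorff_gauge k (U i)"
  show "positive UNIV (hausdorff_outer k :: 'a set \<Rightarrow> ennreal)"
    unfolding positive_def
  proof -
    have "(INF U\<in>fine_covers \<delta> {}. ?s U) = 0" if "\<delta> > 0" for \<delta> :: real
    proof -
      have "(\<lambda>_. {}) \<in> fine_covers \<delta> ({} :: 'a set)"
        using that by (simp add: fine_covers_def)
      then have "(INF U\<in>fine_covers \<delta> {}. ?s U) \<le> ?s (\<lambda>_. {})"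
        by (rule INF_lower)
      then show ?thesis by (simp add: hausdorff_gauge_def)
    qed
    then show "hausdorff_outer k ({} :: 'a set) = 0"
      by (simp add: hausdorff_outer_def)
  qed
  show "increasing UNIV (hausdorff_outer k :: 'a set \<Rightarrow> ennreal)"
    unfolding increasing_def hausdorff_outer_def
    by (intro ballI impI SUP_mono' INF_superset_mono) (auto simp: fine_covers_def)
  show "countably_subadditive UNIV (hausdorff_outer k :: 'a set \<Rightarrow> ennreal)"
    unfolding countably_subadditive_def
  proof (intro allI impI)
    fix A :: "nat \<Rightarrow> 'a set"
    have "(INF U\<in>fine_covers \<delta> (\<Union>i. A i). ?s U) \<le> (\<Sum>i. hausdorff_outer k (A i))"
      if \<delta>: "\<delta> > 0" for \<delta> :: real
    proof (rule ennreal_le_epsilon)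
      fix e :: real
      assume e: "0 < e" and fin: "(\<Sum>i. hausdorff_outer k (A i)) < top"
      let ?e = "\<lambda>i. ennreal (e * (1/2) ^ Suc i)"
      have "\<exists>U\<in>fine_covers \<delta> (A i). ?s U < hausdorff_outer k (A i) + ?e i" for i
      proof -
        have lt: "hausdorff_outer k (A i) < top"
          using fin by (metis ennreal_suminf_lessD)
        have "(INF U\<in>fine_covers \<delta> (A i). ?s U) \<le> hausdorff_outer k (A i)"
          unfolding hausdorff_outer_def using \<delta> by (intro SUP_upper) auto
        also have "\<dots> < hausdorff_outer k (A i) + ?e i"
          using lt e by (cases "hausdorff_outer k (A i)")
            (auto simp: ennreal_plus[symmetric] ennreal_less_iff simp del: ennreal_plus)
        finally show ?thesis by (simp add: INF_less_iff)
      qed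
      then obtain V where V: "\<And>i. V i \<in> fine_covers \<delta> (A i)"
        "\<And>i. ?s (V i) < hausdorff_outer k (A i) + ?e i"
        by metis
      define W where "W n = case_prod V (prod_decode n)" for n
      have "W \<in> fine_covers \<delta> (\<Union>i. A i)"
        unfolding fine_covers_def
      proof (intro CollectI conjI allI subsetI)
        show "bounded (W n)" "diameter (W n) \<le> \<delta>" for n
          using V(1) by (auto simp: W_def fine_covers_def split: prod.split)
        fix x assume "x \<in> (\<Union>i. A i)"
        then obtain i j where "x \<in> V i j"
          using V(1) by (fastforce simp: fine_covers_def)
        then have "x \<in> W (prod_encode (i, j))" by (simp add: W_def)
        then show "x \<in> (\<Union>n. W n)" by blast
      qed
      then have "(INF U\<in>fine_covers \<delta> (\<Union>i. A i). ?s U) \<le> ?s W"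
        by (rule INF_lower)
      also have "?s W = (\<Sum>i. ?s (V i))"
        using suminf_ennreal_2dimen[of "\<lambda>i. ?s (V i)" "\<lambda>p. hausdorff_gauge k (case_prod V p)"]
        by (simp add: W_def o_def)
      also have "\<dots> \<le> (\<Sum>i. hausdorff_outer k (A i) + ?e i)"
        by (intro suminf_le less_imp_le V(2)) auto
      also have "\<dots> = (\<Sum>i. hausdorff_outer k (A i)) + (\<Sum>i. ?e i)"
        by (simp add: suminf_add)
      also have "(\<Sum>i. ?e i) = ennreal e"
        using e sums_mult[OF power_half_series, of e] by (intro suminf_ennreal_eq) auto
      finally show "(INF U\<in>fine_covers \<delta> (\<Union>i. A i). ?s U)
          \<le> (\<Sum>i. hausdorff_outer k (A i)) + ennreal e" .
    qed
    then show "hausdorff_outer k (\<Union>i. A i) \<le> (\<Sum>i. hausdorff_outer k (A i))"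
      by (subst hausdorff_outer_def) (auto intro!: SUP_least)
  qed
qed

lemma measure_space_hausdorff:
  "measure_space UNIV (lambda_system UNIV UNIV (hausdorff_outer k)) (hausdorff_outer k)"
  by (rule sigma_algebra.caratheodory_lemma)
    (use sigma_algebra_Pow[of UNIV] in simp, rule outer_measure_space_hausdorff_outer)

lemma sigma_sets_lambda_hausdorff:
  "sigma_sets UNIV (lambda_system UNIV UNIV (hausdorff_outer k)) =
     lambda_system UNIV UNIV (hausdorff_outer k)"
  using measure_space_hausdorff[of k] sigma_algebra.sigma_sets_eq
  unfolding measure_space_def by blast

lemma space_hausdorff_measure [simp]: "space (hausdorff_measure k) = UNIV"
  by (simp add: hausdorff_measure_def space_measure_of_conv)

lemma sets_hausdorff_measure:
  "sets (hausdorff_measure k) = lambda_system UNIV UNIV (hausdorff_outer k)"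
  by (simp add: hausdorff_measure_def sigma_sets_lambda_hausdorff)

lemma emeasure_hausdorff_measure:
  fixes A :: "'a::metric_space set"
  assumes "A \<in> sets (hausdorff_measure k)"
  shows "emeasure (hausdorff_measure k) A = hausdorff_outer k A"
proof -
  have "measure_space UNIV (lambda_system UNIV UNIV (hausdorff_outer k))
      (hausdorff_outer k :: 'a set \<Rightarrow> ennreal)"
    by (rule measure_space_hausdorff)
  with assms show ?thesis
    unfolding hausdorff_measure_def sets_hausdorff_measure[unfolded hausdorff_measure_def]
    by (intro emeasure_measure_of_sigma) (auto simp: measure_space_def)
qed


section \<open>Beliefs\<close>

definition adim :: "'b::euclidean_space set \<Rightarrow> nat" where
  "adim A = nat (aff_dim A)"

definition borel_probs :: "'b::topological_space set \<Rightarrow> 'b measure set" where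
  "borel_probs Y = {\<mu>. prob_space \<mu> \<and> sets \<mu> = sets (restrict_space borel Y)}"

definition weakly_converges ::
  "'b::metric_space set \<Rightarrow> (nat \<Rightarrow> 'b measure) \<Rightarrow> 'b measure \<Rightarrow> bool" where
  "weakly_converges Y \<mu> \<nu> \<longleftrightarrow>
     (\<forall>f :: 'b \<Rightarrow> real. continuous_on Y f \<and> bounded {y \<in> Y. f y \<noteq> 0} \<longrightarrow>
        (\<lambda>n. \<integral>y. f y \<partial>\<mu> n) \<longlonglongrightarrow> (\<integral>y. f y \<partial>\<nu>))"

definition weak_continuous_at ::
  "'a::metric_space set \<Rightarrow> 'b::metric_space set \<Rightarrow> ('a \<Rightarrow> 'b measure) \<Rightarrow> 'a \<Rightarrow> bool" where
  "weak_continuous_at X Y \<beta> x0 \<longleftrightarrow>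
     (\<forall>\<xi> :: nat \<Rightarrow> 'a. (\<forall>n. \<xi> n \<in> X) \<and> \<xi> \<longlonglongrightarrow> x0 \<longrightarrow>
        weakly_converges Y (\<lambda>n. \<beta> (\<xi> n)) (\<beta> x0))"

definition belief ::
  "'a set \<Rightarrow> 'b::topological_space set \<Rightarrow> ('a \<Rightarrow> 'b set) \<Rightarrow> ('a \<Rightarrow> 'b measure) \<Rightarrow> bool" where
  "belief X Y S \<beta> \<longleftrightarrow> (\<forall>x\<in>X. \<beta> x \<in> borel_probs Y \<and> emeasure (\<beta> x) (S x) = 1)"

definition has_density ::
  "'a set \<Rightarrow> 'b::euclidean_space set \<Rightarrow> ('a \<Rightarrow> 'b set) \<Rightarrow> ('a \<Rightarrow> 'b measure) \<Rightarrow>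
    ('a \<Rightarrow> 'b \<Rightarrow> real) \<Rightarrow> bool" where
  "has_density X Y S \<beta> \<rho> \<longleftrightarrow>
     (\<forall>x\<in>X. \<forall>y\<in>Y. 0 \<le> \<rho> x y) \<and>
     (\<forall>x\<in>X. let H = hausdorff_measure (adim (S x)) in
        \<rho> x \<in> borel_measurable (restrict_space H (S x)) \<and>
        0 < (\<integral>\<^sup>+y\<in>S x. ennreal (\<rho> x y) \<partial>H) \<and> (\<integral>\<^sup>+y\<in>S x. ennreal (\<rho> x y) \<partial>H) < \<infinity> \<and>
        (\<forall>A\<in>sets (restrict_space borel Y). emeasure (\<beta> x) A =
           (\<integral>\<^sup>+y\<in>A \<inter> S x. ennreal (\<rho> x y) \<partial>H) / (\<integral>\<^sup>+y\<in>S x. ennreal (\<rho> x y) \<partial>H)))"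

definition neutral_belief ::
  "'b::euclidean_space set \<Rightarrow> ('a \<Rightarrow> 'b set) \<Rightarrow> 'a \<Rightarrow> 'b measure" where
  "neutral_belief Y S x =
     measure_of Y (sets (restrict_space borel Y))
       (\<lambda>A. emeasure (hausdorff_measure (adim (S x))) (A \<inter> S x) /
            emeasure (hausdorff_measure (adim (S x))) (S x))"


section \<open>Rectangular continuity\<close>

text \<open>
  Limits as \<open>x \<rightarrow> x0\<close> in \<open>X\<close> follow the convention of set-valued analysis: the point \<open>x0\<close>
  itself is not excluded, in contrast to the filter \<open>at x0 within X\<close>. Hence set limits are
  meaningful at isolated points of \<open>X\<close> as well.
\<close>

definition nhds_in :: "'a::topological_space set \<Rightarrow> 'a \<Rightarrow> 'a filter" where
  "nhds_in X x0 = inf (nhds x0) (principal X)"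

definition inner_limit :: "'a filter \<Rightarrow> ('a \<Rightarrow> 'b::metric_space set) \<Rightarrow> 'b set" where
  "inner_limit F T = {y. \<forall>e>0. \<forall>\<^sub>F x in F. \<exists>z\<in>T x. dist z y < e}"

definition outer_limit :: "'a filter \<Rightarrow> ('a \<Rightarrow> 'b::metric_space set) \<Rightarrow> 'b set" where
  "outer_limit F T = {y. \<forall>e>0. \<exists>\<^sub>F x in F. \<exists>z\<in>T x. dist z y < e}"

definition painleve_kuratowski ::
  "'a filter \<Rightarrow> ('a \<Rightarrow> 'b::metric_space set) \<Rightarrow> 'b set \<Rightarrow> bool" where
  "painleve_kuratowski F T L \<longleftrightarrow> inner_limit F T = L \<and> outer_limit F T = L"

text \<open>The span of the Minkowski difference \<open>A - A\<close> (on sets, \<open>-\<close> denotes set difference).\<close>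

definition direction_space :: "'b::real_vector set \<Rightarrow> 'b set" where
  "direction_space A = span {a - b | a b. a \<in> A \<and> b \<in> A}"

text \<open>
  In \<open>ennreal\<close> one has \<open>0 / 0 = 0\<close>, \<open>a / \<infinity> = 0\<close>, and \<open>a / 0 = \<infinity>\<close> for \<open>a \<noteq> 0\<close>; therefore
  convergence of the quotient to \<open>1\<close> forces both measures to be positive and finite near \<open>x0\<close>.
\<close>

definition rectangularly_continuous_at ::
  "'a::metric_space set \<Rightarrow> ('a \<Rightarrow> 'b::euclidean_space set) \<Rightarrow> 'a \<Rightarrow> bool" where
  "rectangularly_continuous_at X S x0 \<longleftrightarrow>
     (\<exists>T0 T1 R0 R1 :: 'a \<Rightarrow> 'b set.
        (\<forall>\<^sub>F x in nhds_in X x0. T0 x + R0 x \<subseteq> S x \<and> S x \<subseteq> T1 x + R1 x) \<and>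
        (\<forall>(T, R) \<in> {(T0, R0), (T1, R1)}.
           (\<forall>x\<in>X. R x \<subseteq> (direction_space (T x))\<^sup>\<bottom> \<inter> direction_space (S x) \<and>
                  aff_dim (T x) = aff_dim (S x0) \<and>
                  R x \<in> sets (hausdorff_measure (adim (S x) - adim (S x0)))) \<and>
           painleve_kuratowski (nhds_in X x0) R {0} \<and>
           painleve_kuratowski (nhds_in X x0) T (S x0)) \<and>
        ((\<lambda>x. emeasure (hausdorff_measure (adim (S x) - adim (S x0))) (R0 x) /
               emeasure (hausdorff_measure (adim (S x) - adim (S x0))) (R1 x))
           \<longlongrightarrow> 1) (nhds_in X x0))"

definition rectangularly_continuous_on ::
  "'a::metric_space set \<Rightarrow> ('a \<Rightarrow> 'b::euclidean_space set) \<Rightarrow> bool" where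
  "rectangularly_continuous_on X S \<longleftrightarrow> (\<forall>x\<in>X. rectangularly_continuous_at X S x)"

end

theory Submission
  imports Defs
begin

text \<open>
  Since \<open>Y\<close> is compact, \<open>\<rho> x\<close> converges to \<open>\<rho> x0\<close> uniformly on \<open>Y\<close> as \<open>x \<rightarrow> x0\<close>; so it suffices that the
  uniform distributions on \<open>S x\<close> converge weakly, i.e. that the liminf of the fraction of \<open>S x\<close>
  lying in an open set \<open>G\<close> is at least the one for \<open>S x0\<close>.

  In the direction space \<open>W\<close> of \<open>S x\<close>, the Hausdorff measure is a constant \<open>c\<close> times the
  product of the measures on \<open>V\<close> and \<open>V\<^sup>\<bottom> \<inter> W\<close>, where \<open>V\<close> is the direction space of \<open>T\<^sub>0 x\<close> or of
  \<open>T\<^sub>1 x\<close>; \<open>c\<close> depends on the dimensions only. The sandwich then bounds the measure of \<open>S x \<inter> G\<close> from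
  below by \<open>c\<close> times the measures of \<open>conv (T\<^sub>0 x) \<inter> G\<close> and of \<open>R\<^sub>0 x\<close>, and the measure of \<open>S x\<close> from above
  by \<open>c\<close> times the measures of \<open>conv (T\<^sub>1 x)\<close> and of \<open>R\<^sub>1 x\<close>, after points of \<open>T\<^sub>1 x\<close> that are not used
  by \<open>S x\<close> have been removed. In the quotient \<open>c\<close> cancels and the ratio of the measures of the \<open>R\<^sub>j x\<close>
  tends to 1. The convex hulls have the dimension of \<open>S x0\<close> and are close to it, hence so
  are their measures: this follows from the orthogonal projection to the affine hull of \<open>S x0\<close>,
  which is 1-Lipschitz and whose inverse on the affine hull of \<open>T\<^sub>1 x\<close> has Lipschitz constant close to 1.
\<close>

subsection \<open>Lipschitz comparison and Borel measurability\<close>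

text \<open>The sets \<open>T\<^sub>j x\<close> are assumed neither convex nor closed nor
  measurable, their two direction spaces need not agree with each other nor with that of
  \<open>S x0\<close>, and Painleve-Kuratowski limits say nothing about points that escape to
  infinity. This shapes the proof. The estimates use outer measures, convex hulls in place of
  \<open>T\<^sub>j x\<close>, and one product constant valid for every orthogonal pair of subspaces
  of given dimensions, so that the lower and the upper bound may split \<open>W\<close> differently.
  Boundedness comes from \<open>S x\<close>: since \<open>R\<^sub>1 x\<close> is orthogonal to the
  directions of \<open>T\<^sub>1 x\<close>, a sum lying in \<open>S x\<close> has both summands
  bounded. In the lower bound the points of \<open>conv (T\<^sub>0 x)\<close> are displaced by
  \<open>R\<^sub>0 x\<close>, so the open set is first shrunk by a margin
  \<open>\<delta>\<close>.\<close>

lemma hausdorff_outer_mono: "A \<subseteq> B \<Longrightarrow> hausdorff_outer k A \<le> hausdorff_outer k B"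
  using outer_measure_space_hausdorff_outer[of k] by (auto simp: outer_measure_space_def increasing_def)

lemma hausdorff_outer_empty [simp]: "hausdorff_outer k {} = 0"
  using outer_measure_space_hausdorff_outer[of k] by (auto simp: outer_measure_space_def positive_def)

lemma diameter_le_dist:
  assumes "0 \<le> d" "\<And>x y. x \<in> A \<Longrightarrow> y \<in> A \<Longrightarrow> dist x y \<le> d"
  shows "diameter A \<le> d"
  using assms by (auto simp: diameter_def intro!: cSUP_least)

text \<open>Covers of \<open>C\<close> are pulled back along \<open>g\<close>, which multiplies
  diameters by at most \<open>L\<close>. This is the Lipschitz estimate for the inverse of
  \<open>g\<close>, phrased without an inverse so that it applies to maps that are only chosen
  pointwise.\<close>

lemma hausdorff_outer_expansion:
  fixes g :: "'a::metric_space \<Rightarrow> 'b::metric_space"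
  assumes L: "L > 0" and g: "\<And>x. x \<in> A \<Longrightarrow> g x \<in> C"
    and exp: "\<And>x y. x \<in> A \<Longrightarrow> y \<in> A \<Longrightarrow> dist x y \<le> L * dist (g x) (g y)"
  shows "hausdorff_outer k A \<le> ennreal (L ^ k) * hausdorff_outer k C"
  unfolding hausdorff_outer_def[of k A]
proof (rule SUP_least)
  fix \<delta> :: real assume "\<delta> \<in> {0<..}"
  then have \<delta>: "\<delta> > 0" by simp
  let ?I = "INF U\<in>fine_covers \<delta> A. \<Sum>i. hausdorff_gauge k (U i)"
  \<comment> \<open>The scale \<open>\<delta> / L\<close> on the side of \<open>C\<close> becomes
    the scale \<open>\<delta>\<close> after pulling back.\<close>
  have *: "?I \<le> ennreal (L ^ k) * (\<Sum>i. hausdorff_gauge k (U i))" if U: "U \<in> fine_covers (\<delta> / L) C" for U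
  proof -
    define V where "V i = {x \<in> A. g x \<in> U i}" for i
    have bU: "bounded (U i)" "diameter (U i) \<le> \<delta> / L" for i
      using U by (auto simp: fine_covers_def)
    have dV: "dist x y \<le> L * diameter (U i)" if "x \<in> V i" "y \<in> V i" for x y i
    proof -
      have "dist x y \<le> L * dist (g x) (g y)" using that exp by (auto simp: V_def)
      also have "\<dots> \<le> L * diameter (U i)"
        using that L bU by (intro mult_left_mono diameter_bounded_bound) (auto simp: V_def)
      finally show ?thesis .
    qed
    have bV: "bounded (V i)" for i
    proof (cases "V i = {}")
      case False
      then obtain x where "x \<in> V i" by auto
      then show ?thesis using dV unfolding bounded_def by blast
    qed auto
    have diamV: "diameter (V i) \<le> L * diameter (U i)" for i
      using dV L diameter_ge_0[OF bU(1)[of i]] by (intro diameter_le_dist) auto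
    have "V \<in> fine_covers \<delta> A"
      unfolding fine_covers_def
    proof (intro CollectI conjI allI subsetI)
      fix i
      show "bounded (V i)" by (rule bV)
      have "L * diameter (U i) \<le> L * (\<delta> / L)" using L bU(2)[of i] by (intro mult_left_mono) auto
      then show "diameter (V i) \<le> \<delta>" using diamV[of i] L by simp
    next
      fix x assume "x \<in> A"
      then show "x \<in> (\<Union>i. V i)"
        using U g by (fastforce simp: V_def fine_covers_def)
    qed
    then have "?I \<le> (\<Sum>i. hausdorff_gauge k (V i))" by (rule INF_lower)
    also have "\<dots> \<le> (\<Sum>i. ennreal (L ^ k) * hausdorff_gauge k (U i))"
    proof (intro suminf_le allI)
      fix i
      show "hausdorff_gauge k (V i) \<le> ennreal (L ^ k) * hausdorff_gauge k (U i)"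
      proof (cases "V i = {}")
        case False
        then have ne: "U i \<noteq> {}" by (auto simp: V_def)
        have "(diameter (V i) / 2) ^ k \<le> (L * (diameter (U i) / 2)) ^ k"
          using diamV[of i] diameter_ge_0[OF bV[of i]] by (intro power_mono) auto
        then have "unit_ball_vol (real k) * (diameter (V i) / 2) ^ k
            \<le> L ^ k * (unit_ball_vol (real k) * (diameter (U i) / 2) ^ k)"
          unfolding power_mult_distrib
          by (metis mult.left_commute mult_left_mono unit_ball_vol_nonneg of_nat_0_le_iff)
        then show ?thesis using False ne L
          by (simp add: hausdorff_gauge_def ennreal_mult'[symmetric] ennreal_leI)
      qed (simp add: hausdorff_gauge_def)
    qed auto
    also have "\<dots> = ennreal (L ^ k) * (\<Sum>i. hausdorff_gauge k (U i))" by simp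
    finally show ?thesis .
  qed
  have one: "ennreal (L ^ k) * ennreal (1 / L ^ k) = 1"
    using L by (simp add: ennreal_mult'[symmetric])
  have "ennreal (1 / L ^ k) * ?I \<le> (INF U\<in>fine_covers (\<delta> / L) C. \<Sum>i. hausdorff_gauge k (U i))"
  proof (rule INF_greatest)
    fix U assume "U \<in> fine_covers (\<delta> / L) C"
    from mult_left_mono[OF *[OF this], of "ennreal (1 / L ^ k)"]
    show "ennreal (1 / L ^ k) * ?I \<le> (\<Sum>i. hausdorff_gauge k (U i))"
      using one by (simp add: mult.assoc[symmetric] mult.commute[of "ennreal (1 / L ^ k)"])
  qed
  also have "\<dots> \<le> hausdorff_outer k C"
    unfolding hausdorff_outer_def using \<delta> L by (intro SUP_upper) auto
  finally have "ennreal (L ^ k) * (ennreal (1 / L ^ k) * ?I) \<le> ennreal (L ^ k) * hausdorff_outer k C"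
    by (rule mult_left_mono) simp
  then show "?I \<le> ennreal (L ^ k) * hausdorff_outer k C"
    using one by (simp add: mult.assoc[symmetric])
qed

lemma hausdorff_outer_isometric_image:
  fixes f :: "'a::metric_space \<Rightarrow> 'b::metric_space"
  assumes iso: "\<And>x y. x \<in> A \<Longrightarrow> y \<in> A \<Longrightarrow> dist (f x) (f y) = dist x y"
  shows "hausdorff_outer k (f ` A) = hausdorff_outer k A"
proof (rule antisym)
  show "hausdorff_outer k A \<le> hausdorff_outer k (f ` A)"
    using hausdorff_outer_expansion[of 1 A f "f ` A" k] iso by simp
  have "f (inv_into A f y) = y" "inv_into A f y \<in> A" if "y \<in> f ` A" for y
    using that by (auto simp: f_inv_into_f inv_into_into)
  then show "hausdorff_outer k (f ` A) \<le> hausdorff_outer k A"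
    using hausdorff_outer_expansion[of 1 "f ` A" "inv_into A f" A k] iso
    by (metis ennreal_1 mult_1 order_refl power_one zero_less_one)
qed

lemma hausdorff_outer_translation:
  fixes A :: "'a::real_normed_vector set"
  shows "hausdorff_outer k ((\<lambda>x. a + x) ` A) = hausdorff_outer k A"
  by (rule hausdorff_outer_isometric_image) simp

lemma hausdorff_outer_UN:
  fixes A :: "nat \<Rightarrow> 'a::metric_space set"
  shows "hausdorff_outer k (\<Union>i. A i) \<le> (\<Sum>i. hausdorff_outer k (A i))"
proof -
  \<comment> \<open>\<open>countably_subadditive\<close> speaks of disjoint families, so the sets
    are made disjoint first; monotonicity then restores the original ones.\<close>
  have "hausdorff_outer k (\<Union>i. disjointed A i) \<le> (\<Sum>i. hausdorff_outer k (disjointed A i))"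
    using outer_measure_space_hausdorff_outer[of k, where 'a='a] disjoint_family_disjointed[of A]
    unfolding outer_measure_space_def countably_subadditive_def by blast
  also have "\<dots> \<le> (\<Sum>i. hausdorff_outer k (A i))"
    by (intro suminf_le allI hausdorff_outer_mono disjointed_subset) auto
  finally show ?thesis by (simp add: UN_disjointed_eq)
qed

lemma hausdorff_outer_Un: "hausdorff_outer k (A \<union> B) \<le> hausdorff_outer k A + hausdorff_outer k B"
proof -
  let ?F = "\<lambda>i::nat. if i = 0 then A else if i = 1 then B else {}"
  have "hausdorff_outer k (\<Union>i. ?F i) \<le> (\<Sum>i. hausdorff_outer k (?F i))"
    by (rule hausdorff_outer_UN)
  moreover have "(\<Union>i. ?F i) = A \<union> B" by (auto split: if_splits)
  moreover have "(\<Sum>i. hausdorff_outer k (?F i)) = (\<Sum>i<2. hausdorff_outer k (?F i))"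
    by (rule suminf_finite) auto
  ultimately show ?thesis by (simp add: numeral_2_eq_2)
qed

text \<open>A set of diameter less than \<open>d\<close> cannot meet both \<open>A\<close> and
  \<open>B\<close>, so a fine cover of the union splits into a cover of \<open>A\<close> and a cover
  of \<open>B\<close>.\<close>

lemma hausdorff_outer_separated:
  assumes d: "d > 0" and sep: "\<And>a b. a \<in> A \<Longrightarrow> b \<in> B \<Longrightarrow> d \<le> dist a b"
  shows "hausdorff_outer k A + hausdorff_outer k B \<le> hausdorff_outer k (A \<union> B)"
proof -
  let ?h = "\<lambda>\<delta> A. INF U\<in>fine_covers \<delta> A. \<Sum>i. hausdorff_gauge k (U i)"
  have anti: "?h \<delta> C \<le> ?h \<delta>' C" if "\<delta>' \<le> \<delta>" for \<delta> \<delta>' C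
  proof (rule INF_superset_mono)
    show "fine_covers \<delta>' C \<subseteq> fine_covers \<delta> C"
      using that by (auto simp: fine_covers_def intro: order_trans)
  qed simp
  have main: "?h \<delta> A + ?h \<delta> B \<le> ?h \<delta> (A \<union> B)" if "\<delta> < d" for \<delta>
  proof (rule INF_greatest)
    fix U assume U: "U \<in> fine_covers \<delta> (A \<union> B)"
    then have d0: "\<delta> \<ge> 0"
      using diameter_ge_0 by (force simp: fine_covers_def intro: order_trans)
    \<comment> \<open>Each \<open>U i\<close> goes to exactly one of the two covers and is replaced
      by the empty set, of gauge 0, in the other.\<close>
    define V where "V i = (if U i \<inter> A = {} then {} else U i)" for i
    define W where "W i = (if U i \<inter> A = {} then U i else {})" for i
    have "V \<in> fine_covers \<delta> A"
      using U d0 by (auto simp: fine_covers_def V_def) blast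
    then have 1: "?h \<delta> A \<le> (\<Sum>i. hausdorff_gauge k (V i))" by (rule INF_lower)
    have "W \<in> fine_covers \<delta> B"
      unfolding fine_covers_def
    proof (intro CollectI conjI allI subsetI)
      fix b assume b: "b \<in> B"
      then obtain i where i: "b \<in> U i" using U by (force simp: fine_covers_def)
      have "U i \<inter> A = {}"
      proof (rule ccontr)
        assume "U i \<inter> A \<noteq> {}"
        then obtain a where a: "a \<in> U i" "a \<in> A" by auto
        have "dist a b \<le> diameter (U i)"
          using U a i by (intro diameter_bounded_bound) (auto simp: fine_covers_def)
        also have "\<dots> \<le> \<delta>" using U by (auto simp: fine_covers_def)
        finally show False using sep[OF a(2) b] \<open>\<delta> < d\<close> by simp
      qed
      then show "b \<in> (\<Union>i. W i)" using i by (auto simp: W_def)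
    qed (use U d0 in \<open>auto simp: fine_covers_def W_def\<close>)
    then have 2: "?h \<delta> B \<le> (\<Sum>i. hausdorff_gauge k (W i))" by (rule INF_lower)
    have "(\<Sum>i. hausdorff_gauge k (V i)) + (\<Sum>i. hausdorff_gauge k (W i))
        = (\<Sum>i. hausdorff_gauge k (V i) + hausdorff_gauge k (W i))"
      by (rule suminf_add) auto
    also have "\<dots> = (\<Sum>i. hausdorff_gauge k (U i))"
      by (intro arg_cong[where f=suminf] ext) (auto simp: V_def W_def hausdorff_gauge_def)
    finally show "?h \<delta> A + ?h \<delta> B \<le> (\<Sum>i. hausdorff_gauge k (U i))"
      using add_mono[OF 1 2] by simp
  qed
  \<comment> \<open>The infimum grows as the scale shrinks, so two independent scales can be
    replaced by a common one, which is also kept below \<open>d\<close>.\<close>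
  have *: "?h \<delta> A + ?h \<delta>' B \<le> hausdorff_outer k (A \<union> B)" if "\<delta> > 0" "\<delta>' > 0" for \<delta> \<delta>'
  proof -
    let ?m = "min (min \<delta> \<delta>') (d / 2)"
    have "?h \<delta> A + ?h \<delta>' B \<le> ?h ?m A + ?h ?m B"
      by (intro add_mono anti) auto
    also have "\<dots> \<le> ?h ?m (A \<union> B)" using d by (intro main) auto
    also have "\<dots> \<le> hausdorff_outer k (A \<union> B)"
      unfolding hausdorff_outer_def using that d by (intro SUP_upper) auto
    finally show ?thesis .
  qed
  have "hausdorff_outer k A + hausdorff_outer k B
      = (SUP \<delta>\<in>{0<..}. SUP \<delta>'\<in>{0<..}. ?h \<delta> A + ?h \<delta>' B)"
    by (subst (1 2) hausdorff_outer_def)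
       (simp add: ennreal_SUP_add_left[symmetric] ennreal_SUP_add_right[symmetric])
  also have "\<dots> \<le> hausdorff_outer k (A \<union> B)"
    using * by (intro SUP_least) auto
  finally show ?thesis .
qed

text \<open>Caratheodory's criterion: the shells \<open>Sh n\<close> around \<open>C\<close> with indices of equal parity are
  mutually separated, hence their measures are summable.\<close>

lemma closed_in_sets_hausdorff:
  fixes C :: "'a::metric_space set"
  assumes C: "closed C"
  shows "C \<in> sets (hausdorff_measure k)"
proof (cases "C = {}")
  case False
  let ?H = "hausdorff_outer k :: 'a set \<Rightarrow> ennreal"
  have "?H (C \<inter> E) + ?H ((UNIV - C) \<inter> E) = ?H E" for E
  proof (rule antisym)
    show "?H E \<le> ?H (C \<inter> E) + ?H ((UNIV - C) \<inter> E)"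
      using hausdorff_outer_Un[of k "C \<inter> E" "(UNIV - C) \<inter> E"] by (simp add: Int_Un_distrib2[symmetric])
    show "?H (C \<inter> E) + ?H ((UNIV - C) \<inter> E) \<le> ?H E"
    proof (cases "?H E < top")
      case fin: True
      define E' where "E' = (UNIV - C) \<inter> E"
      define B where "B n = {x \<in> E'. infdist x C \<ge> 1 / real (Suc n)}" for n
      define Sh where "Sh n = B (Suc n) - B n" for n
      have pos: "infdist x C > 0" if "x \<in> E'" for x
        using that C False in_closed_iff_infdist_zero[of C x] infdist_nonneg[of x C]
        by (auto simp: E'_def less_le)
      have UB: "E' = (\<Union>n. B n)"
      proof -
        have "\<exists>n. infdist x C \<ge> 1 / real (Suc n)" if "x \<in> E'" for x
          using nat_approx_posE[OF pos[OF that]] by (metis less_imp_le)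
        then show ?thesis by (auto simp: B_def)
      qed
      have Bmono: "B m \<subseteq> B n" if "m \<le> n" for m n
      proof -
        have "1 / real (Suc n) \<le> 1 / real (Suc m)" using that by (simp add: frac_le)
        then show ?thesis by (auto simp: B_def)
      qed
      have sepSh: "dist x y \<ge> 1 / real (Suc n) - 1 / real (Suc (Suc n))"
        if "x \<in> B n" "y \<notin> B (Suc n)" "y \<in> E'" for x y n
      proof -
        have "infdist x C \<le> infdist y C + dist x y" by (rule infdist_triangle)
        then show ?thesis using that by (auto simp: B_def)
      qed
      have gap: "1 / real (Suc n) - 1 / real (Suc (Suc n)) > 0" for n
        by (simp add: frac_less2)
      have sumSh: "(\<Sum>i<n. ?H (Sh (2 * i + p))) \<le> ?H (\<Union>i<n. Sh (2 * i + p))" for n p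
      proof (induction n)
        case (Suc n)
        have "?H (\<Union>i<n. Sh (2 * i + p)) + ?H (Sh (2 * n + p))
          \<le> ?H ((\<Union>i<n. Sh (2 * i + p)) \<union> Sh (2 * n + p))"
        proof (cases n)
          case (Suc m)
          \<comment> \<open>With \<open>n = Suc m\<close>, the earlier shells lie in
            \<open>B (2*m+p+1)\<close>, while the new shell avoids \<open>B (2*m+p+2)\<close>. The
            skipped shell of the other parity provides the gap.\<close>
          show ?thesis
          proof (rule hausdorff_outer_separated[OF gap[of "2*m+p+1"]])
            fix a b assume a: "a \<in> (\<Union>i<n. Sh (2 * i + p))" and b: "b \<in> Sh (2 * n + p)"
            from a obtain i where i: "i < n" "a \<in> Sh (2 * i + p)" by auto
            then have "a \<in> B (2*m+p+1)"
              using Bmono[of "2*i+p+1" "2*m+p+1"] Suc by (auto simp: Sh_def)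
            moreover have "b \<notin> B (Suc (2*m+p+1))" "b \<in> E'"
              using b Suc by (auto simp: Sh_def B_def)
            ultimately show "1 / real (Suc (2*m+p+1)) - 1 / real (Suc (Suc (2*m+p+1))) \<le> dist a b"
              by (rule sepSh)
          qed
        qed simp
        then show ?case using Suc by (simp add: lessThan_Suc Un_commute add.commute)
           (metis (no_types, lifting) add_left_mono order_trans)
      qed simp
      have bndSh: "(\<Sum>i<n. ?H (Sh (2 * i + p))) \<le> ?H E" for n p
        by (rule order_trans[OF sumSh]) (auto intro!: hausdorff_outer_mono simp: Sh_def B_def E'_def)
      have "(\<Sum>i. ?H (Sh i)) < top"
      proof -
        have "(\<Sum>i<m. ?H (Sh i)) \<le> ?H E + ?H E" for m
        proof -
          have "(\<Sum>i<m. ?H (Sh i)) \<le> (\<Sum>i<2*m. ?H (Sh i))"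
            by (intro sum_mono2) auto
          also have "\<dots> = (\<Sum>i<m. ?H (Sh (2*i))) + (\<Sum>i<m. ?H (Sh (2*i+1)))"
            by (induction m) (auto simp: algebra_simps)
          also have "\<dots> \<le> ?H E + ?H E"
            using bndSh[of 0 m] bndSh[of 1 m] by (intro add_mono) auto
          finally show ?thesis .
        qed
        then have "(\<Sum>i. ?H (Sh i)) \<le> ?H E + ?H E"
          by (simp add: suminf_eq_SUP SUP_least)
        then show ?thesis using fin by (auto simp: less_top[symmetric] top_unique)
      qed
      \<comment> \<open>The shells have finite total measure, so the tails of the series can be
        computed in the reals, where subtraction of partial sums is available.\<close>
      then have tail: "(\<lambda>n. \<Sum>i. ?H (Sh (i + n))) \<longlonglongrightarrow> 0"
      proof -
        define g where "g i = enn2real (?H (Sh i))" for i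
        have g: "?H (Sh i) = ennreal (g i)" for i
          unfolding g_def using \<open>(\<Sum>i. ?H (Sh i)) < top\<close> ennreal_suminf_lessD
          by (metis ennreal_enn2real)
        have g0: "0 \<le> g i" for i by (simp add: g_def)
        have sg: "summable g"
          using \<open>(\<Sum>i. ?H (Sh i)) < top\<close> g0 unfolding g
          by (intro summable_suminf_not_top) auto
        have "(\<lambda>n. ennreal (\<Sum>i. g (i + n))) \<longlonglongrightarrow> ennreal 0"
        proof (intro tendsto_ennrealI)
          have "(\<lambda>n. suminf g - (\<Sum>i<n. g i)) \<longlonglongrightarrow> suminf g - suminf g"
            by (intro tendsto_diff tendsto_const summable_LIMSEQ sg)
          then show "(\<lambda>n. \<Sum>i. g (i + n)) \<longlonglongrightarrow> 0"
            by (simp add: suminf_minus_initial_segment[OF sg])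
        qed
        moreover have "(\<Sum>i. ennreal (g (i + n))) = ennreal (\<Sum>i. g (i + n))" for n
          using g0 sg by (intro suminf_ennreal2) (auto simp: summable_iff_shift)
        ultimately show ?thesis by (simp add: g)
      qed
      have HE': "?H E' \<le> ?H (B n) + (\<Sum>i. ?H (Sh (i + n)))" for n
      proof -
        have "E' \<subseteq> B n \<union> (\<Union>i. Sh (i + n))"
        proof
          fix x assume x: "x \<in> E'"
          show "x \<in> B n \<union> (\<Union>i. Sh (i + n))"
          proof (cases "x \<in> B n")
            case False
            \<comment> \<open>The first index whose set contains \<open>x\<close> exceeds
              \<open>n\<close>, hence is positive, and \<open>x\<close> lies in the shell just
              before it.\<close>
            define m where "m = (LEAST m. x \<in> B m)"
            have m: "x \<in> B m" using x UB unfolding m_def by (auto intro: LeastI)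
            have "m > n" using Bmono[of m n] m False by (meson linorder_not_le subsetD)
            moreover have "x \<notin> B (m - 1)" using not_less_Least[of "m - 1" "\<lambda>m. x \<in> B m"] calculation
              by (simp add: m_def[symmetric])
            ultimately have "x \<in> Sh ((m - 1 - n) + n)" using m by (auto simp: Sh_def)
            then show ?thesis by blast
          qed auto
        qed
        then have "?H E' \<le> ?H (B n \<union> (\<Union>i. Sh (i + n)))" by (rule hausdorff_outer_mono)
        also have "\<dots> \<le> ?H (B n) + ?H (\<Union>i. Sh (i + n))" by (rule hausdorff_outer_Un)
        finally show ?thesis using hausdorff_outer_UN[of k "\<lambda>i. Sh (i + n)"]
          by (meson add_left_mono order_trans)
      qed
      \<comment> \<open>\<open>C\<close> and \<open>B n\<close> are at distance at least
        \<open>1 / Suc n\<close>, so additivity holds for them; what \<open>B n\<close> misses of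
        \<open>E'\<close> is controlled by the tail.\<close>
      have "?H (C \<inter> E) + ?H E' \<le> ?H E + (\<Sum>i. ?H (Sh (i + n)))" for n
      proof -
        have "?H (C \<inter> E) + ?H (B n) \<le> ?H (C \<inter> E \<union> B n)"
        proof (rule hausdorff_outer_separated[of "1 / real (Suc n)"])
          fix a b assume "a \<in> C \<inter> E" "b \<in> B n"
          then show "1 / real (Suc n) \<le> dist a b"
            using infdist_le[of a C b] by (auto simp: B_def dist_commute)
        qed simp
        also have "\<dots> \<le> ?H E" by (intro hausdorff_outer_mono) (auto simp: B_def E'_def)
        finally show ?thesis using HE'[of n]
          by (smt (verit) add.assoc add_left_mono add_right_mono order_trans)
      qed
      moreover have "(\<lambda>n. ?H E + (\<Sum>i. ?H (Sh (i + n)))) \<longlonglongrightarrow> ?H E + 0"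
        by (intro tendsto_add tendsto_const tail)
      ultimately show ?thesis
        unfolding E'_def by (intro LIMSEQ_le_const) auto
    qed (simp add: not_less top_unique)
  qed
  then show ?thesis by (auto simp: sets_hausdorff_measure lambda_system_def)
qed simp

lemma borel_subset_sets_hausdorff: "sets borel \<subseteq> sets (hausdorff_measure k :: 'a::metric_space measure)"
proof -
  have "sigma_sets UNIV (Collect closed) \<subseteq> sets (hausdorff_measure k :: 'a measure)"
    by (metis closed_in_sets_hausdorff mem_Collect_eq sets.sigma_sets_subset space_hausdorff_measure subsetI)
  then show ?thesis by (simp add: borel_eq_closed)
qed

subsection \<open>Balls in subspaces have positive finite measure\<close>

text \<open>The empty set has gauge 0 also for \<open>k = 0\<close>, so padding a finite cover to a
  sequence costs nothing.\<close>

lemma hausdorff_outer_le_finite_covers: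
  fixes A :: "'a::metric_space set"
  assumes cov: "\<And>\<delta>. \<delta> > 0 \<Longrightarrow> \<exists>I (U :: 'i \<Rightarrow> 'a set). finite I \<and> A \<subseteq> (\<Union>i\<in>I. U i) \<and>
      (\<forall>i\<in>I. bounded (U i) \<and> diameter (U i) \<le> \<delta>) \<and> (\<Sum>i\<in>I. hausdorff_gauge k (U i)) \<le> c"
  shows "hausdorff_outer k A \<le> c"
  unfolding hausdorff_outer_def
proof (rule SUP_least)
  fix \<delta> :: real assume "\<delta> \<in> {0<..}"
  then have \<delta>: "\<delta> > 0" by simp
  from cov[OF this] obtain I and U :: "'i \<Rightarrow> 'a set" where I: "finite I" "A \<subseteq> (\<Union>i\<in>I. U i)"
    and U: "\<And>i. i \<in> I \<Longrightarrow> bounded (U i)" "\<And>i. i \<in> I \<Longrightarrow> diameter (U i) \<le> \<delta>"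
    and c: "(\<Sum>i\<in>I. hausdorff_gauge k (U i)) \<le> c" by blast
  obtain h where h: "bij_betw h {0..<card I} I" using ex_bij_betw_nat_finite[OF I(1)] ..
  define V where "V n = (if n < card I then U (h n) else {})" for n
  have hI: "h n \<in> I" if "n < card I" for n using h that by (auto simp: bij_betw_def)
  have "A \<subseteq> (\<Union>n. V n)"
  proof
    fix x assume "x \<in> A"
    then obtain i where "i \<in> I" "x \<in> U i" using I(2) by auto
    moreover obtain n where "n < card I" "h n = i"
      using h \<open>i \<in> I\<close> unfolding bij_betw_def by (metis atLeastLessThan_iff imageE)
    ultimately have "x \<in> V n" by (simp add: V_def)
    then show "x \<in> (\<Union>n. V n)" by blast
  qed
  then have "V \<in> fine_covers \<delta> A"
    using U hI \<delta> by (auto simp: fine_covers_def V_def)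
  then have "(INF U\<in>fine_covers \<delta> A. \<Sum>i. hausdorff_gauge k (U i)) \<le> (\<Sum>n. hausdorff_gauge k (V n))"
    by (rule INF_lower)
  also have "\<dots> = (\<Sum>n\<in>{0..<card I}. hausdorff_gauge k (V n))"
    by (rule suminf_finite) (auto simp: V_def hausdorff_gauge_def)
  also have "\<dots> = (\<Sum>n\<in>{0..<card I}. hausdorff_gauge k (U (h n)))"
    by (intro sum.cong) (auto simp: V_def)
  also have "\<dots> = (\<Sum>i\<in>I. hausdorff_gauge k (U i))"
    by (rule sum.reindex_bij_betw[OF h])
  finally show "(INF U\<in>fine_covers \<delta> A. \<Sum>i. hausdorff_gauge k (U i)) \<le> c" using c by simp
qed

lemma norm_le_l1_span_Basis:
  fixes x :: "'a::euclidean_space"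
  assumes B: "B \<subseteq> Basis" and x: "x \<in> span B"
  shows "norm x \<le> (\<Sum>b\<in>B. \<bar>x \<bullet> b\<bar>)"
proof -
  have "norm x \<le> (\<Sum>b\<in>Basis. \<bar>x \<bullet> b\<bar>)" by (rule norm_le_l1)
  also have "\<dots> = (\<Sum>b\<in>B. \<bar>x \<bullet> b\<bar>)"
    using B x by (intro sum.mono_neutral_right) (auto simp: span_substd_basis)
  finally show ?thesis .
qed

text \<open>The cube of half side \<open>R\<close> in \<open>span B\<close> is cut into
  \<open>N ^ k\<close> cells of side \<open>2 * R / N\<close>. Their diameters are at most
  \<open>k\<close> times the side, so the powers of \<open>N\<close> cancel in the sum of the gauges
  and the bound is uniform in the scale.\<close>

lemma hausdorff_outer_coordinate_ball_finite:
  fixes B :: "'a::euclidean_space set"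
  assumes B: "B \<subseteq> Basis" and R: "R > 0"
  shows "hausdorff_outer (card B) (span B \<inter> cball 0 R) < top"
proof -
  define k where "k = card B"
  have finB: "finite B" using B finite_Basis finite_subset by blast
  have "hausdorff_outer k (span B \<inter> cball 0 R) \<le> ennreal (unit_ball_vol (real k) * (real k * R) ^ k)"
  proof (rule hausdorff_outer_le_finite_covers[where 'i="'a \<Rightarrow> nat"])
    fix \<delta> :: real assume \<delta>: "\<delta> > 0"
    obtain N0 where N0: "real k * (2 * R) / \<delta> < real N0" using reals_Archimedean2 by blast
    define N where "N = Suc N0"
    have N: "N > 0" "real k * (2 * R / real N) \<le> \<delta>"
      using N0 \<delta> by (auto simp: N_def field_simps)
    define cell where "cell j = {x \<in> span B. \<forall>b\<in>B. - R + 2 * R / real N * real (j b) \<le> x \<bullet> b \<and>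
        x \<bullet> b \<le> - R + 2 * R / real N * (real (j b) + 1)}" for j :: "'a \<Rightarrow> nat"
    define I where "I = PiE B (\<lambda>_. {..<N})"
    have dist_cell: "dist x y \<le> real k * (2 * R / real N)" if "x \<in> cell j" "y \<in> cell j" for x y j
    proof -
      have "dist x y \<le> (\<Sum>b\<in>B. \<bar>(x - y) \<bullet> b\<bar>)"
        unfolding dist_norm using that by (intro norm_le_l1_span_Basis B span_diff) (auto simp: cell_def)
      also have "\<dots> \<le> (\<Sum>b\<in>B. 2 * R / real N)"
      proof (rule sum_mono)
        fix b assume "b \<in> B"
        with that have "- R + 2 * R / real N * real (j b) \<le> x \<bullet> b"
          "x \<bullet> b \<le> - R + 2 * R / real N * real (j b) + 2 * R / real N"
          "- R + 2 * R / real N * real (j b) \<le> y \<bullet> b"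
          "y \<bullet> b \<le> - R + 2 * R / real N * real (j b) + 2 * R / real N"
          by (auto simp: cell_def distrib_left)
        then show "\<bar>(x - y) \<bullet> b\<bar> \<le> 2 * R / real N"
          unfolding inner_diff_left by linarith
      qed
      finally show ?thesis by (simp add: k_def)
    qed
    have bcell: "bounded (cell j)" for j
    proof (cases "cell j = {}")
      case False
      then obtain x where "x \<in> cell j" by auto
      then show ?thesis using dist_cell unfolding bounded_def by blast
    qed auto
    have dcell: "diameter (cell j) \<le> real k * (2 * R / real N)" for j
      using dist_cell R by (intro diameter_le_dist) auto
    have "span B \<inter> cball 0 R \<subseteq> (\<Union>j\<in>I. cell j)"
    proof
      fix x assume x: "x \<in> span B \<inter> cball 0 R"
      have "\<exists>i<N. - R + 2 * R / real N * real i \<le> x \<bullet> b \<and> x \<bullet> b \<le> - R + 2 * R / real N * (real i + 1)"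
        if "b \<in> B" for b
      proof -
        define z where "z = (x \<bullet> b + R) * real N / (2 * R)"
        have "\<bar>x \<bullet> b\<bar> \<le> norm x" using that B by (intro Basis_le_norm) auto
        then have xb: "- R \<le> x \<bullet> b" "x \<bullet> b \<le> R" using x by auto
        have xz: "x \<bullet> b = - R + 2 * R / real N * z" using N R by (simp add: z_def field_simps)
        have z0: "0 \<le> z" using xb R by (simp add: z_def)
        have zN: "z \<le> real N" using xb R N by (simp add: z_def field_simps)
        have "\<exists>i<N. real i \<le> z \<and> z \<le> real i + 1"
        proof (cases "z < real N")
          case True
          have "nat \<lfloor>z\<rfloor> < N" using True z0 by linarith
          moreover have "real (nat \<lfloor>z\<rfloor>) \<le> z" "z \<le> real (nat \<lfloor>z\<rfloor>) + 1" using z0 by linarith+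
          ultimately show ?thesis by blast
        next
          \<comment> \<open>Here \<open>z = N\<close>: the point lies on the upper face and belongs
            to the last cell.\<close>
          case False
          then show ?thesis using zN N by (intro exI[of _ "N - 1"]) (auto simp: of_nat_diff)
        qed
        then obtain i where i: "i < N" "real i \<le> z" "z \<le> real i + 1" by blast
        have "2 * R / real N \<ge> 0" using R by simp
        then have "2 * R / real N * real i \<le> 2 * R / real N * z"
            "2 * R / real N * z \<le> 2 * R / real N * (real i + 1)"
          by (rule mult_left_mono[OF i(2)], rule mult_left_mono[OF i(3)])
        then show ?thesis using i(1) xz by auto
      qed
      then obtain j where j: "\<And>b. b \<in> B \<Longrightarrow> j b < N \<and> - R + 2 * R / real N * real (j b) \<le> x \<bullet> b \<and>
          x \<bullet> b \<le> - R + 2 * R / real N * (real (j b) + 1)" by metis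
      have "restrict j B \<in> I" using j by (auto simp: I_def)
      moreover have "x \<in> cell (restrict j B)" using j x by (auto simp: cell_def)
      ultimately show "x \<in> (\<Union>j\<in>I. cell j)" by blast
    qed
    moreover have "finite I" using finB by (auto simp: I_def intro: finite_PiE)
    moreover have "(\<Sum>j\<in>I. hausdorff_gauge k (cell j)) \<le> ennreal (unit_ball_vol (real k) * (real k * R) ^ k)"
    proof -
      have "(\<Sum>j\<in>I. hausdorff_gauge k (cell j))
          \<le> (\<Sum>j\<in>I. ennreal (unit_ball_vol (real k) * (real k * (R / real N)) ^ k))"
      proof (rule sum_mono)
        fix j
        have e: "real k * (2 * R / real N) = 2 * (real k * (R / real N))" by simp
        have "diameter (cell j) / 2 \<le> real k * (R / real N)" using dcell[of j] unfolding e by linarith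
        then have "unit_ball_vol (real k) * (diameter (cell j) / 2) ^ k
            \<le> unit_ball_vol (real k) * (real k * (R / real N)) ^ k"
          using dcell[of j] diameter_ge_0[OF bcell[of j]]
          by (intro mult_left_mono power_mono) auto
        then show "hausdorff_gauge k (cell j) \<le> ennreal (unit_ball_vol (real k) * (real k * (R / real N)) ^ k)"
          by (auto simp: hausdorff_gauge_def intro: ennreal_leI)
      qed
      also have "\<dots> = ennreal (real (card I) * (unit_ball_vol (real k) * (real k * (R / real N)) ^ k))"
        using R by (simp add: ennreal_mult ennreal_of_nat_eq_real_of_nat)
      also have "card I = N ^ k" using finB by (simp add: I_def card_PiE k_def)
      also have "real (N ^ k) * (unit_ball_vol (real k) * (real k * (R / real N)) ^ k)
          = unit_ball_vol (real k) * (real k * R) ^ k"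
        using N by (simp add: power_mult_distrib power_divide)
      finally show ?thesis .
    qed
    ultimately show "\<exists>I (U :: ('a \<Rightarrow> nat) \<Rightarrow> 'a set). finite I \<and> span B \<inter> cball 0 R \<subseteq> (\<Union>i\<in>I. U i) \<and>
      (\<forall>i\<in>I. bounded (U i) \<and> diameter (U i) \<le> \<delta>) \<and>
      (\<Sum>i\<in>I. hausdorff_gauge k (U i)) \<le> ennreal (unit_ball_vol (real k) * (real k * R) ^ k)"
      using bcell order_trans[OF dcell N(2)] by (intro exI[of _ I] exI[of _ cell]) auto
  qed
  then show ?thesis unfolding k_def by (rule le_less_trans) simp
qed

text \<open>A fine cover of the ball in \<open>span B\<close> is thickened in the remaining coordinate directions;
  Lebesgue measure of the resulting boxes gives the lower bound.\<close>

lemma hausdorff_outer_coordinate_ball_pos: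
  fixes B :: "'a::euclidean_space set"
  assumes B: "B \<subseteq> Basis" and R: "R > 0"
  shows "0 < hausdorff_outer (card B) (span B \<inter> cball 0 R)"
proof -
  define k where "k = card B"
  define p where "p = DIM('a)"
  \<comment> \<open>A point of the cube of half side \<open>\<rho>\<close> projects to a point of
    \<open>span B\<close> whose l1 norm is at most \<open>k * \<rho> \<le> R\<close>, hence into the
    covered ball.\<close>
  define \<rho> where "\<rho> = R / real p"
  have finB: "finite B" using B finite_Basis finite_subset by blast
  have p: "p > 0" by (simp add: p_def)
  have kp: "k \<le> p" unfolding k_def p_def using B by (simp add: card_mono)
  have \<rho>: "\<rho> > 0" using R p by (simp add: \<rho>_def)
  \<comment> \<open>This is the ratio of the volume
    \<open>(2 * d) ^ k * (2 * \<rho>) ^ (p - k)\<close> of a thickened box to the gauge of a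
    covering set of diameter \<open>d\<close>.\<close>
  define C where "C = 4 ^ k * (2 * \<rho>) ^ (p - k) / unit_ball_vol (real k)"
  have C: "C > 0" using \<rho> by (simp add: C_def)
  define l h where "l = (\<Sum>b\<in>Basis. (- \<rho>) *\<^sub>R b :: 'a)" and "h = (\<Sum>b\<in>Basis. \<rho> *\<^sub>R b :: 'a)"
  have lh: "l \<bullet> b = - \<rho>" "h \<bullet> b = \<rho>" if "b \<in> Basis" for b
    unfolding l_def h_def using that by (rule inner_sum_left_Basis)+
  define Z where "Z = cbox l h"
  have "(\<Prod>b\<in>Basis. (h - l) \<bullet> b) = (\<Prod>b\<in>(Basis::'a set). 2 * \<rho>)"
    by (intro prod.cong refl) (simp add: inner_diff_left lh)
  then have Z: "emeasure lborel Z = ennreal ((2 * \<rho>) ^ p)"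
    using \<rho> by (simp add: Z_def emeasure_lborel_cbox_eq lh p_def)
  have main: "ennreal ((2 * \<rho>) ^ p) \<le> ennreal C * (\<Sum>i. hausdorff_gauge k (U i))"
    if U: "U \<in> fine_covers 1 (span B \<inter> cball 0 R)" for U :: "nat \<Rightarrow> 'a set"
  proof -
    define y where "y i = (SOME y. y \<in> U i)" for i
    define d where "d i = diameter (U i)" for i
    have bU: "bounded (U i)" for i using U by (auto simp: fine_covers_def)
    have d0: "d i \<ge> 0" for i using diameter_ge_0[OF bU] by (simp add: d_def)
    \<comment> \<open>In the directions of \<open>B\<close> the box has half side \<open>d i\<close>
      around a point of \<open>U i\<close> and so contains the coordinates of all of
      \<open>U i\<close>; in the other directions it spans the whole cube.\<close>
    define lo where "lo i = (\<Sum>b\<in>Basis. (if b \<in> B then y i \<bullet> b - d i else - \<rho>) *\<^sub>R b)" for i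
    define hi where "hi i = (\<Sum>b\<in>Basis. (if b \<in> B then y i \<bullet> b + d i else \<rho>) *\<^sub>R b)" for i
    define D where "D i = (if U i = {} then {} else cbox (lo i) (hi i))" for i
    have "Z \<subseteq> (\<Union>i. D i)"
    proof
      fix x assume x: "x \<in> Z"
      then have xb: "\<bar>x \<bullet> b\<bar> \<le> \<rho>" if "b \<in> Basis" for b
        using that unfolding Z_def mem_box by (auto simp: lh abs_le_iff)
      define u where "u = (\<Sum>b\<in>B. (x \<bullet> b) *\<^sub>R b)"
      have us: "u \<in> span B" unfolding u_def by (intro span_sum span_scale span_base)
      have ub: "u \<bullet> b = x \<bullet> b" if "b \<in> B" for b
      proof -
        have "u \<bullet> b = (\<Sum>c\<in>B. if c = b then x \<bullet> b else 0)"
          unfolding u_def inner_sum_left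
        proof (intro sum.cong refl)
          fix c assume "c \<in> B"
          then have "c \<bullet> b = (if c = b then 1 else 0)" using that B by (intro inner_Basis) auto
          then show "((x \<bullet> c) *\<^sub>R c) \<bullet> b = (if c = b then x \<bullet> b else 0)"
            by (auto split: if_splits)
        qed
        then show ?thesis using that finB by simp
      qed
      have "norm u \<le> (\<Sum>b\<in>B. \<bar>u \<bullet> b\<bar>)" by (rule norm_le_l1_span_Basis[OF B us])
      also have "\<dots> \<le> (\<Sum>b\<in>B. \<rho>)" using ub xb B by (intro sum_mono) auto
      also have "\<dots> \<le> real p * \<rho>" using kp \<rho> by (simp add: k_def mult_right_mono)
      also have "\<dots> = R" using p by (simp add: \<rho>_def)
      finally have "u \<in> span B \<inter> cball 0 R" using us by simp
      then obtain i where i: "u \<in> U i" using U by (force simp: fine_covers_def)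
      then have yi: "y i \<in> U i" unfolding y_def by (rule someI)
      have "\<bar>x \<bullet> b - y i \<bullet> b\<bar> \<le> d i" if "b \<in> B" for b
      proof -
        have "\<bar>(u - y i) \<bullet> b\<bar> \<le> norm (u - y i)" using that B by (intro Basis_le_norm) auto
        also have "\<dots> \<le> d i"
          unfolding dist_norm[symmetric] d_def by (rule diameter_bounded_bound[OF bU i yi])
        finally show ?thesis using ub[OF that] by (simp add: inner_diff_left)
      qed
      then have "x \<in> cbox (lo i) (hi i)"
        unfolding mem_box lo_def hi_def using xb by (force simp: abs_le_iff)
      then show "x \<in> (\<Union>i. D i)" using i by (auto simp: D_def)
    qed
    then have "emeasure lborel Z \<le> emeasure lborel (\<Union>i. D i)"
      by (intro emeasure_mono) (auto simp: D_def)
    also have "\<dots> \<le> (\<Sum>i. emeasure lborel (D i))"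
      by (intro emeasure_subadditive_countably) (auto simp: D_def)
    also have "\<dots> \<le> (\<Sum>i. ennreal C * hausdorff_gauge k (U i))"
    proof (intro suminf_le allI)
      fix i
      show "emeasure lborel (D i) \<le> ennreal C * hausdorff_gauge k (U i)"
      proof (cases "U i = {}")
        case False
        have "emeasure lborel (D i) = ennreal (\<Prod>b\<in>Basis. (hi i - lo i) \<bullet> b)"
          using False d0 \<rho> by (simp add: D_def lo_def hi_def emeasure_lborel_cbox_eq)
        also have "(\<Prod>b\<in>Basis. (hi i - lo i) \<bullet> b) = (\<Prod>b\<in>Basis. if b \<in> B then 2 * d i else 2 * \<rho>)"
          by (intro prod.cong) (auto simp: lo_def hi_def inner_diff_left)
        also have "\<dots> = (2 * d i) ^ k * (2 * \<rho>) ^ (p - k)"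
        proof -
          have "card (Basis - B) = p - k" unfolding p_def k_def using B finB by (simp add: card_Diff_subset)
          moreover have "Basis \<inter> {b. b \<in> B} = B" "Basis \<inter> - {b. b \<in> B} = Basis - B" using B by auto
          ultimately show ?thesis by (simp add: prod.If_cases k_def)
        qed
        also have "\<dots> = C * (unit_ball_vol (real k) * (d i / 2) ^ k)"
        proof -
          have "2 * d i = 4 * (d i / 2)" by simp
          then have "(2 * d i) ^ k = 4 ^ k * (d i / 2) ^ k"
            by (simp only: power_mult_distrib)
          moreover have "unit_ball_vol (real k) \<noteq> 0" using unit_ball_vol_pos[of "real k"] by linarith
          ultimately show ?thesis by (simp add: C_def)
        qed
        finally show ?thesis using False C by (simp add: hausdorff_gauge_def d_def ennreal_mult')
      qed (simp add: D_def)
    qed auto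
    finally show ?thesis by (simp add: Z)
  qed
  \<comment> \<open>The outer measure is a supremum over scales, so one scale is enough for a lower
    bound; the value 1 is arbitrary.\<close>
  have "ennreal ((2 * \<rho>) ^ p / C) \<le> (INF U\<in>fine_covers 1 (span B \<inter> cball 0 R). \<Sum>i. hausdorff_gauge k (U i))"
  proof (rule INF_greatest)
    fix U assume "U \<in> fine_covers 1 (span B \<inter> cball 0 R)"
    from mult_left_mono[OF main[OF this], of "ennreal (1 / C)"]
    have "ennreal (1 / C) * ennreal ((2 * \<rho>) ^ p) \<le> ennreal (1 / C) * ennreal C * (\<Sum>i. hausdorff_gauge k (U i))"
      by (simp add: mult.assoc)
    then show "ennreal ((2 * \<rho>) ^ p / C) \<le> (\<Sum>i. hausdorff_gauge k (U i))"
      using C \<rho> by (simp add: ennreal_mult'[symmetric])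
  qed
  also have "\<dots> \<le> hausdorff_outer k (span B \<inter> cball 0 R)"
    unfolding hausdorff_outer_def by (intro SUP_upper) auto
  finally show ?thesis unfolding k_def
    using C \<rho> by (metis divide_pos_pos ennreal_less_zero_iff less_le_trans mult_pos_pos zero_less_numeral zero_less_power)
qed

text \<open>A linear isometry carries \<open>V\<close> to a coordinate subspace of the same
  dimension, where the two preceding estimates apply.\<close>

lemma
  fixes V :: "'a::euclidean_space set"
  assumes V: "subspace V" and R: "R > 0"
  shows hausdorff_outer_subspace_ball_pos: "0 < hausdorff_outer (dim V) (V \<inter> cball 0 R)"
    and hausdorff_outer_subspace_ball_finite: "hausdorff_outer (dim V) (V \<inter> cball 0 R) < top"
proof -
  obtain B :: "'a set" where B: "B \<subseteq> Basis" "card B = dim V"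
    using obtain_subset_with_card_n[of "dim V" "Basis :: 'a set"] dim_subset_UNIV[of V] by metis
  have "dim (span B) = dim V"
    using B independent_mono[OF independent_Basis] by (metis dim_eq_card_independent dim_span)
  then obtain f g where f: "linear f" "f ` span B = V" "\<And>x. x \<in> span B \<Longrightarrow> norm (f x) = norm x"
    using isometries_subspaces[OF subspace_span V] by metis
  have "V \<inter> cball 0 R = f ` (span B \<inter> cball 0 R)" using f(2,3) by auto
  moreover have "hausdorff_outer (dim V) (f ` (span B \<inter> cball 0 R)) = hausdorff_outer (dim V) (span B \<inter> cball 0 R)"
    by (rule hausdorff_outer_isometric_image)
       (metis IntD1 dist_norm f(1,3) linear_diff span_diff)
  ultimately show "0 < hausdorff_outer (dim V) (V \<inter> cball 0 R)" "hausdorff_outer (dim V) (V \<inter> cball 0 R) < top"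
    using hausdorff_outer_coordinate_ball_pos[OF B(1) R] hausdorff_outer_coordinate_ball_finite[OF B(1) R] B(2)
    by auto
qed

lemma hausdorff_outer_subspace_cball_finite:
  fixes V :: "'a::euclidean_space set"
  assumes V: "subspace V"
  shows "hausdorff_outer (dim V) (V \<inter> cball 0 R) < top"
proof -
  have "hausdorff_outer (dim V) (V \<inter> cball 0 R) \<le> hausdorff_outer (dim V) (V \<inter> cball 0 (max R 1))"
    by (intro hausdorff_outer_mono) auto
  also have "\<dots> < top" by (intro hausdorff_outer_subspace_ball_finite V) simp
  finally show ?thesis .
qed

subsection \<open>Uniqueness of translation invariant measures\<close>

lemma nn_integral_translation_invariant:
  fixes M :: "'a::euclidean_space measure"
  assumes sets: "sets M = sets borel"
    and inv: "\<And>A. A \<in> sets borel \<Longrightarrow> emeasure M ((\<lambda>x. x + w) -` A) = emeasure M A"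
    and f: "f \<in> borel_measurable borel"
  shows "(\<integral>\<^sup>+x. f (x + w) \<partial>M) = (\<integral>\<^sup>+x. f x \<partial>M)"
proof -
  note sets[measurable_cong]
  have sp: "space M = UNIV" using sets_eq_imp_space_eq[OF sets] by simp
  have "distr M borel (\<lambda>x. x + w) = M"
    using sets inv by (intro measure_eqI) (auto simp: emeasure_distr sp)
  moreover have "(\<integral>\<^sup>+x. f x \<partial>distr M borel (\<lambda>x. x + w)) = (\<integral>\<^sup>+x. f (x + w) \<partial>M)"
    using f by (intro nn_integral_distr) auto
  ultimately show ?thesis by simp
qed

text \<open>For a fixed \<open>Q\<close> this shows that \<open>M\<close> and \<open>N\<close> are proportional; both sides are the integral of
  \<open>indicator Q y * indicator A (x + y)\<close>.\<close>

lemma translation_invariant_exchange: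
  fixes M N :: "'a::euclidean_space measure"
  assumes W: "subspace W"
    and sM: "sets M = sets borel" and sN: "sets N = sets borel"
    and fM: "sigma_finite_measure M" and fN: "sigma_finite_measure N"
    and WM: "AE x in M. x \<in> W" and WN: "AE x in N. x \<in> W"
    and iM: "\<And>w A. w \<in> W \<Longrightarrow> A \<in> sets borel \<Longrightarrow> emeasure M ((\<lambda>x. x + w) -` A) = emeasure M A"
    and iN: "\<And>w A. w \<in> W \<Longrightarrow> A \<in> sets borel \<Longrightarrow> emeasure N ((\<lambda>x. x + w) -` A) = emeasure N A"
    and Q: "Q \<in> sets borel" and A: "A \<in> sets borel"
  shows "emeasure N Q * emeasure M A = emeasure N A * emeasure M (uminus -` Q)"
proof -
  note sM[measurable_cong] sN[measurable_cong]
  note Q[measurable] A[measurable]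
  interpret pair_sigma_finite M N using fM fN by (simp add: pair_sigma_finite_def)
  have "emeasure N Q * emeasure M A = (\<integral>\<^sup>+y. indicator Q y * emeasure M A \<partial>N)"
    by (simp add: nn_integral_multc sN)
  also have "\<dots> = (\<integral>\<^sup>+y. (\<integral>\<^sup>+x. indicator Q y * indicator A (x + y) \<partial>M) \<partial>N)"
  proof (rule nn_integral_cong_AE)
    show "AE y in N. indicator Q y * emeasure M A = (\<integral>\<^sup>+x. indicator Q y * indicator A (x + y) \<partial>M)"
      using WN
    proof eventually_elim
      case (elim y)
      have "(\<integral>\<^sup>+x. indicator Q y * indicator A (x + y) \<partial>M) = indicator Q y * (\<integral>\<^sup>+x. indicator A (x + y) \<partial>M)"
        by (rule nn_integral_cmult) measurable
      also have "(\<integral>\<^sup>+x. indicator A (x + y) \<partial>M) = (\<integral>\<^sup>+x. indicator A x \<partial>M)"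
        using elim by (intro nn_integral_translation_invariant[OF sM iM]) auto
      finally show ?case by (simp add: sM)
    qed
  qed
  also have "\<dots> = (\<integral>\<^sup>+x. (\<integral>\<^sup>+y. indicator Q y * indicator A (x + y) \<partial>N) \<partial>M)"
    by (rule Fubini') measurable
  \<comment> \<open>Substitution of \<open>y - x\<close> for \<open>y\<close>, allowed by invariance
    of \<open>N\<close> because almost every \<open>x\<close> lies in \<open>W\<close>.\<close>
  also have "\<dots> = (\<integral>\<^sup>+x. (\<integral>\<^sup>+y. indicator Q (y - x) * indicator A y \<partial>N) \<partial>M)"
  proof (rule nn_integral_cong_AE)
    show "AE x in M. (\<integral>\<^sup>+y. indicator Q y * indicator A (x + y) \<partial>N) = (\<integral>\<^sup>+y. indicator Q (y - x) * indicator A y \<partial>N)"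
      using WM
    proof eventually_elim
      case (elim x)
      have "- x \<in> W" using W elim by (rule subspace_neg)
      from nn_integral_translation_invariant[OF sN iN[OF this], of "\<lambda>y. indicator Q y * indicator A (x + y)"]
      show ?case by simp
    qed
  qed
  also have "\<dots> = (\<integral>\<^sup>+y. (\<integral>\<^sup>+x. indicator Q (y - x) * indicator A y \<partial>M) \<partial>N)"
    by (rule Fubini'[symmetric]) measurable
  also have "\<dots> = (\<integral>\<^sup>+y. indicator A y * emeasure M (uminus -` Q) \<partial>N)"
  proof (rule nn_integral_cong_AE)
    show "AE y in N. (\<integral>\<^sup>+x. indicator Q (y - x) * indicator A y \<partial>M) = indicator A y * emeasure M (uminus -` Q)"
      using WN
    proof eventually_elim
      case (elim y)
      have my: "- y \<in> W" using W elim by (rule subspace_neg)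
      have "(\<integral>\<^sup>+x. indicator Q (y - x) * indicator A y \<partial>M) = (\<integral>\<^sup>+x. indicator Q (y - x) \<partial>M) * indicator A y"
        by (rule nn_integral_multc) measurable
      \<comment> \<open>Invariance of \<open>M\<close> under the shift by \<open>- y\<close> removes
        \<open>y\<close>, at the price of reflecting \<open>Q\<close>.\<close>
      also have "(\<integral>\<^sup>+x. indicator Q (y - x) \<partial>M) = (\<integral>\<^sup>+x. indicator Q (- x) \<partial>M)"
        using nn_integral_translation_invariant[OF sM iM[OF my], of "\<lambda>x. indicator Q (- x)"] by simp
      also have "\<dots> = (\<integral>\<^sup>+x. indicator (uminus -` Q) x \<partial>M)"
        by (intro nn_integral_cong) (auto simp: indicator_def)
      also have "\<dots> = emeasure M (uminus -` Q)"
        using measurable_sets[of "uminus :: 'a \<Rightarrow> 'a" borel borel Q] by (simp add: sM)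
      finally show ?case by (simp add: mult.commute)
    qed
  qed
  also have "\<dots> = emeasure N A * emeasure M (uminus -` Q)"
    by (simp add: nn_integral_multc sN)
  finally show ?thesis .
qed

subsection \<open>Hausdorff measure of products\<close>

text \<open>The Caratheodory measurable sets vary with \<open>k\<close>. Cutting the measure down to
  \<open>A\<close> and pushing it to the Borel sets gives measures on one common sigma-algebra,
  suitable for products and Fubini.\<close>

definition hausdorff_on :: "nat \<Rightarrow> 'a::euclidean_space set \<Rightarrow> 'a measure" where
  "hausdorff_on k A = distr (density (hausdorff_measure k) (indicator A)) borel (\<lambda>x. x)"

lemma sets_hausdorff_on [simp, measurable_cong]: "sets (hausdorff_on k A) = sets borel"
  and space_hausdorff_on [simp]: "space (hausdorff_on k A) = UNIV"
  by (simp_all add: hausdorff_on_def)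

lemma borel_sets_hausdorff: "A \<in> sets borel \<Longrightarrow> A \<in> sets (hausdorff_measure k)"
  using borel_subset_sets_hausdorff by blast

lemma measurable_hausdorff_borel: "f \<in> measurable borel M \<Longrightarrow> f \<in> measurable (hausdorff_measure k) M"
  using borel_subset_sets_hausdorff by (auto simp: measurable_def)

lemma nn_integral_hausdorff_on:
  assumes A: "A \<in> sets borel" and f: "f \<in> borel_measurable borel"
  shows "(\<integral>\<^sup>+x. f x \<partial>hausdorff_on k A) = (\<integral>\<^sup>+x\<in>A. f x \<partial>hausdorff_measure k)"
proof -
  have "(\<lambda>x. x) \<in> measurable (density (hausdorff_measure k) (indicator A)) borel"
    using measurable_hausdorff_borel[of "\<lambda>x. x" borel k] by simp
  then have "(\<integral>\<^sup>+x. f x \<partial>hausdorff_on k A) = (\<integral>\<^sup>+x. f x \<partial>density (hausdorff_measure k) (indicator A))"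
    unfolding hausdorff_on_def using f by (intro nn_integral_distr) auto
  also have "\<dots> = (\<integral>\<^sup>+x. indicator A x * f x \<partial>hausdorff_measure k)"
    using A f by (intro nn_integral_density borel_measurable_indicator borel_sets_hausdorff measurable_hausdorff_borel) auto
  finally show ?thesis by (simp add: mult.commute)
qed

lemma emeasure_hausdorff_on:
  assumes A: "A \<in> sets borel" and B: "B \<in> sets borel"
  shows "emeasure (hausdorff_on k A) B = hausdorff_outer k (A \<inter> B)"
proof -
  have "emeasure (hausdorff_on k A) B = (\<integral>\<^sup>+x. indicator B x \<partial>hausdorff_on k A)"
    using B by simp
  also have "\<dots> = (\<integral>\<^sup>+x. indicator (A \<inter> B) x \<partial>hausdorff_measure k)"
    using A B by (subst nn_integral_hausdorff_on) (auto intro!: nn_integral_cong simp: indicator_def)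
  also have "\<dots> = hausdorff_outer k (A \<inter> B)"
    using A B by (simp add: emeasure_hausdorff_measure borel_sets_hausdorff)
  finally show ?thesis .
qed

lemma AE_hausdorff_on:
  assumes "A \<in> sets borel"
  shows "AE x in hausdorff_on k A. x \<in> A"
  using assms by (intro AE_I[where N="- A"]) (auto simp: emeasure_hausdorff_on)

lemma borel_subspace: "subspace (V :: 'a::euclidean_space set) \<Longrightarrow> V \<in> sets borel"
  by (simp add: closed_subspace)

lemma sigma_finite_measure_cballs:
  fixes M :: "'a::euclidean_space measure"
  assumes M: "sets M = sets borel" and fin: "\<And>n. emeasure M (cball 0 (real n)) < top"
  shows "sigma_finite_measure M"
proof (rule sigma_finite_measure.intro, intro exI conjI)
  let ?A = "range (\<lambda>n. cball (0::'a) (real n))"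
  show "countable ?A" by simp
  show "?A \<subseteq> sets M" unfolding M by auto
  have "\<exists>n. norm x \<le> real n" for x :: 'a using real_arch_simple by blast
  moreover have "space M = UNIV" using sets_eq_imp_space_eq[OF M] by simp
  ultimately show "\<Union> ?A = space M" by auto
  show "\<forall>a\<in>?A. emeasure M a \<noteq> \<infinity>" using fin by (auto simp: less_top[symmetric])
qed

text \<open>Balls have finite measure because the exponent matches the dimension of
  \<open>V\<close>. Fubini for these measures rests on this.\<close>

lemma sigma_finite_hausdorff_on_subspace:
  fixes V :: "'a::euclidean_space set"
  assumes V: "subspace V"
  shows "sigma_finite_measure (hausdorff_on (dim V) V)"
proof (rule sigma_finite_measure_cballs)
  show "emeasure (hausdorff_on (dim V) V) (cball 0 (real n)) < top" for n
    using hausdorff_outer_subspace_cball_finite[OF V]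
    by (simp only: emeasure_hausdorff_on[OF borel_subspace[OF V] borel_closed[OF closed_cball]])
qed simp

lemma hausdorff_on_subspace_invariant:
  fixes V :: "'a::euclidean_space set"
  assumes V: "subspace V" and w: "w \<in> V" and A: "A \<in> sets borel"
  shows "emeasure (hausdorff_on k V) ((\<lambda>x. x + w) -` A) = emeasure (hausdorff_on k V) A"
proof -
  have "(\<lambda>x. x + w) -` A \<in> sets borel"
    using measurable_sets[of "\<lambda>x. x + w" borel borel A] A by simp
  moreover have "V \<inter> A = (\<lambda>x. w + x) ` (V \<inter> (\<lambda>x. x + w) -` A)"
  proof (intro subset_antisym subsetI)
    fix x assume "x \<in> V \<inter> A"
    then show "x \<in> (\<lambda>x. w + x) ` (V \<inter> (\<lambda>x. x + w) -` A)"
      using V w by (intro image_eqI[of _ _ "x - w"]) (auto simp: subspace_diff)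
  qed (use V w in \<open>auto simp: subspace_add add.commute\<close>)
  ultimately show ?thesis
    using V A hausdorff_outer_translation[of k w "V \<inter> (\<lambda>x. x + w) -` A"]
    by (simp add: emeasure_hausdorff_on borel_subspace)
qed

section \<open>The product measure on an orthogonal sum of two subspaces\<close>

lemma hausdorff_outer_subspace_ball_cong:
  fixes V :: "'a::euclidean_space set" and V' :: "'b::euclidean_space set"
  assumes V: "subspace V" and V': "subspace V'" and dim: "dim V = dim V'"
  shows "hausdorff_outer k (V \<inter> cball 0 R) = hausdorff_outer k (V' \<inter> cball 0 R)"
proof -
  obtain f g where f: "linear f" "f ` V = V'" "\<And>x. x \<in> V \<Longrightarrow> norm (f x) = norm x"
    using isometries_subspaces[OF V V' dim] by metis
  have "V' \<inter> cball 0 R = f ` (V \<inter> cball 0 R)" using f(2,3) by auto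
  moreover have "hausdorff_outer k (f ` (V \<inter> cball 0 R)) = hausdorff_outer k (V \<inter> cball 0 R)"
    by (rule hausdorff_outer_isometric_image)
       (metis IntD1 V dist_norm f(1,3) linear_diff subspace_diff)
  ultimately show ?thesis by simp
qed

lemma norm_le_orthogonal_add:
  fixes x y :: "'a::real_inner"
  assumes "x \<bullet> y = 0"
  shows "norm x \<le> norm (x + y)" "norm y \<le> norm (x + y)"
proof -
  have "(norm (x + y))\<^sup>2 = (norm x)\<^sup>2 + (norm y)\<^sup>2"
    using assms by (intro norm_add_Pythagorean) (simp add: orthogonal_def)
  then have "(norm x)\<^sup>2 \<le> (norm (x + y))\<^sup>2" "(norm y)\<^sup>2 \<le> (norm (x + y))\<^sup>2" by auto
  then show "norm x \<le> norm (x + y)" "norm y \<le> norm (x + y)"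
    by (meson norm_ge_zero power2_le_imp_le)+
qed

lemma orthogonal_sum_unique:
  fixes a a' b b' :: "'a::euclidean_space"
  assumes "subspace V" "subspace V'" "\<And>x y. x \<in> V \<Longrightarrow> y \<in> V' \<Longrightarrow> x \<bullet> y = 0"
    and "a \<in> V" "a' \<in> V" "b \<in> V'" "b' \<in> V'" "a + b = a' + b'"
  shows "a = a' \<and> b = b'"
proof -
  have e: "a - a' = b' - b" using assms(8) by (simp add: algebra_simps)
  have "(a - a') \<bullet> (b' - b) = 0" using assms by (intro assms(3)) (auto simp: subspace_diff)
  then have "a - a' = 0" using e by simp
  then show ?thesis using e by simp
qed

text \<open>The test set for comparing the two invariant measures on \<open>V + V'\<close>. Its
  product measure is the product of two ball measures, it is symmetric, and up to isometry it
  depends on the two dimensions only.\<close>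

definition product_ball :: "'a::euclidean_space set \<Rightarrow> 'a set \<Rightarrow> 'a set" where
  "product_ball V V' = {a + b | a b. a \<in> V \<and> b \<in> V' \<and> norm a \<le> 1 \<and> norm b \<le> 1}"

text \<open>Isometries between the two factors are glued to a map of the sums, which is an isometry
  by Pythagoras.\<close>

lemma product_ball_measure_cong:
  fixes V0 V1 :: "'a::euclidean_space set"
  assumes sub: "subspace V0" "subspace V0'" "subspace V1" "subspace V1'"
    and orth0: "\<And>x y. x \<in> V0 \<Longrightarrow> y \<in> V0' \<Longrightarrow> x \<bullet> y = 0"
    and orth1: "\<And>x y. x \<in> V1 \<Longrightarrow> y \<in> V1' \<Longrightarrow> x \<bullet> y = 0"
    and dim: "dim V0 = dim V1" "dim V0' = dim V1'"
  shows "hausdorff_outer k (product_ball V0 V0') = hausdorff_outer k (product_ball V1 V1')"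
proof -
  obtain f where f: "linear f" "f ` V0 = V1" "\<And>x. x \<in> V0 \<Longrightarrow> norm (f x) = norm x"
    using isometries_subspaces[OF sub(1,3) dim(1)] by metis
  obtain g where g: "linear g" "g ` V0' = V1'" "\<And>x. x \<in> V0' \<Longrightarrow> norm (g x) = norm x"
    using isometries_subspaces[OF sub(2,4) dim(2)] by metis
  \<comment> \<open>The component in \<open>V0\<close>; orthogonality makes the chosen value
    unique.\<close>
  define p where "p x = (SOME a. a \<in> V0 \<and> x - a \<in> V0')" for x
  have p: "p (a + b) = a" if "a \<in> V0" "b \<in> V0'" for a b
  proof -
    have "p (a + b) \<in> V0 \<and> (a + b) - p (a + b) \<in> V0'"
      unfolding p_def by (rule someI[of _ a]) (use that in auto)
    then show ?thesis
      using orthogonal_sum_unique[OF sub(1,2) orth0, of "p (a + b)" a "(a + b) - p (a + b)" b] that by auto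
  qed
  define h where "h x = f (p x) + g (x - p x)" for x
  have h: "h (a + b) = f a + g b" if "a \<in> V0" "b \<in> V0'" for a b
    using p[OF that] by (simp add: h_def)
  have "product_ball V1 V1' = h ` product_ball V0 V0'"
  proof (intro subset_antisym subsetI)
    fix x assume "x \<in> product_ball V1 V1'"
    then obtain a b where ab: "x = a + b" "a \<in> V1" "b \<in> V1'" "norm a \<le> 1" "norm b \<le> 1"
      by (auto simp: product_ball_def)
    then obtain a0 b0 where "a = f a0" "a0 \<in> V0" "b = g b0" "b0 \<in> V0'" using f(2) g(2) by auto
    then show "x \<in> h ` product_ball V0 V0'"
      using ab h f(3) g(3) by (intro image_eqI[of _ _ "a0 + b0"]) (auto simp: product_ball_def)
  next
    fix x assume "x \<in> h ` product_ball V0 V0'"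
    then obtain a b where ab: "x = h (a + b)" "a \<in> V0" "b \<in> V0'" "norm a \<le> 1" "norm b \<le> 1"
      by (auto simp: product_ball_def)
    then show "x \<in> product_ball V1 V1'"
      using h f(2,3) g(2,3) unfolding product_ball_def
      by (intro CollectI exI[of _ "f a"] exI[of _ "g b"]) auto
  qed
  moreover have "hausdorff_outer k (h ` product_ball V0 V0') = hausdorff_outer k (product_ball V0 V0')"
  proof (rule hausdorff_outer_isometric_image)
    fix x y assume "x \<in> product_ball V0 V0'" "y \<in> product_ball V0 V0'"
    then obtain a b a' b' where x: "x = a + b" "a \<in> V0" "b \<in> V0'" and y: "y = a' + b'" "a' \<in> V0" "b' \<in> V0'"
      by (auto simp: product_ball_def)
    have d: "a - a' \<in> V0" "b - b' \<in> V0'" using x y sub by (auto simp: subspace_diff)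
    have fg: "f (a - a') \<in> V1" "g (b - b') \<in> V1'" using d f(2) g(2) by auto
    have "(norm (h x - h y))\<^sup>2 = (norm (f (a - a') + g (b - b')))\<^sup>2"
      using x y h by (simp add: linear_diff[OF f(1)] linear_diff[OF g(1)] algebra_simps)
    also have "\<dots> = (norm (f (a - a')))\<^sup>2 + (norm (g (b - b')))\<^sup>2"
      using orth1[OF fg] by (intro norm_add_Pythagorean) (simp add: orthogonal_def)
    also have "\<dots> = (norm (a - a'))\<^sup>2 + (norm (b - b'))\<^sup>2" using f(3) g(3) d by simp
    also have "\<dots> = (norm ((a - a') + (b - b')))\<^sup>2"
      using orth0[OF d] by (intro norm_add_Pythagorean[symmetric]) (simp add: orthogonal_def)
    also have "(a - a') + (b - b') = x - y" using x y by simp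
    finally show "dist (h x) (h y) = dist x y" by (simp add: dist_norm)
  qed
  ultimately show ?thesis by simp
qed

lemma hausdorff_outer_section:
  fixes V :: "'a::euclidean_space set"
  assumes V: "subspace V" and A: "A \<in> sets borel"
  shows "hausdorff_outer k {a \<in> V. a + b \<in> A} = (\<integral>\<^sup>+a. indicator A (a + b) \<partial>hausdorff_on k V)"
proof -
  have "(\<lambda>a. a + b) -` A \<in> sets borel" using measurable_sets[of "\<lambda>x. x + b" borel borel A] A by simp
  moreover have "(\<integral>\<^sup>+a. indicator A (a + b) \<partial>hausdorff_on k V) = (\<integral>\<^sup>+a. indicator ((\<lambda>a. a + b) -` A) a \<partial>hausdorff_on k V)"
    by (intro nn_integral_cong) (auto simp: indicator_def)
  moreover have "V \<inter> (\<lambda>a. a + b) -` A = {a \<in> V. a + b \<in> A}" by auto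
  ultimately show ?thesis
    using V by (simp add: emeasure_hausdorff_on borel_subspace)
qed

text \<open>On \<open>W\<close> there are two translation invariant measures: the Hausdorff measure
  \<open>M\<close> and the image \<open>N\<close> of the product measure under addition. The
  exchange lemma, with the product ball as \<open>Q\<close>, makes them proportional.\<close>

lemma hausdorff_product_exchange:
  fixes V V' D :: "'a::euclidean_space set"
  assumes V: "subspace V" and V': "subspace V'"
    and orth': "\<forall>x\<in>V. \<forall>y\<in>V'. x \<bullet> y = 0"
    and D: "D \<in> sets borel"
  defines "W \<equiv> {a + b | a b. a \<in> V \<and> b \<in> V'}"
  shows "dim W = dim V + dim V'"
    and "hausdorff_outer (dim V) (V \<inter> cball 0 1) * hausdorff_outer (dim V') (V' \<inter> cball 0 1) *
            hausdorff_outer (dim W) (W \<inter> D)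
       = (\<integral>\<^sup>+b. hausdorff_outer (dim V) {a \<in> V. a + b \<in> D} \<partial>hausdorff_on (dim V') V') *
            hausdorff_outer (dim W) (product_ball V V')"
proof -
  have orth: "x \<bullet> y = 0" if "x \<in> V" "y \<in> V'" for x y using orth' that by blast
  have W: "subspace W" unfolding W_def by (rule subspace_sums[OF V V'])
  have "V \<inter> V' = {0}"
  proof -
    have "x = 0" if "x \<in> V" "x \<in> V'" for x using orth[OF that] by simp
    then show ?thesis using V V' by (auto simp: subspace_0)
  qed
  then show dimW: "dim W = dim V + dim V'"
    using dim_sums_Int[OF V V'] by (simp add: W_def)
  let ?Q = "product_ball V V'"
  have QW: "?Q \<subseteq> W" by (auto simp: W_def product_ball_def)
  have "?Q = (\<lambda>(a, b). a + b) ` ((V \<inter> cball 0 1) \<times> (V' \<inter> cball 0 1))"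
    by (force simp: product_ball_def)
  moreover have "compact \<dots>"
    using V V' by (intro compact_continuous_image compact_Times closed_Int_compact)
      (auto intro!: closed_subspace continuous_intros simp: case_prod_unfold)
  ultimately have Qb: "?Q \<in> sets borel" by (simp add: compact_imp_closed)
  have pyth: "norm a \<le> norm (a + b)" "norm b \<le> norm (a + b)" if "a \<in> V" "b \<in> V'" for a b
    using norm_le_orthogonal_add[OF orth[OF that]] .
  define M1 where "M1 = hausdorff_on (dim V) V"
  define M2 where "M2 = hausdorff_on (dim V') V'"
  define M where "M = hausdorff_on (dim W) W"
  define N where "N = distr (M1 \<Otimes>\<^sub>M M2) borel (\<lambda>(a, b). a + b)"
  have s[measurable_cong]: "sets M1 = sets borel" "sets M2 = sets borel" "sets M = sets borel" "sets N = sets borel"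
    by (simp_all add: M1_def M2_def M_def N_def)
  interpret M1: sigma_finite_measure M1 unfolding M1_def by (rule sigma_finite_hausdorff_on_subspace[OF V])
  interpret M2: sigma_finite_measure M2 unfolding M2_def by (rule sigma_finite_hausdorff_on_subspace[OF V'])
  interpret P: pair_sigma_finite M1 M2 ..
  have N: "emeasure N A = (\<integral>\<^sup>+b. (\<integral>\<^sup>+a. indicator A (a + b) \<partial>M1) \<partial>M2)" if [measurable]: "A \<in> sets borel" for A
  proof -
    have "emeasure N A = (\<integral>\<^sup>+x. indicator A x \<partial>N)" using that s by simp
    also have "\<dots> = (\<integral>\<^sup>+z. indicator A (fst z + snd z) \<partial>(M1 \<Otimes>\<^sub>M M2))"
      unfolding N_def by (subst nn_integral_distr) (auto simp: case_prod_unfold)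
    also have "\<dots> = (\<integral>\<^sup>+b. (\<integral>\<^sup>+a. indicator A (a + b) \<partial>M1) \<partial>M2)"
      using P.nn_integral_snd[of "\<lambda>(a, b). indicator A (a + b)"] by (simp add: case_prod_unfold)
    finally show ?thesis .
  qed
  have V'sect: "(\<integral>\<^sup>+a. indicator A (a + b) \<partial>M1) = hausdorff_outer (dim V) {a \<in> V. a + b \<in> A}"
    if A: "A \<in> sets borel" for A b
    unfolding M1_def by (rule hausdorff_outer_section[OF V A, symmetric])
  have bV': "V' \<in> sets borel" using V' by (rule borel_subspace)
  have AE2: "AE b in M2. b \<in> V'" unfolding M2_def by (rule AE_hausdorff_on[OF bV'])
  have NW: "AE x in N. x \<in> W"
  proof (rule AE_I[where N="- W"])
    have "emeasure N (- W) = (\<integral>\<^sup>+b. (\<integral>\<^sup>+a. indicator (- W) (a + b) \<partial>M1) \<partial>M2)"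
      using borel_subspace[OF W] by (intro N) auto
    also have "\<dots> = (\<integral>\<^sup>+b. 0 \<partial>M2)"
    proof (rule nn_integral_cong_AE)
      show "AE b in M2. (\<integral>\<^sup>+a. indicator (- W) (a + b) \<partial>M1) = 0"
        using AE2
      proof eventually_elim
        case (elim b)
        then have e: "{a \<in> V. a + b \<in> - W} = {}" by (auto simp: W_def)
        have "- W \<in> sets borel" using borel_subspace[OF W] by auto
        from V'sect[OF this, of b] show ?case unfolding e by simp
      qed
    qed
    finally show "emeasure N (- W) = 0" by simp
  qed (use borel_subspace[OF W] s in auto)
  \<comment> \<open>By Pythagoras both components of a point of the ball lie in balls of the same
    radius. This makes \<open>N\<close> sigma-finite.\<close>
  have Nle: "emeasure N (cball 0 (real n)) < top" for n
  proof -
    have "emeasure N (cball 0 (real n)) = (\<integral>\<^sup>+b. hausdorff_outer (dim V) {a \<in> V. a + b \<in> cball 0 (real n)} \<partial>M2)"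
      by (subst N) (auto simp: V'sect)
    also have "\<dots> \<le> (\<integral>\<^sup>+b. hausdorff_outer (dim V) (V \<inter> cball 0 (real n)) * indicator (cball 0 (real n)) b \<partial>M2)"
    proof (rule nn_integral_mono_AE)
      show "AE b in M2. hausdorff_outer (dim V) {a \<in> V. a + b \<in> cball 0 (real n)}
          \<le> hausdorff_outer (dim V) (V \<inter> cball 0 (real n)) * indicator (cball 0 (real n)) b"
        using AE2
      proof eventually_elim
        case (elim b)
        show ?case
        proof (cases "norm b \<le> real n")
          case True
          have "{a \<in> V. a + b \<in> cball 0 (real n)} \<subseteq> V \<inter> cball 0 (real n)"
            using pyth(1)[OF _ elim] by force
          then show ?thesis using True by (simp add: hausdorff_outer_mono)
        next
          case False
          then have e: "{a \<in> V. a + b \<in> cball 0 (real n)} = {}"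
            using pyth(2)[OF _ elim] by force
          show ?thesis unfolding e by simp
        qed
      qed
    qed
    also have "\<dots> = hausdorff_outer (dim V) (V \<inter> cball 0 (real n)) * hausdorff_outer (dim V') (V' \<inter> cball 0 (real n))"
      by (subst nn_integral_cmult_indicator) (auto simp: s M2_def emeasure_hausdorff_on[OF bV'])
    also have "\<dots> < top" using V V' by (simp add: ennreal_mult_less_top hausdorff_outer_subspace_cball_finite)
    finally show ?thesis .
  qed
  have fN: "sigma_finite_measure N" using s(4) Nle by (rule sigma_finite_measure_cballs)
  have iN: "emeasure N ((\<lambda>x. x + w) -` A) = emeasure N A" if w: "w \<in> W" and A[measurable]: "A \<in> sets borel" for w A
  proof -
    obtain v v' where v: "w = v + v'" "v \<in> V" "v' \<in> V'" using w by (auto simp: W_def)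
    have Aw: "(\<lambda>x. x + w) -` A \<in> sets borel"
      using measurable_sets[of "\<lambda>x. x + w" borel borel A] A by simp
    have "emeasure N ((\<lambda>x. x + w) -` A) = (\<integral>\<^sup>+b. (\<integral>\<^sup>+a. indicator A ((a + v) + (b + v')) \<partial>M1) \<partial>M2)"
      unfolding N[OF Aw] by (intro nn_integral_cong) (auto simp: indicator_def v algebra_simps)
    also have "\<dots> = (\<integral>\<^sup>+b. (\<integral>\<^sup>+a. indicator A (a + (b + v')) \<partial>M1) \<partial>M2)"
      by (intro nn_integral_cong nn_integral_translation_invariant[of M1 v "\<lambda>a. indicator A (a + c)" for c] s)
         (auto simp: M1_def intro: hausdorff_on_subspace_invariant[OF V v(2)])
    also have "\<dots> = (\<integral>\<^sup>+b. (\<integral>\<^sup>+a. indicator A (a + b) \<partial>M1) \<partial>M2)"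
      by (rule nn_integral_translation_invariant[of M2 v' "\<lambda>b. (\<integral>\<^sup>+a. indicator A (a + b) \<partial>M1)"])
         (auto simp: M2_def intro: hausdorff_on_subspace_invariant[OF V' v(3)])
    also have "\<dots> = emeasure N A" by (rule N[symmetric]) fact
    finally show ?thesis .
  qed
  have "emeasure N ?Q * emeasure M D = emeasure N D * emeasure M (uminus -` ?Q)"
  proof (rule translation_invariant_exchange[OF W])
    show "sigma_finite_measure M" unfolding M_def by (rule sigma_finite_hausdorff_on_subspace[OF W])
    show "AE x in M. x \<in> W" unfolding M_def by (rule AE_hausdorff_on[OF borel_subspace[OF W]])
  qed (use s fN NW iN Qb D in \<open>auto simp: M_def intro: hausdorff_on_subspace_invariant[OF W]\<close>)
  \<comment> \<open>Symmetry of the test set undoes the reflection in the exchange lemma.\<close>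
  moreover have "uminus -` ?Q = ?Q"
  proof -
    have "- x \<in> ?Q" if x: "x \<in> ?Q" for x
    proof -
      obtain a b where "x = a + b" "a \<in> V" "b \<in> V'" "norm a \<le> 1" "norm b \<le> 1"
        using x by (auto simp: product_ball_def)
      then show ?thesis
        using V V' unfolding product_ball_def
        by (intro CollectI exI[of _ "- a"] exI[of _ "- b"]) (auto simp: subspace_neg)
    qed
    then show ?thesis by (auto simp: vimage_def) (metis add.inverse_inverse)
  qed
  moreover have "emeasure M D = hausdorff_outer (dim W) (W \<inter> D)"
    unfolding M_def by (rule emeasure_hausdorff_on[OF borel_subspace[OF W] D])
  moreover have "emeasure M ?Q = hausdorff_outer (dim W) ?Q"
    unfolding M_def using emeasure_hausdorff_on[OF borel_subspace[OF W] Qb] QW by (simp add: Int_absorb1)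
  moreover have "emeasure N D = (\<integral>\<^sup>+b. hausdorff_outer (dim V) {a \<in> V. a + b \<in> D} \<partial>M2)"
    using D by (simp add: N V'sect)
  moreover have "emeasure N ?Q = hausdorff_outer (dim V) (V \<inter> cball 0 1) * hausdorff_outer (dim V') (V' \<inter> cball 0 1)"
  proof -
    have "emeasure N ?Q = (\<integral>\<^sup>+b. hausdorff_outer (dim V) {a \<in> V. a + b \<in> ?Q} \<partial>M2)"
      using Qb by (simp add: N V'sect)
    also have "\<dots> = (\<integral>\<^sup>+b. hausdorff_outer (dim V) (V \<inter> cball 0 1) * indicator (cball 0 1) b \<partial>M2)"
    proof (rule nn_integral_cong_AE)
      show "AE b in M2. hausdorff_outer (dim V) {a \<in> V. a + b \<in> ?Q}
          = hausdorff_outer (dim V) (V \<inter> cball 0 1) * indicator (cball 0 1) b"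
        using AE2
      proof eventually_elim
        case (elim b)
        have "a + b \<in> ?Q \<longleftrightarrow> norm a \<le> 1 \<and> norm b \<le> 1" if "a \<in> V" for a
          using that elim orthogonal_sum_unique[OF V V' orth, of a _ b] unfolding product_ball_def by blast
        then have "{a \<in> V. a + b \<in> ?Q} = (if norm b \<le> 1 then V \<inter> cball 0 1 else {})"
          by auto
        then show ?case by simp
      qed
    qed
    also have "\<dots> = hausdorff_outer (dim V) (V \<inter> cball 0 1) * hausdorff_outer (dim V') (V' \<inter> cball 0 1)"
      by (subst nn_integral_cmult_indicator) (auto simp: s M2_def emeasure_hausdorff_on[OF bV'])
    finally show ?thesis .
  qed
  ultimately show "hausdorff_outer (dim V) (V \<inter> cball 0 1) * hausdorff_outer (dim V') (V' \<inter> cball 0 1) *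
            hausdorff_outer (dim W) (W \<inter> D)
       = (\<integral>\<^sup>+b. hausdorff_outer (dim V) {a \<in> V. a + b \<in> D} \<partial>hausdorff_on (dim V') V') *
            hausdorff_outer (dim W) (product_ball V V')"
    by (simp add: M2_def)
qed

text \<open>Cavalieri's principle with an unspecified factor. The quantification over all orthogonal
  pairs of the given dimensions lets bounds obtained from different splittings share the same
  \<open>c\<close>; the type argument fixes the ambient space.\<close>

definition hausdorff_product_constant :: "'a::euclidean_space itself \<Rightarrow> nat \<Rightarrow> nat \<Rightarrow> ennreal \<Rightarrow> bool" where
  "hausdorff_product_constant _ k k' c \<longleftrightarrow> (\<forall>V V' D :: 'a set. subspace V \<longrightarrow> subspace V' \<longrightarrow>
      (\<forall>x\<in>V. \<forall>y\<in>V'. x \<bullet> y = 0) \<longrightarrow> dim V = k \<longrightarrow> dim V' = k' \<longrightarrow> D \<in> sets borel \<longrightarrow>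
      hausdorff_outer (k + k') ({a + b | a b. a \<in> V \<and> b \<in> V'} \<inter> D)
        = c * (\<integral>\<^sup>+b. hausdorff_outer k {a \<in> V. a + b \<in> D} \<partial>hausdorff_on k' V'))"

text \<open>The constant depends on the normalization only; its value (1, by the isodiametric inequality)
  is irrelevant here because it cancels in quotients of measures.\<close>

lemma hausdorff_product: "\<exists>c. hausdorff_product_constant TYPE('a::euclidean_space) k k' c"
proof (cases "\<exists>V V' :: 'a set. subspace V \<and> subspace V' \<and> (\<forall>x\<in>V. \<forall>y\<in>V'. x \<bullet> y = 0) \<and> dim V = k \<and> dim V' = k'")
  case False
  \<comment> \<open>There is no orthogonal pair with these dimensions, so the predicate holds
    vacuously.\<close>
  then show ?thesis unfolding hausdorff_product_constant_def by blast
next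
  case True
  then obtain V0 V0' :: "'a set" where V0: "subspace V0" "subspace V0'"
    "\<forall>x\<in>V0. \<forall>y\<in>V0'. x \<bullet> y = 0" "dim V0 = k" "dim V0' = k'" by blast
  \<comment> \<open>The constant will be \<open>r / q\<close>, read off from any one reference pair.
    Positivity and finiteness of \<open>q\<close>, that is, of the ball measures, justify the
    division.\<close>
  define q where "q = hausdorff_outer k (V0 \<inter> cball 0 1) * hausdorff_outer k' (V0' \<inter> cball 0 1)"
  define r where "r = hausdorff_outer (k + k') (product_ball V0 V0')"
  have q: "q < top" "0 < q"
    using hausdorff_outer_subspace_ball_finite[OF V0(1), of 1] hausdorff_outer_subspace_ball_finite[OF V0(2), of 1]
      hausdorff_outer_subspace_ball_pos[OF V0(1), of 1] hausdorff_outer_subspace_ball_pos[OF V0(2), of 1] V0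
    by (simp_all add: q_def ennreal_mult_less_top ennreal_zero_less_mult_iff)
  have "hausdorff_product_constant TYPE('a) k k' (r / q)"
    unfolding hausdorff_product_constant_def
  proof (intro allI impI)
    fix V V' D :: "'a set"
    assume V: "subspace V" "subspace V'" "\<forall>x\<in>V. \<forall>y\<in>V'. x \<bullet> y = 0"
      "dim V = k" "dim V' = k'" "D \<in> sets borel"
    note ex = hausdorff_product_exchange[OF V(1-3,6), unfolded V(4,5)]
    let ?W = "{a + b | a b. a \<in> V \<and> b \<in> V'}"
    let ?I = "\<integral>\<^sup>+b. hausdorff_outer k {a \<in> V. a + b \<in> D} \<partial>hausdorff_on k' V'"
    have "q * hausdorff_outer (k + k') (?W \<inter> D) = ?I * r"
    proof -
      have "hausdorff_outer k (V \<inter> cball 0 1) = hausdorff_outer k (V0 \<inter> cball 0 1)"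
        "hausdorff_outer k' (V' \<inter> cball 0 1) = hausdorff_outer k' (V0' \<inter> cball 0 1)"
        by (rule hausdorff_outer_subspace_ball_cong; simp add: V V0)+
      moreover have "hausdorff_outer (k + k') (product_ball V V') = hausdorff_outer (k + k') (product_ball V0 V0')"
        using V V0 by (intro product_ball_measure_cong) auto
      ultimately show ?thesis
        using ex(2) unfolding ex(1) q_def r_def by simp
    qed
    then have "hausdorff_outer (k + k') (?W \<inter> D) * q = ?I * r" by (simp only: mult.commute)
    moreover have "hausdorff_outer (k + k') (?W \<inter> D) = hausdorff_outer (k + k') (?W \<inter> D) * q / q"
      using q by (intro mult_divide_eq_ennreal[symmetric]) auto
    ultimately have "hausdorff_outer (k + k') (?W \<inter> D) = ?I * r / q" by (simp only:)
    also have "\<dots> = ?I * (r / q)" by (rule ennreal_times_divide[symmetric])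
    finally show "hausdorff_outer (k + k') (?W \<inter> D) = r / q * ?I" by (simp only: mult.commute)
  qed
  then show ?thesis ..
qed

subsection \<open>Direction spaces and relative interiors\<close>

lemma subspace_direction_space: "subspace (direction_space A)"
  by (simp add: direction_space_def)

lemma diff_in_direction_space: "a \<in> A \<Longrightarrow> b \<in> A \<Longrightarrow> a - b \<in> direction_space A"
  unfolding direction_space_def by (rule span_base) blast

lemma direction_space_minimal:
  "subspace V \<Longrightarrow> (\<And>a b. a \<in> A \<Longrightarrow> b \<in> A \<Longrightarrow> a - b \<in> V) \<Longrightarrow> direction_space A \<subseteq> V"
  unfolding direction_space_def by (rule span_minimal) auto

lemma direction_space_mono: "A \<subseteq> B \<Longrightarrow> direction_space A \<subseteq> direction_space B"
  by (intro direction_space_minimal subspace_direction_space diff_in_direction_space) auto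

lemma direction_space_eq_span:
  assumes a: "a \<in> A"
  shows "direction_space A = span ((\<lambda>x. - a + x) ` A)"
proof
  have "x - y \<in> span ((\<lambda>x. - a + x) ` A)" if "x \<in> A" "y \<in> A" for x y
  proof -
    have "(- a + x) - (- a + y) \<in> span ((\<lambda>x. - a + x) ` A)"
      using that by (intro span_diff span_base) auto
    then show ?thesis by simp
  qed
  then show "direction_space A \<subseteq> span ((\<lambda>x. - a + x) ` A)"
    by (intro direction_space_minimal) auto
  show "span ((\<lambda>x. - a + x) ` A) \<subseteq> direction_space A"
    using a diff_in_direction_space[of _ A a]
    by (intro span_minimal subspace_direction_space) (auto simp: algebra_simps)
qed

lemma dim_direction_space:
  fixes A :: "'a::euclidean_space set"
  assumes "A \<noteq> {}"
  shows "dim (direction_space A) = adim A"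
proof -
  obtain a where a: "a \<in> A" using assms by auto
  then have "aff_dim A = int (dim ((\<lambda>x. - a + x) ` A))" by (intro aff_dim_eq_dim hull_inc)
  then show ?thesis by (simp add: direction_space_eq_span[OF a] adim_def)
qed

lemma direction_space_convex_hull: "direction_space (convex hull A) = direction_space A"
proof
  show "direction_space (convex hull A) \<subseteq> direction_space A"
  proof (rule direction_space_minimal[OF subspace_direction_space])
    fix x y assume x: "x \<in> convex hull A" and y: "y \<in> convex hull A"
    then obtain a where a: "a \<in> A" by fastforce
    have "z - a \<in> direction_space A" if "z \<in> convex hull A" for z
    proof -
      have "convex {z. z - a \<in> direction_space A}"
      proof (rule convexI)
        fix x y :: 'a and u v :: real
        assume xy: "x \<in> {z. z - a \<in> direction_space A}" "y \<in> {z. z - a \<in> direction_space A}"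
          and uv: "0 \<le> u" "0 \<le> v" "u + v = 1"
        have "u *\<^sub>R (x - a) + v *\<^sub>R (y - a) \<in> direction_space A"
          using xy by (intro subspace_add subspace_scale subspace_direction_space) auto
        moreover have "u *\<^sub>R (x - a) + v *\<^sub>R (y - a) = (u *\<^sub>R x + v *\<^sub>R y) - (u + v) *\<^sub>R a"
          by (simp add: algebra_simps)
        ultimately show "u *\<^sub>R x + v *\<^sub>R y \<in> {z. z - a \<in> direction_space A}" using uv by simp
      qed
      then have "convex hull A \<subseteq> {z. z - a \<in> direction_space A}"
        using a by (intro hull_minimal) (auto intro: diff_in_direction_space)
      then show ?thesis using that by auto
    qed
    from subspace_diff[OF subspace_direction_space this[OF x] this[OF y]]
    show "x - y \<in> direction_space A" by simp
  qed
qed (simp add: direction_space_mono hull_subset)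

lemma relative_ball_exists:
  fixes S :: "'a::euclidean_space set"
  assumes S: "convex S" "S \<noteq> {}"
  obtains a r where "r > 0" "a \<in> S" "\<And>v. v \<in> direction_space S \<Longrightarrow> norm v \<le> r \<Longrightarrow> a + v \<in> S"
proof -
  obtain a where "a \<in> rel_interior S" using S by (auto simp: rel_interior_eq_empty[symmetric])
  then obtain r where a: "a \<in> S" and r: "r > 0" "cball a r \<inter> affine hull S \<subseteq> S"
    by (auto simp: mem_rel_interior_cball)
  have "affine hull S = (\<lambda>x. a + x) ` direction_space S"
    using a affine_hull_span_gen[OF hull_inc[OF a]] by (simp add: direction_space_eq_span[OF a])
  then have "a + v \<in> S" if "v \<in> direction_space S" "norm v \<le> r" for v
    using that r(2) by (auto simp: dist_norm)
  then show ?thesis using that r a by blast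
qed

text \<open>\<open>S\<close> lies between two translated balls of its direction space.\<close>

lemma
  fixes S :: "'a::euclidean_space set"
  assumes S: "compact S" "convex S" "S \<noteq> {}"
  shows hausdorff_outer_convex_pos: "0 < hausdorff_outer (adim S) S"
    and hausdorff_outer_convex_finite: "hausdorff_outer (adim S) S < top"
proof -
  let ?V = "direction_space S"
  obtain a r where ar: "r > 0" "a \<in> S" "\<And>v. v \<in> ?V \<Longrightarrow> norm v \<le> r \<Longrightarrow> a + v \<in> S"
    using relative_ball_exists[OF S(2,3)] by metis
  obtain R0 where R0: "\<And>x. x \<in> S \<Longrightarrow> dist a x \<le> R0"
    using compact_imp_bounded[OF S(1)] unfolding bounded_any_center[of _ a] by blast
  define R where "R = max 1 R0"
  have R: "R > 0" "\<And>x. x \<in> S \<Longrightarrow> norm (x - a) \<le> R"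
    using R0 by (auto simp: R_def dist_norm norm_minus_commute le_max_iff_disj)
  have d: "dim ?V = adim S" by (rule dim_direction_space[OF S(3)])
  have "(\<lambda>v. a + v) ` (?V \<inter> cball 0 r) \<subseteq> S" using ar by auto
  from hausdorff_outer_mono[OF this, of "adim S"]
  show "0 < hausdorff_outer (adim S) S"
    using hausdorff_outer_subspace_ball_pos[OF subspace_direction_space ar(1), of S]
    by (simp add: hausdorff_outer_translation d)
  have "S \<subseteq> (\<lambda>v. a + v) ` (?V \<inter> cball 0 R)"
  proof
    fix x assume "x \<in> S"
    then show "x \<in> (\<lambda>v. a + v) ` (?V \<inter> cball 0 R)"
      using R ar(2) by (intro image_eqI[of _ _ "x - a"]) (auto intro: diff_in_direction_space)
  qed
  from hausdorff_outer_mono[OF this, of "adim S"]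
  show "hausdorff_outer (adim S) S < top"
    using hausdorff_outer_subspace_ball_finite[OF subspace_direction_space R(1), of S]
    by (simp add: hausdorff_outer_translation d)
qed

subsection \<open>Nearby convex sets\<close>

definition hausdorff_close :: "real \<Rightarrow> 'a::metric_space set \<Rightarrow> 'a set \<Rightarrow> bool" where
  "hausdorff_close \<delta> A B \<longleftrightarrow> (\<forall>a\<in>A. \<exists>b\<in>B. dist a b < \<delta>) \<and> (\<forall>b\<in>B. \<exists>a\<in>A. dist a b < \<delta>)"

text \<open>Otherwise a hyperplane separates \<open>q\<close> from \<open>C + V\<^sup>\<bottom>\<close>. Its normal vector lies in \<open>V\<close>, and in
  this direction \<open>S\<close> extends beyond \<open>q\<close> by more than \<open>\<delta>\<close>.\<close>

lemma close_convex_projection: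
  fixes S C :: "'a::euclidean_space set"
  assumes C: "convex C" and V: "subspace V"
    and close: "\<And>s. s \<in> S \<Longrightarrow> \<exists>c\<in>C. dist c s < \<delta>"
    and \<delta>: "\<delta> < \<rho>" "\<rho> \<ge> 0" and q: "\<And>v. v \<in> V \<Longrightarrow> norm v \<le> \<rho> \<Longrightarrow> q + v \<in> S"
  shows "\<exists>c\<in>C. \<forall>v\<in>V. (c - q) \<bullet> v = 0"
proof (rule ccontr)
  assume neg: "\<not> ?thesis"
  \<comment> \<open>This is \<open>C - q + V\<^sup>\<bottom>\<close>; it contains 0 exactly if some
    point of \<open>C\<close> projects to the same point as \<open>q\<close>.\<close>
  define K where "K = (\<Union>x\<in>(\<lambda>c. - q + c) ` C. \<Union>y\<in>V\<^sup>\<bottom>. {x + y})"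
  have VT: "subspace (V\<^sup>\<bottom>)" by (rule subspace_orthogonal_comp)
  have "convex K"
    unfolding K_def by (rule convex_sums[OF convex_translation[OF C] subspace_imp_convex[OF VT]])
  moreover have "0 \<notin> K"
  proof
    assume "0 \<in> K"
    then obtain c y where c: "c \<in> C" "y \<in> V\<^sup>\<bottom>" "0 = (- q + c) + y" by (auto simp: K_def)
    then have "c - q = - y" by (simp add: algebra_simps add_eq_0_iff)
    then have "\<forall>v\<in>V. (c - q) \<bullet> v = 0"
      using c(2) by (auto simp: orthogonal_comp_def orthogonal_def inner_commute)
    then show False using neg c(1) by blast
  qed
  ultimately obtain a where a: "a \<noteq> 0" "\<And>x. x \<in> K \<Longrightarrow> 0 \<le> a \<bullet> x"
    using separating_hyperplane_set_0[of K] by blast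
  have aK: "0 \<le> a \<bullet> (c - q) + a \<bullet> y" if "c \<in> C" "y \<in> V\<^sup>\<bottom>" for c y
  proof -
    have "(- q + c) + y \<in> K" using that unfolding K_def by blast
    from a(2)[OF this] show ?thesis by (simp add: inner_simps)
  qed
  have "q \<in> S" using q[of 0] \<delta> V by (simp add: subspace_0)
  then obtain c0 where c0: "c0 \<in> C" using close by blast
  have aV: "a \<bullet> y = 0" if y: "y \<in> V\<^sup>\<bottom>" for y
  proof (rule ccontr)
    assume ne: "a \<bullet> y \<noteq> 0"
    \<comment> \<open>Chosen so that
      \<open>a \<bullet> (c0 - q) + t * (a \<bullet> y) = - 1\<close>, against the separation
      inequality.\<close>
    define t where "t = - (a \<bullet> (c0 - q) + 1) / (a \<bullet> y)"
    have "t *\<^sub>R y \<in> V\<^sup>\<bottom>" using VT y by (rule subspace_scale)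
    from aK[OF c0 this] show False using ne by (simp add: t_def)
  qed
  obtain y z where yz: "a = y + z" "y \<in> V" "\<And>w. w \<in> V \<Longrightarrow> orthogonal z w"
    using orthogonal_subspace_decomp_exists[of V a] V by (metis span_eq_iff)
  then have zT: "z \<in> V\<^sup>\<bottom>" by (auto simp: orthogonal_comp_def orthogonal_commute)
  have "z \<bullet> z = a \<bullet> z - z \<bullet> y" using yz(1) by (simp add: inner_simps inner_commute)
  also have "\<dots> = 0" using aV[OF zT] yz(2,3) by (simp add: orthogonal_def)
  finally have "a \<in> V" using yz by simp
  \<comment> \<open>The step of length \<open>\<rho>\<close> from \<open>q\<close> against the
    normal. A point of \<open>C\<close> within \<open>\<delta> < \<rho>\<close> of
    \<open>q + v\<close> is on the wrong side of the hyperplane.\<close>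
  define v where "v = - (\<rho> / norm a) *\<^sub>R a"
  have v: "v \<in> V" "norm v \<le> \<rho>" using \<open>a \<in> V\<close> V a(1) \<delta> by (auto simp: v_def subspace_scale subspace_neg)
  from close[OF q[OF v]] obtain c where c: "c \<in> C" "dist c (q + v) < \<delta>" by blast
  have "a \<bullet> (c - q) = a \<bullet> v + a \<bullet> (c - (q + v))" by (simp add: inner_simps)
  also have "a \<bullet> v = - \<rho> * norm a" using a(1) by (simp add: v_def dot_square_norm power2_eq_square)
  also have "a \<bullet> (c - (q + v)) \<le> norm a * norm (c - (q + v))" by (rule norm_cauchy_schwarz)
  also have "norm a * norm (c - (q + v)) < norm a * \<rho>"
    using c(2) \<delta> a(1) by (intro mult_strict_left_mono) (auto simp: dist_norm)
  finally have "a \<bullet> (c - q) < 0" by (simp add: mult.commute)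
  then show False using aK[OF c(1), of 0] VT by (simp add: subspace_0)
qed

text \<open>The complement is the sum of the closed set \<open>- G\<close> and a compact ball, hence
  closed.\<close>

lemma open_erosion:
  fixes G :: "'a::euclidean_space set"
  assumes G: "open G"
  shows "open {x. cball x e \<subseteq> G}"
proof -
  have "{x. cball x e \<subseteq> G} = - (\<Union>x\<in>- G. \<Union>y\<in>cball 0 e. {x + y})"
  proof (intro set_eqI iffI)
    fix x assume x: "x \<in> {x. cball x e \<subseteq> G}"
    show "x \<in> - (\<Union>x\<in>- G. \<Union>y\<in>cball 0 e. {x + y})"
    proof
      assume "x \<in> (\<Union>x\<in>- G. \<Union>y\<in>cball 0 e. {x + y})"
      then obtain g y where "g \<notin> G" "norm y \<le> e" "x = g + y" by auto
      then have "g \<in> cball x e" by (simp add: dist_norm)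
      then show False using x \<open>g \<notin> G\<close> by auto
    qed
  next
    fix x assume x: "x \<in> - (\<Union>x\<in>- G. \<Union>y\<in>cball 0 e. {x + y})"
    have "g \<in> G" if "g \<in> cball x e" for g
    proof (rule ccontr)
      assume "g \<notin> G"
      moreover have "x = g + (x - g)" "x - g \<in> cball 0 e" using that by (auto simp: dist_norm norm_minus_commute)
      ultimately show False using x by blast
    qed
    then show "x \<in> {x. cball x e \<subseteq> G}" by blast
  qed
  moreover have "closed (\<Union>x\<in>- G. \<Union>y\<in>cball 0 e. {x + y})"
    using G by (intro closed_compact_sums) auto
  ultimately show ?thesis by (metis open_Compl)
qed

text \<open>The copies of \<open>S\<close> shrunk by \<open>\<theta> \<rightarrow> 1\<close> exhaust \<open>S\<close> up to a null set, because their measures are at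
  least \<open>\<theta>\<^sup>k\<close> times that of \<open>S\<close>.\<close>

lemma hausdorff_inner_approximation:
  fixes S G :: "'a::euclidean_space set"
  assumes S: "compact S" "convex S" "S \<noteq> {}" and G: "open G"
    and a: "a \<in> S" and \<kappa>: "\<kappa> < hausdorff_outer (adim S) (S \<inter> G)"
  obtains \<theta> e where "0 < \<theta>" "\<theta> < 1" "0 < e"
    "\<kappa> < hausdorff_outer (adim S) ((\<lambda>s. a + \<theta> *\<^sub>R (s - a)) ` S \<inter> {x. cball x e \<subseteq> G})"
proof -
  define k where "k = adim S"
  \<comment> \<open>The offset 2 keeps \<open>\<theta> 0\<close> positive, as is needed to divide by
    it.\<close>
  define \<theta> where "\<theta> i = 1 - 1 / real (i + 2)" for i :: nat
  define Sh where "Sh i = (\<lambda>s. a + \<theta> i *\<^sub>R (s - a)) ` S" for i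
  define E where "E i = {x. cball x (1 / real (i + 1)) \<subseteq> G}" for i :: nat
  have \<theta>: "0 < \<theta> i" "\<theta> i < 1" for i by (auto simp: \<theta>_def)
  have \<theta>mono: "\<theta> i \<le> \<theta> j" if "i \<le> j" for i j
    using that by (auto simp: \<theta>_def intro!: divide_left_mono)
  have scale: "a + t *\<^sub>R (s - a) \<in> S" if "0 \<le> t" "t \<le> 1" "s \<in> S" for t s
  proof -
    have "(1 - t) *\<^sub>R a + t *\<^sub>R s \<in> S" using that a S(2) by (intro convexD) auto
    then show ?thesis by (simp add: algebra_simps)
  qed
  have ShS: "Sh i \<subseteq> S" for i using scale[of "\<theta> i"] \<theta>[of i] by (auto simp: Sh_def)
  have Shinc: "incseq Sh"
  proof (intro incseq_def[THEN iffD2] allI impI subsetI)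
    fix i j :: nat and x assume ij: "i \<le> j" and "x \<in> Sh i"
    then obtain s where s: "s \<in> S" "x = a + \<theta> i *\<^sub>R (s - a)" by (auto simp: Sh_def)
    have "a + (\<theta> i / \<theta> j) *\<^sub>R (s - a) \<in> S"
      using \<theta>[of i] \<theta>[of j] \<theta>mono[OF ij] s by (intro scale) auto
    then show "x \<in> Sh j"
      unfolding Sh_def using s \<theta>[of j] by (intro image_eqI[of _ _ "a + (\<theta> i / \<theta> j) *\<^sub>R (s - a)"]) auto
  qed
  have Einc: "incseq E"
  proof (intro incseq_def[THEN iffD2] allI impI subsetI)
    fix i j :: nat and x assume ij: "i \<le> j" and x: "x \<in> E i"
    have "1 / real (j + 1) \<le> 1 / real (i + 1)" using ij by (simp add: frac_le)
    then have "cball x (1 / real (j + 1)) \<subseteq> cball x (1 / real (i + 1))" by (rule subset_cball)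
    then show "x \<in> E j" using x by (auto simp: E_def)
  qed
  have UE: "(\<Union>i. E i) = G"
  proof (intro subset_antisym subsetI)
    fix x assume "x \<in> G"
    then obtain e where e: "e > 0" "cball x e \<subseteq> G" using G open_contains_cball by blast
    obtain n where "1 / real (Suc n) < e" using nat_approx_posE[OF e(1)] by blast
    then have "x \<in> E n" using e subset_cball[of "1 / real (n + 1)" e x] by (auto simp: E_def)
    then show "x \<in> (\<Union>i. E i)" by blast
  next
    fix x assume "x \<in> (\<Union>i. E i)"
    then obtain i where "cball x (1 / real (i + 1)) \<subseteq> G" by (auto simp: E_def)
    moreover have "x \<in> cball x (1 / real (i + 1))" by simp
    ultimately show "x \<in> G" by blast
  qed
  have "compact (Sh i)" for i
    unfolding Sh_def by (intro compact_continuous_image S continuous_intros)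
  then have Shb: "Sh i \<in> sets borel" for i by (simp add: compact_imp_closed)
  have Eb: "E i \<in> sets borel" for i using open_erosion[OF G] by (simp add: E_def)
  let ?H = "hausdorff_outer k :: 'a set \<Rightarrow> ennreal"
  let ?M = "hausdorff_measure k :: 'a measure"
  have HM: "?H A = emeasure ?M A" if "A \<in> sets borel" for A
    using that by (simp add: emeasure_hausdorff_measure borel_sets_hausdorff)
  let ?U = "\<Union>i. Sh i"
  have US: "?U \<subseteq> S" using ShS by blast
  have Ub: "?U \<in> sets borel" using Shb by auto
  have Sb: "S \<in> sets borel" using S by (simp add: compact_imp_closed)
  have fin: "?H S < top" unfolding k_def by (rule hausdorff_outer_convex_finite[OF S])
  \<comment> \<open>Undoing the contraction with factor \<open>\<theta> i\<close> is Lipschitz with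
    constant \<open>1 / \<theta> i\<close>, which tends to 1.\<close>
  have le: "?H S \<le> ennreal ((1 / \<theta> i) ^ k) * ?H ?U" for i
  proof (rule hausdorff_outer_expansion[of _ _ "\<lambda>s. a + \<theta> i *\<^sub>R (s - a)"])
    show "0 < 1 / \<theta> i" using \<theta> by simp
    show "dist x y \<le> 1 / \<theta> i * dist (a + \<theta> i *\<^sub>R (x - a)) (a + \<theta> i *\<^sub>R (y - a))" for x y
    proof -
      have "(a + \<theta> i *\<^sub>R (x - a)) - (a + \<theta> i *\<^sub>R (y - a)) = \<theta> i *\<^sub>R (x - y)"
        by (simp add: algebra_simps)
      then have "dist (a + \<theta> i *\<^sub>R (x - a)) (a + \<theta> i *\<^sub>R (y - a)) = \<theta> i * dist x y"
        using \<theta>[of i] by (simp only: dist_norm norm_scaleR)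
      then show ?thesis using \<theta>[of i] by simp
    qed
  qed (auto simp: Sh_def)
  have "(\<lambda>i. 1 / real (i + 2)) \<longlonglongrightarrow> 0"
    using LIMSEQ_ignore_initial_segment[OF lim_1_over_n, of 2] by simp
  then have "\<theta> \<longlonglongrightarrow> 1 - 0" unfolding \<theta>_def[abs_def] by (intro tendsto_intros)
  then have "(\<lambda>i. ennreal ((1 / \<theta> i) ^ k) * ?H ?U) \<longlonglongrightarrow> ennreal ((1 / (1 - 0)) ^ k) * ?H ?U"
    by (intro tendsto_mult_ennreal tendsto_ennrealI tendsto_intros) auto
  then have "(\<lambda>i. ennreal ((1 / \<theta> i) ^ k) * ?H ?U) \<longlonglongrightarrow> ?H ?U" by simp
  then have "?H S \<le> ?H ?U" by (rule LIMSEQ_le_const) (use le in blast)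
  then have "?H S = ?H ?U" using hausdorff_outer_mono[OF US, of k] by simp
  then have "?H (S - ?U) = 0"
  proof -
    have "?H (S - ?U) = emeasure ?M (S - ?U)" by (rule HM) (use Ub Sb in auto)
    also have "\<dots> = emeasure ?M S - emeasure ?M ?U"
    proof (rule emeasure_Diff)
      show "emeasure ?M ?U \<noteq> \<infinity>" using fin \<open>?H S = ?H ?U\<close> HM[OF Ub] by (metis infinity_ennreal_def less_irrefl)
    qed (use Ub Sb US in \<open>auto intro!: borel_sets_hausdorff\<close>)
    also have "\<dots> = ?H S - ?H ?U" using HM[OF Ub] HM[OF Sb] by (simp only:)
    also have "\<dots> = 0" using fin \<open>?H S = ?H ?U\<close> by (metis ennreal_diff_self less_irrefl)
    finally show ?thesis .
  qed
  moreover have "?H (S \<inter> G) \<le> ?H (?U \<inter> G) + ?H (S - ?U)"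
    by (rule order_trans[OF _ hausdorff_outer_Un]) (auto intro!: hausdorff_outer_mono)
  ultimately have "\<kappa> < ?H (?U \<inter> G)" using \<kappa> unfolding k_def[symmetric] by (simp add: less_le_trans)
  moreover have "?U \<inter> G = (\<Union>i. Sh i \<inter> E i)"
    unfolding UE[symmetric]
  proof (intro subset_antisym subsetI)
    fix x assume "x \<in> ?U \<inter> (\<Union>i. E i)"
    then obtain i j where "x \<in> Sh i" "x \<in> E j" by auto
    then have "x \<in> Sh (max i j) \<inter> E (max i j)"
      using incseqD[OF Shinc, of i "max i j"] incseqD[OF Einc, of j "max i j"] by auto
    then show "x \<in> (\<Union>i. Sh i \<inter> E i)" by blast
  qed auto
  \<comment> \<open>Continuity from below picks a single index for both the contraction and the
    margin.\<close>
  moreover have "?H (\<Union>i. Sh i \<inter> E i) = (SUP i. ?H (Sh i \<inter> E i))"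
  proof -
    have "incseq (\<lambda>i. Sh i \<inter> E i)"
      using Shinc Einc unfolding incseq_def by blast
    moreover have "range (\<lambda>i. Sh i \<inter> E i) \<subseteq> sets ?M"
      using Shb Eb by (auto intro!: borel_sets_hausdorff)
    ultimately have "(SUP i. emeasure ?M (Sh i \<inter> E i)) = emeasure ?M (\<Union>i. Sh i \<inter> E i)"
      by (intro SUP_emeasure_incseq)
    moreover have "(\<Union>i. Sh i \<inter> E i) \<in> sets borel" "\<And>i. Sh i \<inter> E i \<in> sets borel" using Shb Eb by auto
    ultimately show ?thesis by (simp add: HM)
  qed
  ultimately obtain i where "\<kappa> < ?H (Sh i \<inter> E i)" by (auto simp: less_SUP_iff)
  then show ?thesis
    using that[of "\<theta> i" "1 / real (i + 1)"] \<theta>[of i] by (simp add: Sh_def E_def k_def)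
qed

text \<open>Every point \<open>q\<close> of a slightly shrunk copy of \<open>S\<close> has a
  relative ball around it inside \<open>S\<close>, so \<open>C\<close> contains a point
  \<open>g q\<close> that projects orthogonally to \<open>q\<close>. The map \<open>g\<close> does
  not decrease distances, and the expansion lemma with \<open>L = 1\<close> applies.\<close>

lemma hausdorff_lower_semicontinuous:
  fixes S G :: "'a::euclidean_space set"
  assumes S: "compact S" "convex S" "S \<noteq> {}" and G: "open G"
    and \<kappa>: "\<kappa> < hausdorff_outer (adim S) (S \<inter> G)"
  obtains \<delta> where "\<delta> > 0" "\<And>C. convex C \<Longrightarrow> hausdorff_close \<delta> C S \<Longrightarrow>
      \<kappa> \<le> hausdorff_outer (adim S) (C \<inter> {x. cball x \<delta> \<subseteq> G})"
proof -
  let ?V = "direction_space S"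
  obtain a r where r: "r > 0" and a: "a \<in> S" and ar: "\<And>v. v \<in> ?V \<Longrightarrow> norm v \<le> r \<Longrightarrow> a + v \<in> S"
    using relative_ball_exists[OF S(2,3)] by metis
  obtain \<theta> e where \<theta>: "0 < \<theta>" "\<theta> < 1" and e: "0 < e"
    and \<kappa>': "\<kappa> < hausdorff_outer (adim S) ((\<lambda>s. a + \<theta> *\<^sub>R (s - a)) ` S \<inter> {x. cball x e \<subseteq> G})"
    using hausdorff_inner_approximation[OF S G a \<kappa>] by metis
  \<comment> \<open>A point shrunk towards \<open>a\<close> by \<open>\<theta>\<close> keeps a
    relative ball of this radius: it is a convex combination in which the ball around
    \<open>a\<close> has weight \<open>1 - \<theta>\<close>.\<close>
  define \<rho> where "\<rho> = r * (1 - \<theta>)"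
  have \<rho>: "\<rho> > 0" using r \<theta> by (simp add: \<rho>_def)
  \<comment> \<open>Below \<open>\<rho>\<close> for the projection lemma; at most
    \<open>e / 2\<close> because a displacement from \<open>q\<close> to \<open>g q\<close> and a
    remaining margin \<open>\<delta>\<close> must both fit into \<open>e\<close>.\<close>
  define \<delta> where "\<delta> = min (\<rho> / 2) (e / 2)"
  have \<delta>: "\<delta> > 0" "\<delta> < \<rho>" "2 * \<delta> \<le> e" using \<rho> e by (auto simp: \<delta>_def)
  let ?A = "(\<lambda>s. a + \<theta> *\<^sub>R (s - a)) ` S \<inter> {x. cball x e \<subseteq> G}"
  have "hausdorff_outer (adim S) ?A \<le> hausdorff_outer (adim S) (C \<inter> {x. cball x \<delta> \<subseteq> G})"
    if C: "convex C" "hausdorff_close \<delta> C S" for C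
  proof -
    have "\<exists>c\<in>C \<inter> {x. cball x \<delta> \<subseteq> G}. \<forall>v\<in>?V. (c - q) \<bullet> v = 0" if q: "q \<in> ?A" for q
    proof -
      obtain s where s: "s \<in> S" "q = a + \<theta> *\<^sub>R (s - a)" using q by auto
      have qS: "q + v \<in> S" if v: "v \<in> ?V" "norm v \<le> \<rho>" for v
      proof -
        have "(1 / (1 - \<theta>)) *\<^sub>R v \<in> ?V" using v(1) by (intro subspace_scale subspace_direction_space)
        moreover have "norm ((1 / (1 - \<theta>)) *\<^sub>R v) \<le> r" using v(2) \<theta> by (simp add: \<rho>_def field_simps)
        ultimately have "a + (1 / (1 - \<theta>)) *\<^sub>R v \<in> S" by (rule ar)
        then have "\<theta> *\<^sub>R s + (1 - \<theta>) *\<^sub>R (a + (1 / (1 - \<theta>)) *\<^sub>R v) \<in> S"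
          using S(2) s(1) \<theta> by (intro convexD) auto
        moreover have "\<theta> *\<^sub>R s + (1 - \<theta>) *\<^sub>R (a + (1 / (1 - \<theta>)) *\<^sub>R v) = q + v"
          using \<theta> by (simp add: s algebra_simps)
        ultimately show ?thesis by simp
      qed
      have "\<exists>c\<in>C. \<forall>v\<in>?V. (c - q) \<bullet> v = 0"
        using close_convex_projection[OF C(1) subspace_direction_space, where S=S and \<delta>=\<delta> and \<rho>=\<rho> and q=q] C(2) \<delta> \<rho> qS
        unfolding hausdorff_close_def by auto
      then obtain c where c: "c \<in> C" "\<And>v. v \<in> ?V \<Longrightarrow> (c - q) \<bullet> v = 0" by blast
      obtain s' where s': "s' \<in> S" "dist c s' < \<delta>" using C(2) c(1) by (auto simp: hausdorff_close_def)
      have "q \<in> S" using qS[of 0] \<rho> by (simp add: subspace_0 subspace_direction_space)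
      \<comment> \<open>Since \<open>q - s'\<close> is a direction of \<open>S\<close>, the point
        \<open>q\<close> is at least as close to \<open>c\<close> as \<open>s'\<close> is.\<close>
      then have "(c - q) \<bullet> (q - s') = 0" using s' by (intro c diff_in_direction_space)
      then have cq: "dist c q < \<delta>" using norm_le_orthogonal_add(1)[of "c - q" "q - s'"] s' by (simp add: dist_norm)
      have "cball c \<delta> \<subseteq> cball q e"
      proof
        fix x assume "x \<in> cball c \<delta>"
        then show "x \<in> cball q e" using cq \<delta>(3) dist_triangle[of q x c] by (simp add: dist_commute)
      qed
      then show ?thesis using c q by blast
    qed
    then obtain g where g: "\<And>q. q \<in> ?A \<Longrightarrow> g q \<in> C \<inter> {x. cball x \<delta> \<subseteq> G}"
      "\<And>q v. q \<in> ?A \<Longrightarrow> v \<in> ?V \<Longrightarrow> (g q - q) \<bullet> v = 0" by metis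
    have AS: "?A \<subseteq> S"
    proof
      fix q assume "q \<in> ?A"
      then obtain s where s: "s \<in> S" "q = a + \<theta> *\<^sub>R (s - a)" by auto
      have "(1 - \<theta>) *\<^sub>R a + \<theta> *\<^sub>R s \<in> S" using S(2) a \<theta> s(1) by (intro convexD) auto
      moreover have "(1 - \<theta>) *\<^sub>R a + \<theta> *\<^sub>R s = a + \<theta> *\<^sub>R (s - a)" by (simp add: algebra_simps)
      ultimately show "q \<in> S" using s(2) by simp
    qed
    have "hausdorff_outer (adim S) ?A \<le> ennreal (1 ^ adim S) * hausdorff_outer (adim S) (C \<inter> {x. cball x \<delta> \<subseteq> G})"
    proof (rule hausdorff_outer_expansion[of 1 ?A g])
      fix x y assume xy: "x \<in> ?A" "y \<in> ?A"
      then have "x - y \<in> ?V" using AS by (intro diff_in_direction_space) auto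
      then have "(x - y) \<bullet> ((g x - x) - (g y - y)) = 0"
        using g(2)[OF xy(1)] g(2)[OF xy(2)] by (metis diff_zero inner_commute inner_diff_left)
      from norm_le_orthogonal_add(1)[OF this]
      show "dist x y \<le> 1 * dist (g x) (g y)" by (simp add: dist_norm)
    qed (use g in auto)
    then show ?thesis by simp
  qed
  then show ?thesis using that[of \<delta>] \<delta>(1) \<kappa>' by (meson less_imp_le order_trans)
qed

lemma eventually_at_right_less_limit:
  fixes f :: "real \<Rightarrow> real"
  assumes "(f \<longlongrightarrow> l) (at_right 0)" "l < u" "0 < b"
  obtains d where "0 < d" "d < b" "f d < u"
proof -
  have "\<forall>\<^sub>F d in at_right 0. f d < u" using assms(1,2) by (rule order_tendstoD)
  moreover have "\<forall>\<^sub>F d in at_right (0::real). 0 < d \<and> d < b"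
    using assms(3) by (auto simp: eventually_at_right_field)
  ultimately have "\<forall>\<^sub>F d in at_right (0::real). 0 < d \<and> d < b \<and> f d < u" by eventually_elim auto
  then show ?thesis using that eventually_happens[of _ "at_right (0::real)"] by (auto simp: trivial_limit_at_right_real)
qed

lemma orthogonal_complement_within:
  fixes V W :: "'a::euclidean_space set"
  assumes V: "subspace V" and W: "subspace W" and VW: "V \<subseteq> W"
  obtains V' where "subspace V'" "\<forall>x\<in>V. \<forall>y\<in>V'. x \<bullet> y = 0" "dim V + dim V' = dim W"
    "{a + b | a b. a \<in> V \<and> b \<in> V'} = W" "V\<^sup>\<bottom> \<inter> W \<subseteq> V'"
proof (rule that[of "{y \<in> W. \<forall>x\<in>V. orthogonal x y}"])
  let ?V' = "{y \<in> W. \<forall>x\<in>V. orthogonal x y}"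
  show "subspace ?V'"
    using W by (auto simp: subspace_def orthogonal_def inner_simps)
  show "\<forall>x\<in>V. \<forall>y\<in>?V'. x \<bullet> y = 0" by (auto simp: orthogonal_def)
  show "dim V + dim ?V' = dim W"
    using dim_subspace_orthogonal_to_vectors[OF V W VW] by simp
  show "{a + b | a b. a \<in> V \<and> b \<in> ?V'} = W"
  proof (intro subset_antisym subsetI)
    fix x assume x: "x \<in> W"
    obtain y z where yz: "x = y + z" "y \<in> V" "\<And>w. w \<in> V \<Longrightarrow> orthogonal z w"
      using orthogonal_subspace_decomp_exists[of V x] V by (metis span_eq_iff)
    then have "z = x - y" by simp
    then have "z \<in> W" using x yz(2) VW W by (auto intro: subspace_diff)
    then have "z \<in> ?V'" using yz(3) by (auto simp: orthogonal_commute)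
    then show "x \<in> {a + b | a b. a \<in> V \<and> b \<in> ?V'}" using yz(1,2) by blast
  qed (use VW W in \<open>auto intro: subspace_add\<close>)
  show "V\<^sup>\<bottom> \<inter> W \<subseteq> ?V'" by (auto simp: orthogonal_comp_def)
qed

text \<open>Close to \<open>S\<close>, the orthogonal projection of the direction space of \<open>C\<close> to the one of \<open>S\<close>
  is surjective and hence, by dimension, a bijection which is almost an isometry.\<close>

lemma hausdorff_upper_semicontinuous:
  fixes S :: "'a::euclidean_space set"
  assumes S: "compact S" "convex S" "S \<noteq> {}" and \<eta>: "\<eta> > 0"
  obtains \<delta> where "\<delta> > 0" "\<And>C. convex C \<Longrightarrow> hausdorff_close \<delta> C S \<Longrightarrow> dim (direction_space C) \<le> adim S \<Longrightarrow>
      dim (direction_space C) = adim S \<and>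
      hausdorff_outer (adim S) C \<le> ennreal (1 + \<eta>) * hausdorff_outer (adim S) S"
proof -
  define k where "k = adim S"
  define V where "V = direction_space S"
  have V: "subspace V" unfolding V_def by (rule subspace_direction_space)
  have dimV: "dim V = k" unfolding V_def k_def by (rule dim_direction_space[OF S(3)])
  obtain a r where r: "r > 0" and a: "a \<in> S" and ar: "\<And>v. v \<in> V \<Longrightarrow> norm v \<le> r \<Longrightarrow> a + v \<in> S"
    using relative_ball_exists[OF S(2,3)] unfolding V_def by metis
  \<comment> \<open>The Lipschitz constant has two factors: \<open>1 + 4 * d / r\<close> for
    inverting the projection on directions of \<open>C\<close>, and \<open>1 + d / r\<close> for
    contracting the projected set into \<open>S\<close>.\<close>
  have "((\<lambda>d. ((1 + 4 * d / r) * (1 + d / r)) ^ k) \<longlongrightarrow> ((1 + 4 * 0 / r) * (1 + 0 / r)) ^ k) (at_right 0)"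
    using r by (intro tendsto_intros) auto
  then have "((\<lambda>d. ((1 + 4 * d / r) * (1 + d / r)) ^ k) \<longlongrightarrow> 1) (at_right 0)" by simp
  from eventually_at_right_less_limit[OF this, of "1 + \<eta>" "r / 2"] obtain \<delta>
    where \<delta>: "0 < \<delta>" "\<delta> < r / 2" and L: "((1 + 4 * \<delta> / r) * (1 + \<delta> / r)) ^ k < 1 + \<eta>"
    using \<eta> r by auto
  have "dim (direction_space C) = k \<and> hausdorff_outer k C \<le> ennreal (1 + \<eta>) * hausdorff_outer k S"
    if C: "convex C" "hausdorff_close \<delta> C S" "dim (direction_space C) \<le> k" for C
  proof -
    define D where "D = direction_space C"
    have D: "subspace D" unfolding D_def by (rule subspace_direction_space)
    have VS: "x - y \<in> V" if "x \<in> S" "y \<in> S" for x y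
      using that unfolding V_def by (rule diff_in_direction_space)
    have pr: "\<exists>c\<in>C. (\<forall>v\<in>V. (c - (a + q)) \<bullet> v = 0) \<and> norm (c - (a + q)) < \<delta>" if q: "q \<in> V" "norm q \<le> r / 2" for q
    proof -
      have qS: "a + q + v \<in> S" if "v \<in> V" "norm v \<le> r / 2" for v
        using ar[of "q + v"] norm_triangle_ineq[of q v] that q V by (simp add: subspace_add add.assoc)
      have "\<exists>c\<in>C. \<forall>v\<in>V. (c - (a + q)) \<bullet> v = 0"
        using close_convex_projection[OF C(1) V, where S=S and \<delta>=\<delta> and \<rho>="r/2" and q="a+q"] C(2) \<delta> r qS
        unfolding hausdorff_close_def by auto
      then obtain c where c: "c \<in> C" "\<And>v. v \<in> V \<Longrightarrow> (c - (a + q)) \<bullet> v = 0" by blast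
      obtain s where s: "s \<in> S" "dist c s < \<delta>" using C(2) c(1) by (auto simp: hausdorff_close_def)
      have "a + q \<in> S" using qS[of 0] r V by (simp add: subspace_0)
      then have "(c - (a + q)) \<bullet> ((a + q) - s) = 0" using s by (intro c VS)
      then have "norm (c - (a + q)) < \<delta>"
        using norm_le_orthogonal_add(1)[of "c - (a + q)" "(a + q) - s"] s by (simp add: dist_norm)
      then show ?thesis using c by blast
    qed
    \<comment> \<open>After scaling \<open>v\<close> to length \<open>r / 2\<close>, the difference
      of two points of \<open>C\<close>, one above \<open>a + t v\<close> and one above
      \<open>a\<close>, is a direction projecting to \<open>t v\<close>. Its error is at most
      \<open>2 * \<delta>\<close>; dividing by \<open>t\<close> gives the factor
      \<open>4 * \<delta> / r\<close>.\<close>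
    have surj: "\<exists>d\<in>D. (\<forall>u\<in>V. (d - v) \<bullet> u = 0) \<and> norm (d - v) \<le> 4 * \<delta> / r * norm v" if v: "v \<in> V" for v
    proof (cases "v = 0")
      case True
      then show ?thesis using D by (intro bexI[of _ 0]) (auto simp: subspace_0)
    next
      case False
      define t where "t = (r / 2) / norm v"
      have t: "t > 0" using r False by (simp add: t_def)
      have "norm (t *\<^sub>R v) \<le> r / 2" using False r by (simp add: t_def)
      from pr[OF subspace_scale[OF V v] this] obtain c1 where c1: "c1 \<in> C"
        "\<And>u. u \<in> V \<Longrightarrow> (c1 - (a + t *\<^sub>R v)) \<bullet> u = 0" "norm (c1 - (a + t *\<^sub>R v)) < \<delta>" by blast
      from pr[OF subspace_0[OF V]] r obtain c0 where c0: "c0 \<in> C"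
        "\<And>u. u \<in> V \<Longrightarrow> (c0 - a) \<bullet> u = 0" "norm (c0 - a) < \<delta>" by auto
      define d where "d = (1 / t) *\<^sub>R (c1 - c0)"
      have "d \<in> D" unfolding d_def D_def
        using c0(1) c1(1) by (intro subspace_scale subspace_direction_space diff_in_direction_space)
      moreover have e: "d - v = (1 / t) *\<^sub>R ((c1 - (a + t *\<^sub>R v)) - (c0 - a))"
        using t by (simp add: d_def algebra_simps)
      moreover have "norm (d - v) \<le> 4 * \<delta> / r * norm v"
      proof -
        have "norm ((c1 - (a + t *\<^sub>R v)) - (c0 - a)) \<le> 2 * \<delta>"
          using norm_triangle_ineq4[of "c1 - (a + t *\<^sub>R v)" "c0 - a"] c0(3) c1(3) by linarith
        then have "norm (d - v) \<le> 1 / t * (2 * \<delta>)"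
          unfolding e norm_scaleR using t by (simp add: divide_right_mono)
        also have "\<dots> = 4 * \<delta> / r * norm v" using False r by (simp add: t_def)
        finally show ?thesis .
      qed
      moreover have "(d - v) \<bullet> u = 0" if "u \<in> V" for u
      proof -
        have "(d - v) \<bullet> u = 1 / t * ((c1 - (a + t *\<^sub>R v)) \<bullet> u - (c0 - a) \<bullet> u)"
          unfolding e inner_scaleR_left by (simp only: inner_diff_left)
        then show ?thesis using c0(2)[OF that] c1(2)[OF that] by (simp only:) simp
      qed
      ultimately show ?thesis by blast
    qed
    obtain V' where V': "subspace V'" "\<forall>x\<in>V. \<forall>y\<in>V'. x \<bullet> y = 0" "dim V + dim V' = dim (UNIV :: 'a set)"
      "{a + b | a b. a \<in> V \<and> b \<in> V'} = UNIV" "V\<^sup>\<bottom> \<inter> UNIV \<subseteq> V'"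
      by (rule orthogonal_complement_within[OF V subspace_UNIV subset_UNIV])
    have memV': "y \<in> V'" if "\<forall>u\<in>V. y \<bullet> u = 0" for y
      using that V'(5) by (auto simp: orthogonal_comp_def orthogonal_def inner_commute)
    have dec: "\<exists>y\<in>V. \<exists>z\<in>V'. x = y + z" for x using V'(4) by blast
    \<comment> \<open>Surjectivity of the projection says \<open>D + V' = UNIV\<close>. With
      \<open>dim D \<le> k\<close> the dimension formula then forces \<open>dim D = k\<close> and a
      trivial intersection with \<open>V'\<close>, hence injectivity.\<close>
    have "{x + y | x y. x \<in> D \<and> y \<in> V'} = UNIV"
    proof (intro subset_antisym subsetI)
      fix x :: 'a
      obtain y z where yz: "x = y + z" "y \<in> V" "z \<in> V'" using dec by blast
      obtain d where d: "d \<in> D" "\<forall>u\<in>V. (d - y) \<bullet> u = 0" using surj[OF yz(2)] by blast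
      have "x = d + (z - (d - y))" using yz(1) by simp
      then show "x \<in> {x + y | x y. x \<in> D \<and> y \<in> V'}"
        using d(1) subspace_diff[OF V'(1) yz(3) memV'[OF d(2)]] by blast
    qed simp
    then have "DIM('a) + dim (D \<inter> V') = dim D + dim V'"
      using dim_sums_Int[OF D V'(1)] by simp
    then have dims: "dim D = k" "dim (D \<inter> V') = 0"
      using V'(3) dimV C(3) unfolding D_def dim_UNIV by linarith+
    then have DV': "x = 0" if "x \<in> D" "x \<in> V'" for x using that by auto
    have normD: "norm d \<le> (1 + 4 * \<delta> / r) * norm v" if d: "d \<in> D" and v: "v \<in> V" "\<forall>u\<in>V. (d - v) \<bullet> u = 0" for d v
    proof -
      obtain d' where d': "d' \<in> D" "\<forall>u\<in>V. (d' - v) \<bullet> u = 0" "norm (d' - v) \<le> 4 * \<delta> / r * norm v"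
        using surj[OF v(1)] by blast
      have "d - d' \<in> V'"
        using subspace_diff[OF V'(1) memV'[OF v(2)] memV'[OF d'(2)]] by simp
      from DV'[OF subspace_diff[OF D d d'(1)] this]
      have "norm (d - v) \<le> 4 * \<delta> / r * norm v" using d'(3) by simp
      then show ?thesis using norm_triangle_ineq[of v "d - v"] by (simp add: algebra_simps)
    qed
    \<comment> \<open>The projection of \<open>C\<close> sticks out of \<open>S\<close> by at most
      \<open>\<delta>\<close>. Contraction towards \<open>a\<close> by \<open>\<mu>\<close> brings
      it back: \<open>a + \<mu> p c\<close> is a convex combination of a point of \<open>S\<close>
      and a point of the ball of radius \<open>r\<close> around \<open>a\<close>, as
      \<open>(1 - \<mu>) * (r / \<delta>) = \<mu>\<close>.\<close>
    define \<mu> where "\<mu> = r / (r + \<delta>)"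
    have \<mu>: "0 < \<mu>" "\<mu> < 1" "1 / \<mu> = 1 + \<delta> / r" "1 - \<mu> = \<delta> / (r + \<delta>)"
      using r \<delta> by (auto simp: \<mu>_def field_simps)
    have "\<exists>v. v \<in> V \<and> (\<forall>u\<in>V. ((c - a) - v) \<bullet> u = 0)" for c
    proof -
      obtain y z where "c - a = y + z" "y \<in> V" "z \<in> V'" using dec by blast
      then show ?thesis using V'(2) by (intro exI[of _ y]) (simp add: inner_commute)
    qed
    then obtain p where p: "\<And>c. p c \<in> V" "\<And>c u. u \<in> V \<Longrightarrow> ((c - a) - p c) \<bullet> u = 0" by metis
    have "hausdorff_outer k C \<le> ennreal (((1 + 4 * \<delta> / r) * (1 + \<delta> / r)) ^ k) * hausdorff_outer k S"
    proof (rule hausdorff_outer_expansion)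
      show "0 < (1 + 4 * \<delta> / r) * (1 + \<delta> / r)" using r \<delta> by (intro mult_pos_pos add_pos_pos) auto
      fix c assume c: "c \<in> C"
      then obtain s where s: "s \<in> S" "dist c s < \<delta>" using C(2) by (auto simp: hausdorff_close_def)
      have w: "a + p c - s \<in> V" using subspace_add[OF V p(1)[of c] VS[OF a s(1)]] by (simp add: algebra_simps)
      have "((c - a) - p c) \<bullet> (a + p c - s) = 0" by (rule p(2)[OF w])
      from norm_le_orthogonal_add(2)[OF this]
      have "norm (a + p c - s) \<le> \<delta>" using s(2) by (simp add: dist_norm)
      then have "r / \<delta> * norm (a + p c - s) \<le> r / \<delta> * \<delta>"
        using r \<delta> by (intro mult_left_mono) auto
      then have "norm ((r / \<delta>) *\<^sub>R (a + p c - s)) \<le> r"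
        unfolding norm_scaleR using r \<delta> by simp
      then have "a + (r / \<delta>) *\<^sub>R (a + p c - s) \<in> S" by (intro ar subspace_scale[OF V w])
      then have "\<mu> *\<^sub>R s + (1 - \<mu>) *\<^sub>R (a + (r / \<delta>) *\<^sub>R (a + p c - s)) \<in> S"
        using S(2) s(1) \<mu> by (intro convexD) auto
      moreover have "(1 - \<mu>) *\<^sub>R (r / \<delta>) *\<^sub>R (a + p c - s) = \<mu> *\<^sub>R (a + p c - s)"
      proof -
        have "(1 - \<mu>) * (r / \<delta>) = \<mu>" using \<delta> r unfolding \<mu>(4) by (simp add: \<mu>_def)
        then show ?thesis by (simp only: scaleR_scaleR)
      qed
      ultimately have "\<mu> *\<^sub>R s + ((1 - \<mu>) *\<^sub>R a + \<mu> *\<^sub>R (a + p c - s)) \<in> S"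
        by (simp only: scaleR_add_right)
      moreover have "\<mu> *\<^sub>R s + ((1 - \<mu>) *\<^sub>R a + \<mu> *\<^sub>R (a + p c - s)) = a + \<mu> *\<^sub>R p c"
        by (simp add: algebra_simps)
      ultimately show "a + \<mu> *\<^sub>R p c \<in> S" by (simp only:)
    next
      fix c c' assume c: "c \<in> C" "c' \<in> C"
      have "norm (c - c') \<le> (1 + 4 * \<delta> / r) * norm (p c - p c')"
      proof (rule normD)
        show "c - c' \<in> D" unfolding D_def using c by (rule diff_in_direction_space)
        show "p c - p c' \<in> V" using V p(1) by (simp add: subspace_diff)
        show "\<forall>u\<in>V. ((c - c') - (p c - p c')) \<bullet> u = 0"
        proof
          fix u assume u: "u \<in> V"
          have "(c - c') - (p c - p c') = ((c - a) - p c) - ((c' - a) - p c')" by simp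
          then show "((c - c') - (p c - p c')) \<bullet> u = 0" using p(2)[OF u, of c] p(2)[OF u, of c']
            by (simp only: inner_diff_left)
        qed
      qed
      also have "norm (p c - p c') = (1 + \<delta> / r) * dist (a + \<mu> *\<^sub>R p c) (a + \<mu> *\<^sub>R p c')"
      proof -
        have "(a + \<mu> *\<^sub>R p c) - (a + \<mu> *\<^sub>R p c') = \<mu> *\<^sub>R (p c - p c')" by (simp add: algebra_simps)
        then have "dist (a + \<mu> *\<^sub>R p c) (a + \<mu> *\<^sub>R p c') = \<mu> * norm (p c - p c')"
          using \<mu>(1) by (simp only: dist_norm norm_scaleR)
        then show ?thesis using \<mu>(1) unfolding \<mu>(3)[symmetric] by simp
      qed
      finally show "dist c c' \<le> (1 + 4 * \<delta> / r) * (1 + \<delta> / r) * dist (a + \<mu> *\<^sub>R p c) (a + \<mu> *\<^sub>R p c')"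
        by (simp add: dist_norm mult.assoc)
    qed
    also have "\<dots> \<le> ennreal (1 + \<eta>) * hausdorff_outer k S"
      using L by (intro mult_right_mono ennreal_leI) auto
    finally show ?thesis using dims(1) by (simp add: D_def)
  qed
  then show ?thesis using that[of \<delta>] \<delta>(1) unfolding k_def by blast
qed

subsection \<open>Measures of sandwiched sets\<close>

lemma measurable_hausdorff_outer_section:
  fixes V :: "'a::euclidean_space set"
  assumes V: "subspace V" and [measurable]: "A \<in> sets borel"
  shows "(\<lambda>b. hausdorff_outer (dim V) {a \<in> V. a + b \<in> A}) \<in> borel_measurable borel"
proof -
  interpret sigma_finite_measure "hausdorff_on (dim V) V"
    by (rule sigma_finite_hausdorff_on_subspace[OF V])
  show ?thesis unfolding hausdorff_outer_section[OF V assms(2)] by measurable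
qed

text \<open>For each \<open>b\<close> in \<open>R\<close>, convexity puts \<open>conv T + b\<close>
  into \<open>S\<close>, and a shift by at most \<open>\<delta>\<close> keeps the eroded part of it
  in \<open>G\<close>. So every section of \<open>S \<inter> G\<close> over \<open>R\<close> has
  measure at least \<open>\<kappa>\<close>, and integration over \<open>R\<close> gives the
  bound.\<close>

lemma sandwich_lower_bound:
  fixes S T R G :: "'a::euclidean_space set"
  assumes const: "hausdorff_product_constant TYPE('a) k (adim S - k) c"
    and S: "compact S" "convex S" and sub: "T + R \<subseteq> S"
    and R: "R \<subseteq> (direction_space T)\<^sup>\<bottom> \<inter> direction_space S" "R \<noteq> {}" "\<And>y. y \<in> R \<Longrightarrow> norm y \<le> \<delta>"
    and T: "T \<noteq> {}" "dim (direction_space T) = k" and G: "open G"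
    and \<kappa>: "\<kappa> \<le> hausdorff_outer k ((convex hull T) \<inter> {x. cball x \<delta> \<subseteq> G})"
  shows "k \<le> adim S" and "c * (\<kappa> * hausdorff_outer (adim S - k) R) \<le> hausdorff_outer (adim S) (S \<inter> G)"
proof -
  define V where "V = direction_space T"
  define W where "W = direction_space S"
  have V: "subspace V" and W: "subspace W" by (simp_all add: V_def W_def subspace_direction_space)
  obtain t0 where t0: "t0 \<in> T" using T(1) by auto
  obtain r0 where r0: "r0 \<in> R" using R(2) by auto
  have TR: "t + y \<in> S" if "t \<in> T" "y \<in> R" for t y using sub that by (auto intro: set_plus_intro)
  have VW: "V \<subseteq> W" unfolding V_def
  proof (rule direction_space_minimal[OF W])
    fix t t' assume "t \<in> T" "t' \<in> T"
    then have "(t + r0) - (t' + r0) \<in> W"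
      unfolding W_def by (intro diff_in_direction_space TR r0)
    then show "t - t' \<in> W" by simp
  qed
  have "S \<noteq> {}" using TR[OF t0 r0] by auto
  then have dimW: "dim W = adim S" unfolding W_def by (rule dim_direction_space)
  obtain V' where V': "subspace V'" "\<forall>x\<in>V. \<forall>y\<in>V'. x \<bullet> y = 0" "dim V + dim V' = dim W"
    "{a + b | a b. a \<in> V \<and> b \<in> V'} = W" "V\<^sup>\<bottom> \<inter> W \<subseteq> V'"
    by (rule orthogonal_complement_within[OF V W VW])
  have dimV: "dim V = k" using T(2) by (simp add: V_def)
  show km: "k \<le> adim S" using V'(3) dimV dimW by simp
  define m' where "m' = adim S - k"
  have dimV': "dim V' = m'" using V'(3) dimV dimW by (simp add: m'_def)
  have RV': "R \<subseteq> V'" using R(1) V'(5) by (auto simp: V_def W_def)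
  define D where "D = (\<lambda>x. t0 + x) -` (S \<inter> G)"
  have SG: "S \<inter> G \<in> sets borel" using S(1) G by (auto simp: compact_imp_closed)
  have D: "D \<in> sets borel"
    using measurable_sets[of "\<lambda>x. t0 + x" borel borel "S \<inter> G"] SG by (simp add: D_def)
  have chull: "t + y \<in> S" if "t \<in> convex hull T" "y \<in> R" for t y
  proof -
    have "convex {t. t + y \<in> S}"
    proof -
      have "{t. t + y \<in> S} = (\<lambda>s. - y + s) ` S"
        by (force simp: image_def algebra_simps)
      then show ?thesis using S(2) by (simp only: convex_translation)
    qed
    then have "convex hull T \<subseteq> {t. t + y \<in> S}" using TR that by (intro hull_minimal) auto
    then show ?thesis using that by auto
  qed
  let ?f = "\<lambda>b. hausdorff_outer k {a \<in> V. a + b \<in> D}"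
  have f: "?f \<in> borel_measurable borel" using measurable_hausdorff_outer_section[OF V D] by (simp add: dimV)
  have \<kappa>f: "\<kappa> \<le> ?f b" if b: "b \<in> R" for b
  proof -
    let ?C = "(convex hull T) \<inter> {x. cball x \<delta> \<subseteq> G}"
    have "(\<lambda>x. - t0 + x) ` ?C \<subseteq> {a \<in> V. a + b \<in> D}"
    proof
      fix x assume "x \<in> (\<lambda>x. - t0 + x) ` ?C"
      then obtain t where t: "x = - t0 + t" "t \<in> convex hull T" "cball t \<delta> \<subseteq> G" by auto
      have "t - t0 \<in> direction_space (convex hull T)"
        using t(2) t0 by (intro diff_in_direction_space) (auto intro: hull_inc)
      then have "x \<in> V" using t(1) by (simp add: V_def direction_space_convex_hull)
      moreover have "t + b \<in> cball t \<delta>" using R(3)[OF b] by (simp add: dist_norm)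
      then have "t + b \<in> S \<inter> G" using t(3) chull[OF t(2) b] by blast
      then have "x + b \<in> D" by (simp add: D_def t(1) algebra_simps)
      ultimately show "x \<in> {a \<in> V. a + b \<in> D}" by simp
    qed
    then have "hausdorff_outer k ((\<lambda>x. - t0 + x) ` ?C) \<le> ?f b" by (rule hausdorff_outer_mono)
    then show ?thesis using \<kappa> by (simp only: hausdorff_outer_translation)
  qed
  \<comment> \<open>A Borel set containing \<open>R\<close>, so that the integral can be bounded
    although only the outer measure of \<open>R\<close> enters.\<close>
  define P where "P = {b. \<kappa> \<le> ?f b}"
  have P: "P \<in> sets borel"
    using f unfolding P_def by measurable
  have "\<kappa> * hausdorff_outer m' R \<le> \<kappa> * hausdorff_outer m' (V' \<inter> P)"
    using RV' \<kappa>f by (intro mult_left_mono hausdorff_outer_mono) (auto simp: P_def)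
  also have "\<dots> = (\<integral>\<^sup>+b. \<kappa> * indicator P b \<partial>hausdorff_on m' V')"
    using P V'(1) by (simp add: nn_integral_cmult_indicator emeasure_hausdorff_on borel_subspace)
  also have "\<dots> \<le> (\<integral>\<^sup>+b. ?f b \<partial>hausdorff_on m' V')"
    by (intro nn_integral_mono) (auto simp: P_def indicator_def)
  finally have "c * (\<kappa> * hausdorff_outer m' R) \<le> c * (\<integral>\<^sup>+b. ?f b \<partial>hausdorff_on m' V')"
    by (rule mult_left_mono) simp
  also have "\<dots> = hausdorff_outer (k + m') (W \<inter> D)"
    using const V V'(1,2) dimV dimV' D unfolding hausdorff_product_constant_def V'(4)[symmetric] m'_def by simp
  also have "k + m' = adim S" using km by (simp add: m'_def)
  also have "hausdorff_outer (adim S) (W \<inter> D) = hausdorff_outer (adim S) ((\<lambda>x. t0 + x) ` (W \<inter> D))"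
    by (rule hausdorff_outer_translation[symmetric])
  also have "\<dots> \<le> hausdorff_outer (adim S) (S \<inter> G)"
    by (intro hausdorff_outer_mono) (auto simp: D_def)
  finally show "c * (\<kappa> * hausdorff_outer (adim S - k) R) \<le> hausdorff_outer (adim S) (S \<inter> G)"
    by (simp add: m'_def)
qed

text \<open>Uniqueness of orthogonal decompositions shows that a nonempty section of
  \<open>S\<close> lies over a point of \<open>R\<close>, and that it is contained in a translate of
  \<open>T'\<close>.\<close>

lemma sandwich_upper_bound:
  fixes S T R :: "'a::euclidean_space set"
  assumes const: "hausdorff_product_constant TYPE('a) k (adim S - k) c"
    and S: "compact S" "S \<noteq> {}" and sub: "S \<subseteq> T + R"
    and R: "R \<subseteq> (direction_space T)\<^sup>\<bottom> \<inter> direction_space S"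
    and T: "dim (direction_space T) = k"
  defines "T' \<equiv> {t \<in> T. \<exists>y\<in>R. t + y \<in> S}"
  assumes T': "dim (direction_space T') = k" and u: "hausdorff_outer k (convex hull T') \<le> u"
  shows "hausdorff_outer (adim S) S \<le> c * (u * hausdorff_outer (adim S - k) R)"
proof -
  define V where "V = direction_space T"
  define W where "W = direction_space S"
  have V: "subspace V" and W: "subspace W" by (simp_all add: V_def W_def subspace_direction_space)
  have dimV: "dim V = k" using T by (simp add: V_def)
  have dec: "\<exists>t y. t \<in> T' \<and> y \<in> R \<and> s = t + y" if "s \<in> S" for s
    using sub that unfolding T'_def set_plus_def by blast
  \<comment> \<open>Pruning preserves the dimension, hence the directions. Only for points of
    \<open>T'\<close> are the differences known to be directions of \<open>S\<close>, so this is how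
    \<open>V \<subseteq> W\<close> is obtained.\<close>
  have "direction_space T' = V"
  proof (rule subspace_dim_equal[OF subspace_direction_space V])
    show "direction_space T' \<subseteq> V" unfolding V_def T'_def by (intro direction_space_mono) auto
    show "dim V \<le> dim (direction_space T')" by (simp add: dimV T')
  qed
  have VW: "V \<subseteq> W" unfolding \<open>direction_space T' = V\<close>[symmetric]
  proof (rule direction_space_minimal[OF W])
    fix t t' assume "t \<in> T'" "t' \<in> T'"
    then obtain y y' where y: "y \<in> R" "t + y \<in> S" "y' \<in> R" "t' + y' \<in> S" by (auto simp: T'_def)
    then have "(t + y) - (t' + y') \<in> W" "y \<in> W" "y' \<in> W"
      using R by (auto simp: W_def intro: diff_in_direction_space)
    then have "((t + y) - (t' + y')) - (y - y') \<in> W" using W by (meson subspace_diff)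
    then show "t - t' \<in> W" by simp
  qed
  have dimW: "dim W = adim S" unfolding W_def by (rule dim_direction_space[OF S(2)])
  obtain V' where V': "subspace V'" "\<forall>x\<in>V. \<forall>y\<in>V'. x \<bullet> y = 0" "dim V + dim V' = dim W"
    "{a + b | a b. a \<in> V \<and> b \<in> V'} = W" "V\<^sup>\<bottom> \<inter> W \<subseteq> V'"
    by (rule orthogonal_complement_within[OF V W VW])
  define m' where "m' = adim S - k"
  have dimV': "dim V' = m'" "k + m' = adim S" using V'(3) dimV dimW by (simp_all add: m'_def)
  have RV': "R \<subseteq> V'" using R(1) V'(5) by (auto simp: V_def W_def)
  obtain t1 where t1: "t1 \<in> T'" using dec S(2) by blast
  define D where "D = (\<lambda>x. t1 + x) -` S"
  have Sb: "S \<in> sets borel" using S(1) by (simp add: compact_imp_closed)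
  have D: "D \<in> sets borel"
    using measurable_sets[of "\<lambda>x. t1 + x" borel borel S] Sb by (simp add: D_def)
  have T'V: "t - t1 \<in> V" if "t \<in> T'" for t
    unfolding \<open>direction_space T' = V\<close>[symmetric] using that t1 by (rule diff_in_direction_space)
  have "S \<subseteq> (\<lambda>x. t1 + x) ` (W \<inter> D)"
  proof
    fix s assume s: "s \<in> S"
    then obtain t y where t: "t \<in> T'" "y \<in> R" "s = t + y" using dec by blast
    then have "(t - t1) + y \<in> W" using T'V VW R W by (intro subspace_add) (auto simp: W_def)
    then show "s \<in> (\<lambda>x. t1 + x) ` (W \<inter> D)"
      using s t(3) by (intro image_eqI[of _ _ "s - t1"]) (auto simp: D_def algebra_simps)
  qed
  then have "hausdorff_outer (adim S) S \<le> hausdorff_outer (adim S) ((\<lambda>x. t1 + x) ` (W \<inter> D))"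
    by (rule hausdorff_outer_mono)
  also have "\<dots> = hausdorff_outer (k + m') (W \<inter> D)" by (simp only: hausdorff_outer_translation dimV')
  also have "\<dots> = c * (\<integral>\<^sup>+b. hausdorff_outer k {a \<in> V. a + b \<in> D} \<partial>hausdorff_on m' V')"
    using const V V'(1,2) dimV dimV' D unfolding hausdorff_product_constant_def V'(4)[symmetric] m'_def by simp
  also have "\<dots> \<le> c * (u * hausdorff_outer m' R)"
  proof (rule mult_left_mono)
    \<comment> \<open>The base points \<open>b\<close> with a nonempty section are those of
      \<open>V' \<inter> P\<close>. This set is Borel and contained in \<open>R\<close>.\<close>
    define P where "P = (\<Union>x\<in>V. \<Union>y\<in>(\<lambda>s. - t1 + s) ` S. {x + y})"
    have "closed P" unfolding P_def
      using V S(1) by (intro closed_compact_sums closed_subspace compact_translation)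
    then have P: "P \<in> sets borel" by simp
    have uniq: "b \<in> R \<and> t1 + a \<in> T'" if "a \<in> V" "b \<in> V'" "t1 + (a + b) \<in> S" for a b
    proof -
      obtain t y where t: "t \<in> T'" "y \<in> R" "t1 + (a + b) = t + y" using dec[OF \<open>t1 + (a + b) \<in> S\<close>] by blast
      have "a = t - t1 \<and> b = y"
        using V V'(1,2) that t RV' T'V
        by (intro orthogonal_sum_unique[of V V']) (auto simp: algebra_simps)
      then show ?thesis using t by simp
    qed
    have "(\<integral>\<^sup>+b. hausdorff_outer k {a \<in> V. a + b \<in> D} \<partial>hausdorff_on m' V') \<le> (\<integral>\<^sup>+b. u * indicator P b \<partial>hausdorff_on m' V')"
    proof (rule nn_integral_mono_AE)
      show "AE b in hausdorff_on m' V'. hausdorff_outer k {a \<in> V. a + b \<in> D} \<le> u * indicator P b"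
        using AE_hausdorff_on[OF borel_subspace[OF V'(1)]]
      proof eventually_elim
        case (elim b)
        show ?case
        proof (cases "{a \<in> V. a + b \<in> D} = {}")
          case False
          then obtain a where a: "a \<in> V" "t1 + (a + b) \<in> S" by (auto simp: D_def)
          have "b = - a + (- t1 + (t1 + (a + b)))" by simp
          then have "b \<in> P" using a V unfolding P_def by (blast intro: subspace_neg)
          moreover have "hausdorff_outer k {a \<in> V. a + b \<in> D} \<le> hausdorff_outer k ((\<lambda>x. - t1 + x) ` (convex hull T'))"
          proof (intro hausdorff_outer_mono subsetI)
            fix a assume "a \<in> {a \<in> V. a + b \<in> D}"
            then have "t1 + a \<in> T'" using uniq[OF _ elim] by (auto simp: D_def)
            then show "a \<in> (\<lambda>x. - t1 + x) ` (convex hull T')"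
              by (intro image_eqI[of _ _ "t1 + a"]) (auto intro: hull_inc)
          qed
          ultimately show ?thesis using u unfolding hausdorff_outer_translation by simp
        next
          case True
          show ?thesis unfolding True by simp
        qed
      qed
    qed
    also have "\<dots> = u * hausdorff_outer m' (V' \<inter> P)"
      using P V'(1) by (simp add: nn_integral_cmult_indicator emeasure_hausdorff_on borel_subspace)
    also have "\<dots> \<le> u * hausdorff_outer m' R"
    proof (intro mult_left_mono hausdorff_outer_mono subsetI)
      fix b assume b: "b \<in> V' \<inter> P"
      then obtain x s where xs: "x \<in> V" "s \<in> S" "b = x + (- t1 + s)" by (auto simp: P_def)
      then have "t1 + (- x + b) \<in> S" by simp
      then show "b \<in> R" using uniq[of "- x" b] b xs V by (auto intro: subspace_neg)
    qed simp
    finally show "(\<integral>\<^sup>+b. hausdorff_outer k {a \<in> V. a + b \<in> D} \<partial>hausdorff_on m' V') \<le> u * hausdorff_outer m' R" .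
  qed simp
  finally show ?thesis by (simp add: m'_def)
qed

subsection \<open>Rectangular continuity\<close>

text \<open>The pointwise condition is applied to a finite \<open>e / 2\<close>-net of the compact
  limit.\<close>

lemma painleve_kuratowski_inner_uniform:
  assumes pk: "painleve_kuratowski F T L" and L: "compact L" and e: "e > 0"
  shows "\<forall>\<^sub>F x in F. \<forall>s\<in>L. \<exists>z\<in>T x. dist z s < e"
proof -
  obtain K where K: "K \<subseteq> L" "finite K" "L \<subseteq> (\<Union>y\<in>K. ball y (e / 2))"
    using compactE_image[OF L, of L "\<lambda>y. ball y (e / 2)"] e by force
  have "\<forall>\<^sub>F x in F. \<exists>z\<in>T x. dist z y < e / 2" if "y \<in> K" for y
  proof -
    have "y \<in> inner_limit F T" using pk K(1) that by (auto simp: painleve_kuratowski_def)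
    then show ?thesis using e unfolding inner_limit_def by (auto dest: spec[of _ "e / 2"])
  qed
  then have "\<forall>\<^sub>F x in F. \<forall>y\<in>K. \<exists>z\<in>T x. dist z y < e / 2"
    using K(2) by (simp add: eventually_ball_finite)
  then show ?thesis
  proof eventually_elim
    case (elim x)
    show ?case
    proof
      fix s assume "s \<in> L"
      then obtain y where y: "y \<in> K" "dist y s < e / 2" using K(3) by auto
      then obtain z where "z \<in> T x" "dist z y < e / 2" using elim by blast
      then show "\<exists>z\<in>T x. dist z s < e"
        using y dist_triangle[of z s y] by (intro bexI[of _ z]) auto
    qed
  qed
qed

text \<open>Points of \<open>B\<close> at distance at least \<open>e\<close> from \<open>L\<close>
  form a compact set, and each has a neighbourhood eventually avoided by \<open>T x\<close>. The
  restriction to a bounded region is essential, since points may escape to infinity.\<close>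

lemma painleve_kuratowski_outer_uniform:
  fixes T :: "'a \<Rightarrow> 'b::heine_borel set"
  assumes pk: "painleve_kuratowski F T L" and B: "compact B" and e: "e > 0"
  shows "\<forall>\<^sub>F x in F. \<forall>z\<in>T x. z \<in> B \<longrightarrow> (\<exists>s\<in>L. dist z s < e)"
proof -
  let ?K = "B - (\<Union>s\<in>L. ball s e)"
  have "compact ?K" using B by (intro compact_diff) auto
  have "\<exists>d>0. \<forall>\<^sub>F x in F. \<forall>z\<in>T x. \<not> dist z y < d" if "y \<in> ?K" for y
  proof -
    have "y \<notin> L" using that e by auto
    then have "y \<notin> outer_limit F T" using pk by (simp add: painleve_kuratowski_def)
    then show ?thesis by (auto simp: outer_limit_def not_frequently)
  qed
  then have "\<forall>y\<in>?K. \<exists>d>0. \<forall>\<^sub>F x in F. \<forall>z\<in>T x. \<not> dist z y < d" by blast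
  from bchoice[OF this] obtain d where
    d: "\<And>y. y \<in> ?K \<Longrightarrow> d y > 0" "\<And>y. y \<in> ?K \<Longrightarrow> \<forall>\<^sub>F x in F. \<forall>z\<in>T x. \<not> dist z y < d y"
    by blast
  obtain C where C: "C \<subseteq> ?K" "finite C" "?K \<subseteq> (\<Union>y\<in>C. ball y (d y))"
  proof (rule compactE_image[OF \<open>compact ?K\<close>, of ?K "\<lambda>y. ball y (d y)"])
    show "?K \<subseteq> (\<Union>y\<in>?K. ball y (d y))" using d(1) centre_in_ball by blast
  qed (simp_all only: open_ball)
  have "\<forall>\<^sub>F x in F. \<forall>y\<in>C. \<forall>z\<in>T x. \<not> dist z y < d y"
    using C(1,2) d(2) by (intro eventually_ball_finite) auto
  then show ?thesis
  proof eventually_elim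
    case (elim x)
    show ?case
    proof (intro ballI impI)
      fix z assume z: "z \<in> T x" "z \<in> B"
      show "\<exists>s\<in>L. dist z s < e"
      proof (rule ccontr)
        assume "\<not> ?thesis"
        then have "z \<in> ?K" using z by (auto simp: dist_commute)
        then obtain y where "y \<in> C" "dist y z < d y" using C(3) by auto
        then show False using elim z(1) by (auto simp: dist_commute)
      qed
    qed
  qed
qed

text \<open>The \<open>e\<close>-neighbourhood of a convex set is convex.\<close>

lemma convex_hull_close:
  fixes S T :: "'a::real_normed_vector set"
  assumes S: "convex S" and T: "\<And>t. t \<in> T \<Longrightarrow> \<exists>s\<in>S. dist t s < e" and x: "x \<in> convex hull T"
  shows "\<exists>s\<in>S. dist x s < e"
proof -
  let ?N = "\<Union>s\<in>S. \<Union>y\<in>ball 0 e. {s + y}"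
  have "convex ?N" by (rule convex_sums[OF S convex_ball])
  moreover have N: "y \<in> ?N \<longleftrightarrow> (\<exists>s\<in>S. dist y s < e)" for y
  proof
    assume "\<exists>s\<in>S. dist y s < e"
    then obtain s where "s \<in> S" "y - s \<in> ball 0 e" by (auto simp: dist_norm norm_minus_commute)
    moreover have "y = s + (y - s)" by simp
    ultimately show "y \<in> ?N" by blast
  next
    assume "y \<in> ?N"
    then obtain s z where "s \<in> S" "norm z < e" "y = s + z" by auto
    then show "\<exists>s\<in>S. dist y s < e" by (intro bexI[of _ s]) (auto simp: dist_norm)
  qed
  ultimately have "convex hull T \<subseteq> ?N" using T by (intro hull_minimal) auto
  then show ?thesis using x N by blast
qed

lemma hausdorff_close_mono: "hausdorff_close \<delta> A B \<Longrightarrow> \<delta> \<le> \<delta>' \<Longrightarrow> hausdorff_close \<delta>' A B"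
  unfolding hausdorff_close_def by (meson order_less_le_trans)

text \<open>All estimates at a single point \<open>x\<close>, with the limits already turned into
  \<open>e\<close>-closeness within a fixed ball. What matters is that both conclusions hold with
  the same \<open>c\<close>.\<close>

lemma sandwich_ratio_bound:
  fixes S T0 T1 R0 R1 S0 G :: "'a::euclidean_space set"
  defines "k \<equiv> adim S0" and "m \<equiv> adim S"
  assumes S: "compact S" "convex S" "S \<noteq> {}" "S \<subseteq> cball 0 B" "B \<ge> 0"
    and S0: "convex S0" "S0 \<noteq> {}" "S0 \<subseteq> cball 0 B" and G: "open G"
    and sub: "T0 + R0 \<subseteq> S" "S \<subseteq> T1 + R1"
    and R0: "R0 \<subseteq> (direction_space T0)\<^sup>\<bottom> \<inter> direction_space S"
    and R1: "R1 \<subseteq> (direction_space T1)\<^sup>\<bottom> \<inter> direction_space S"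
    and aff: "aff_dim T0 = aff_dim S0" "aff_dim T1 = aff_dim S0"
    and e: "0 < e" "4 * e \<le> 1" "4 * e \<le> \<delta>" "4 * e \<le> \<delta>'"
    and inner: "\<And>s. s \<in> S0 \<Longrightarrow> \<exists>z\<in>T0. dist z s < e" "\<And>s. s \<in> S0 \<Longrightarrow> \<exists>z\<in>T1. dist z s < e" "\<exists>y\<in>R0. norm y < e"
    and outer: "\<And>z. z \<in> T0 \<Longrightarrow> norm z \<le> 3 * B + 2 \<Longrightarrow> \<exists>s\<in>S0. dist z s < e"
      "\<And>z. z \<in> T1 \<Longrightarrow> norm z \<le> 3 * B + 2 \<Longrightarrow> \<exists>s\<in>S0. dist z s < e"
      "\<And>y. y \<in> R0 \<Longrightarrow> norm y \<le> 3 * B + 2 \<Longrightarrow> norm y < e"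
      "\<And>y. y \<in> R1 \<Longrightarrow> norm y \<le> 3 * B + 2 \<Longrightarrow> norm y < e"
    and lower: "\<And>C. convex C \<Longrightarrow> hausdorff_close \<delta> C S0 \<Longrightarrow> \<kappa> \<le> hausdorff_outer k (C \<inter> {x. cball x \<delta> \<subseteq> G})"
    and upper: "\<And>C. convex C \<Longrightarrow> hausdorff_close \<delta>' C S0 \<Longrightarrow> dim (direction_space C) \<le> k \<Longrightarrow>
      dim (direction_space C) = k \<and> hausdorff_outer k C \<le> u"
  obtains c where "c * (\<kappa> * hausdorff_outer (m - k) R0) \<le> hausdorff_outer m (S \<inter> G)"
    "hausdorff_outer m S \<le> c * (u * hausdorff_outer (m - k) R1)"
proof -
  obtain c where c: "hausdorff_product_constant TYPE('a) k (adim S - k) c" using hausdorff_product by blast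
  obtain s0 where s0: "s0 \<in> S0" using S0(2) by auto
  obtain t0 where t0: "t0 \<in> T0" "dist t0 s0 < e" using inner(1)[OF s0] by blast
  obtain t1 where t1: "t1 \<in> T1" "dist t1 s0 < e" using inner(2)[OF s0] by blast
  obtain r0 where r0: "r0 \<in> R0" "norm r0 < e" using inner(3) by blast
  have ns0: "norm s0 \<le> B" using s0 S0(3) by auto
  have nt: "norm t0 \<le> B + 1" "norm t1 \<le> B + 1"
    using norm_triangle_sub[of t0 s0] norm_triangle_sub[of t1 s0] t0(2) t1(2) e ns0 by (auto simp: dist_norm)
  have TR: "t + y \<in> S" if "t \<in> T0" "y \<in> R0" for t y using sub(1) that by (auto intro: set_plus_intro)
  have nS: "norm s \<le> B" if "s \<in> S" for s using that S(4) by auto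
  have nR0: "norm y < e" if "y \<in> R0" for y
  proof (rule outer(3)[OF that])
    have "norm y \<le> norm (t0 + y) + norm t0" using norm_triangle_ineq4[of "t0 + y" t0] by simp
    then show "norm y \<le> 3 * B + 2" using nS[OF TR[OF t0(1) that]] nt S(5) by simp
  qed
  have T0S0: "\<exists>s\<in>S0. dist t s < e" if "t \<in> T0" for t
  proof (rule outer(1)[OF that])
    have "norm t \<le> norm (t + r0) + norm r0" using norm_triangle_ineq4[of "t + r0" r0] by simp
    then show "norm t \<le> 3 * B + 2" using nS[OF TR[OF that r0(1)]] r0(2) e S(5) by simp
  qed
  let ?C0 = "convex hull T0"
  have "hausdorff_close e ?C0 S0"
    unfolding hausdorff_close_def
  proof (intro conjI ballI)
    fix x assume "x \<in> ?C0"
    then show "\<exists>b\<in>S0. dist x b < e" using convex_hull_close[OF S0(1) T0S0] by blast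
  next
    fix s assume "s \<in> S0"
    then obtain z where "z \<in> T0" "dist z s < e" using inner(1) by blast
    then show "\<exists>a\<in>?C0. dist a s < e" by (meson hull_inc)
  qed
  then have close0: "hausdorff_close \<delta> ?C0 S0" by (rule hausdorff_close_mono) (use e in simp)
  have T0ne: "T0 \<noteq> {}" and T1ne: "T1 \<noteq> {}" using t0 t1 by auto
  have dimT: "dim (direction_space T0) = k" "dim (direction_space T1) = k"
    using aff dim_direction_space[OF T0ne] dim_direction_space[OF T1ne] by (auto simp: adim_def k_def)
  have low: "c * (\<kappa> * hausdorff_outer (m - k) R0) \<le> hausdorff_outer m (S \<inter> G)"
    unfolding m_def
  proof (rule sandwich_lower_bound(2)[OF c S(1,2) sub(1) R0 _ _ T0ne dimT(1) G])
    show "R0 \<noteq> {}" using r0 by auto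
    show "norm y \<le> \<delta>" if "y \<in> R0" for y using nR0[OF that] e by simp
    show "\<kappa> \<le> hausdorff_outer k (?C0 \<inter> {x. cball x \<delta> \<subseteq> G})" by (intro lower close0) simp
  qed
  define T' where "T' = {t \<in> T1. \<exists>y\<in>R1. t + y \<in> S}"
  \<comment> \<open>\<open>T1\<close> and \<open>R1\<close> may have far away points. Here
    \<open>t - t1\<close> is orthogonal to \<open>y\<close> and their sum is bounded because
    \<open>t + y\<close> lies in \<open>S\<close>; by Pythagoras both are at most
    \<open>2 * B + 1\<close>. Adding \<open>norm t1 \<le> B + 1\<close> gives the radius
    \<open>3 * B + 2\<close> used in \<open>outer\<close>.\<close>
  have T'R: "norm y < e \<and> (\<exists>s\<in>S0. dist t s < e)" if "t \<in> T1" "y \<in> R1" "t + y \<in> S" for t y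
  proof -
    have "t - t1 \<in> direction_space T1" using that(1) t1(1) by (rule diff_in_direction_space)
    then have "(t - t1) \<bullet> y = 0" using R1 that(2) by (auto simp: orthogonal_comp_def orthogonal_def)
    note o = norm_le_orthogonal_add[OF this]
    have "norm ((t - t1) + y) \<le> norm (t + y) + norm t1"
      using norm_triangle_ineq4[of "t + y" t1] by (simp add: algebra_simps)
    then have "norm ((t - t1) + y) \<le> 2 * B + 1" using nS[OF that(3)] nt by simp
    then have "norm (t - t1) \<le> 2 * B + 1" "norm y \<le> 2 * B + 1" using o by linarith+
    moreover have "norm t \<le> norm (t - t1) + norm t1" using norm_triangle_ineq[of "t - t1" t1] by simp
    ultimately have "norm t \<le> 3 * B + 2" "norm y \<le> 3 * B + 2" using nt S(5) by linarith+
    then show ?thesis using outer(2)[OF that(1)] outer(4)[OF that(2)] by blast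
  qed
  let ?C1 = "convex hull T'"
  \<comment> \<open>Pruning must leave points near all of \<open>S0\<close>. A point of
    \<open>T0\<close> near \<open>s\<close> is moved into \<open>S\<close> by \<open>r0\<close> and
    decomposed there as \<open>t + y\<close>, so that \<open>t\<close> is in \<open>T'\<close>; the
    three errors are each below \<open>e\<close>.\<close>
  have "hausdorff_close (4 * e) ?C1 S0"
    unfolding hausdorff_close_def
  proof (intro conjI ballI)
    fix x assume x: "x \<in> ?C1"
    have "\<exists>s\<in>S0. dist t s < e" if "t \<in> T'" for t using that T'R by (auto simp: T'_def)
    from convex_hull_close[OF S0(1) this x]
    show "\<exists>b\<in>S0. dist x b < 4 * e" using e(1) by force
  next
    fix s assume "s \<in> S0"
    then obtain z where z: "z \<in> T0" "dist z s < e" using inner(1) by blast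
    have "z + r0 \<in> S" by (rule TR[OF z(1) r0(1)])
    then obtain t y where t: "t \<in> T1" "y \<in> R1" "z + r0 = t + y" using sub(2) by (auto simp: set_plus_def)
    then have tS: "t + y \<in> S" using \<open>z + r0 \<in> S\<close> by simp
    then have "t \<in> T'" using t by (auto simp: T'_def)
    have "t - s = (z - s) + r0 - y" using t(3) by (simp add: algebra_simps)
    then have "dist t s \<le> dist z s + norm r0 + norm y"
      unfolding dist_norm by (metis norm_triangle_ineq4 norm_triangle_ineq add_right_mono order_trans)
    then have "dist t s < 4 * e" using z(2) r0(2) T'R[OF t(1,2) tS] e(1) by linarith
    then show "\<exists>a\<in>?C1. dist a s < 4 * e" using \<open>t \<in> T'\<close> by (meson hull_inc)
  qed
  then have close1: "hausdorff_close \<delta>' ?C1 S0" by (rule hausdorff_close_mono) (use e in simp)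
  have "dim (direction_space ?C1) \<le> k"
    unfolding direction_space_convex_hull dimT(2)[symmetric]
    by (intro dim_subset direction_space_mono) (auto simp: T'_def)
  from upper[OF convex_convex_hull close1 this]
  have up: "dim (direction_space T') = k" "hausdorff_outer k ?C1 \<le> u"
    by (simp_all add: direction_space_convex_hull)
  have "hausdorff_outer m S \<le> c * (u * hausdorff_outer (m - k) R1)"
    unfolding m_def
    by (rule sandwich_upper_bound[OF c S(1,3) sub(2) R1 dimT(2)]) (use up in \<open>simp_all add: T'_def\<close>)
  with low show ?thesis by (rule that)
qed

lemma eventually_mem_nhds_in: "\<forall>\<^sub>F x in nhds_in X x0. x \<in> X"
  by (simp add: nhds_in_def eventually_inf_principal)

lemma rectangularly_continuous_liminf:
  fixes X :: "'a::metric_space set" and S :: "'a \<Rightarrow> 'b::euclidean_space set"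
  assumes S: "\<And>x. x \<in> X \<Longrightarrow> compact (S x)" "\<And>x. x \<in> X \<Longrightarrow> convex (S x)" "\<And>x. x \<in> X \<Longrightarrow> S x \<noteq> {}"
    "\<And>x. x \<in> X \<Longrightarrow> S x \<subseteq> cball 0 B" and x0: "x0 \<in> X"
    and rc: "rectangularly_continuous_at X S x0" and G: "open G"
    and t: "ennreal t * hausdorff_outer (adim (S x0)) (S x0) < hausdorff_outer (adim (S x0)) (S x0 \<inter> G)" "t \<ge> 0"
  shows "\<forall>\<^sub>F x in nhds_in X x0. ennreal t * hausdorff_outer (adim (S x)) (S x) \<le> hausdorff_outer (adim (S x)) (S x \<inter> G)"
proof -
  define k where "k = adim (S x0)"
  define h where "h = hausdorff_outer k (S x0)"
  have h: "h < top" unfolding h_def k_def by (intro hausdorff_outer_convex_finite S x0)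
  have B: "B \<ge> 0" using S(3,4)[OF x0] by (metis cball_eq_empty not_le subset_empty)
  from t(1) obtain \<kappa> where \<kappa>: "ennreal t * h < \<kappa>" "\<kappa> < hausdorff_outer k (S x0 \<inter> G)"
    unfolding h_def k_def using dense by blast
  have \<kappa>top: "\<kappa> < top" using \<kappa>(2) by (rule less_le_trans) simp
  define h' where "h' = enn2real h"
  have h': "h = ennreal h'" "h' \<ge> 0" using h by (simp_all add: h'_def)
  define \<kappa>' where "\<kappa>' = enn2real \<kappa>"
  have \<kappa>': "\<kappa> = ennreal \<kappa>'" "\<kappa>' \<ge> 0" using \<kappa>top by (simp_all add: \<kappa>'_def)
  have "t * h' < \<kappa>'" using \<kappa>(1) t(2) h'(2) unfolding h'(1) \<kappa>'(1)
    by (simp add: ennreal_mult[symmetric] ennreal_less_iff)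
  \<comment> \<open>The gap between \<open>t * h'\<close> and \<open>\<kappa>'\<close> pays for two
    factors \<open>1 + \<eta>\<close>: one for the measure of the outer convex hull, one for the
    ratio of the measures of \<open>R1 x\<close> and \<open>R0 x\<close>.\<close>
  moreover have "((\<lambda>d. t * (1 + d) * h' * (1 + d)) \<longlongrightarrow> t * (1 + 0) * h' * (1 + 0)) (at_right 0)"
    by (intro tendsto_intros)
  ultimately obtain \<eta> where \<eta>: "0 < \<eta>" "t * (1 + \<eta>) * h' * (1 + \<eta>) < \<kappa>'"
    using eventually_at_right_less_limit[of _ "t * h'" \<kappa>' 1] by auto
  obtain \<delta> where \<delta>: "\<delta> > 0" "\<And>C. convex C \<Longrightarrow> hausdorff_close \<delta> C (S x0) \<Longrightarrow>
      \<kappa> \<le> hausdorff_outer k (C \<inter> {x. cball x \<delta> \<subseteq> G})"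
    using hausdorff_lower_semicontinuous[OF S(1-3)[OF x0] G \<kappa>(2)[unfolded k_def]] unfolding k_def by metis
  obtain \<delta>' where \<delta>': "\<delta>' > 0" "\<And>C. convex C \<Longrightarrow> hausdorff_close \<delta>' C (S x0) \<Longrightarrow> dim (direction_space C) \<le> k \<Longrightarrow>
      dim (direction_space C) = k \<and> hausdorff_outer k C \<le> ennreal (1 + \<eta>) * h"
    using hausdorff_upper_semicontinuous[OF S(1-3)[OF x0] \<eta>(1)] unfolding k_def h_def by metis
  define e where "e = min 1 (min \<delta> \<delta>') / 4"
  have e: "0 < e" "4 * e \<le> 1" "4 * e \<le> \<delta>" "4 * e \<le> \<delta>'" using \<delta>(1) \<delta>'(1) by (auto simp: e_def)
  let ?F = "nhds_in X x0"
  from rc obtain T0 T1 R0 R1 :: "'a \<Rightarrow> 'b set" where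
    sub: "\<forall>\<^sub>F x in ?F. T0 x + R0 x \<subseteq> S x \<and> S x \<subseteq> T1 x + R1 x"
    and R0: "\<And>x. x \<in> X \<Longrightarrow> R0 x \<subseteq> (direction_space (T0 x))\<^sup>\<bottom> \<inter> direction_space (S x)"
    and R1: "\<And>x. x \<in> X \<Longrightarrow> R1 x \<subseteq> (direction_space (T1 x))\<^sup>\<bottom> \<inter> direction_space (S x)"
    and aff: "\<And>x. x \<in> X \<Longrightarrow> aff_dim (T0 x) = aff_dim (S x0)" "\<And>x. x \<in> X \<Longrightarrow> aff_dim (T1 x) = aff_dim (S x0)"
    and Rm: "\<And>x. x \<in> X \<Longrightarrow> R0 x \<in> sets (hausdorff_measure (adim (S x) - k))"
       "\<And>x. x \<in> X \<Longrightarrow> R1 x \<in> sets (hausdorff_measure (adim (S x) - k))"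
    and pk: "painleve_kuratowski ?F R0 {0}" "painleve_kuratowski ?F R1 {0}"
      "painleve_kuratowski ?F T0 (S x0)" "painleve_kuratowski ?F T1 (S x0)"
    and ratio: "((\<lambda>x. emeasure (hausdorff_measure (adim (S x) - k)) (R0 x) /
               emeasure (hausdorff_measure (adim (S x) - k)) (R1 x)) \<longlongrightarrow> 1) ?F"
    unfolding rectangularly_continuous_at_def k_def by (auto; blast)
  have "ennreal (1 / (1 + \<eta>)) < 1" using \<eta>(1) by simp
  from order_tendstoD(1)[OF ratio this]
  have rat: "\<forall>\<^sub>F x in ?F. ennreal (1 / (1 + \<eta>)) < emeasure (hausdorff_measure (adim (S x) - k)) (R0 x) /
               emeasure (hausdorff_measure (adim (S x) - k)) (R1 x)" .
  note inner = painleve_kuratowski_inner_uniform[OF pk(3) S(1)[OF x0] e(1)]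
    painleve_kuratowski_inner_uniform[OF pk(4) S(1)[OF x0] e(1)]
    painleve_kuratowski_inner_uniform[OF pk(1) _ e(1)]
  have cB: "compact (cball (0::'b) (3 * B + 2))" by simp
  note outer = painleve_kuratowski_outer_uniform[OF pk(3) cB e(1)] painleve_kuratowski_outer_uniform[OF pk(4) cB e(1)]
    painleve_kuratowski_outer_uniform[OF pk(1) cB e(1)] painleve_kuratowski_outer_uniform[OF pk(2) cB e(1)]
  show ?thesis
    using eventually_mem_nhds_in sub rat inner(1,2) inner(3)[OF compact_sing] outer
  proof eventually_elim
    case (elim x)
    let ?m = "adim (S x)"
    obtain c where c: "c * (\<kappa> * hausdorff_outer (?m - k) (R0 x)) \<le> hausdorff_outer ?m (S x \<inter> G)"
      "hausdorff_outer ?m (S x) \<le> c * ((ennreal (1 + \<eta>) * h) * hausdorff_outer (?m - k) (R1 x))"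
      unfolding k_def
    proof (rule sandwich_ratio_bound[of "S x" B "S x0" G "T0 x" "R0 x" "T1 x" "R1 x" e \<delta> \<delta>' \<kappa> "ennreal (1 + \<eta>) * h"])
      show "\<And>z. z \<in> T0 x \<Longrightarrow> norm z \<le> 3 * B + 2 \<Longrightarrow> \<exists>s\<in>S x0. dist z s < e"
        "\<And>z. z \<in> T1 x \<Longrightarrow> norm z \<le> 3 * B + 2 \<Longrightarrow> \<exists>s\<in>S x0. dist z s < e"
        "\<And>y. y \<in> R0 x \<Longrightarrow> norm y \<le> 3 * B + 2 \<Longrightarrow> norm y < e"
        "\<And>y. y \<in> R1 x \<Longrightarrow> norm y \<le> 3 * B + 2 \<Longrightarrow> norm y < e"
        using elim(7-10) by auto
      show "\<And>s. s \<in> S x0 \<Longrightarrow> \<exists>z\<in>T0 x. dist z s < e" "\<And>s. s \<in> S x0 \<Longrightarrow> \<exists>z\<in>T1 x. dist z s < e"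
        "\<exists>y\<in>R0 x. norm y < e"
        using elim(4-6) by auto
    qed (use elim(1,2) S[OF elim(1)] S[OF x0] B G R0[OF elim(1)] R1[OF elim(1)] aff[OF elim(1)] e \<delta>(2) \<delta>'(2)
          in \<open>auto simp: k_def\<close>)
    let ?r0 = "hausdorff_outer (?m - k) (R0 x)" and ?r1 = "hausdorff_outer (?m - k) (R1 x)"
    have r: "ennreal (1 / (1 + \<eta>)) < ?r0 / ?r1"
      using elim(3) Rm[OF elim(1)] by (simp add: emeasure_hausdorff_measure)
    have "?r1 \<le> ennreal (1 + \<eta>) * ?r0"
    \<comment> \<open>If \<open>?r1\<close> is 0 the claim is trivial; if it were infinite, the
      quotient would be 0, against \<open>r\<close>.\<close>
    proof (cases "?r1 = 0 \<or> ?r1 = top")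
      case False
      then have "ennreal (1 / (1 + \<eta>)) * ?r1 \<le> ?r0 / ?r1 * ?r1" using r by (intro mult_right_mono) auto
      also have "\<dots> = ?r0" using False mult_divide_eq_ennreal[of ?r1 ?r0] by (metis ennreal_times_divide mult.commute)
      finally have "ennreal (1 + \<eta>) * (ennreal (1 / (1 + \<eta>)) * ?r1) \<le> ennreal (1 + \<eta>) * ?r0"
        by (rule mult_left_mono) simp
      moreover have "ennreal (1 + \<eta>) * ennreal (1 / (1 + \<eta>)) = 1"
        using \<eta>(1) by (simp add: ennreal_mult'[symmetric] del: ennreal_plus)
      ultimately show ?thesis by (simp add: mult.assoc[symmetric])
    qed (use r in auto)
    then have "ennreal t * hausdorff_outer ?m (S x) \<le> ennreal t * (c * ((ennreal (1 + \<eta>) * h) * (ennreal (1 + \<eta>) * ?r0)))"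
      using c(2) by (meson mult_left_mono order_trans zero_le)
    also have "\<dots> = c * ((ennreal t * ennreal (1 + \<eta>) * h * ennreal (1 + \<eta>)) * ?r0)"
      by (simp add: mult_ac)
    also have "ennreal t * ennreal (1 + \<eta>) * h * ennreal (1 + \<eta>) = ennreal (t * (1 + \<eta>) * h' * (1 + \<eta>))"
      using t(2) \<eta>(1) h'(2) unfolding h'(1) by (simp add: ennreal_mult[symmetric] del: ennreal_plus)
    also have "c * (\<dots> * ?r0) \<le> c * (\<kappa> * ?r0)"
      unfolding \<kappa>'(1) using \<eta>(2) by (intro mult_left_mono mult_right_mono ennreal_leI) auto
    also have "\<dots> \<le> hausdorff_outer ?m (S x \<inter> G)" by (rule c(1))
    finally show ?case .
  qed
qed

subsection \<open>Weak convergence\<close>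

text \<open>The sum counts the positive integers strictly below \<open>z\<close>, which number
  \<open>ceiling z - 1\<close>, or 0 if \<open>z = 0\<close>.\<close>

lemma step_function_bounds:
  fixes z :: real and N :: nat
  assumes z: "0 \<le> z" "z \<le> real N"
  shows "(\<Sum>i\<in>{1..N}. of_bool (real i < z)) \<le> z" "z \<le> 1 + (\<Sum>i\<in>{1..N}. of_bool (real i < z))"
proof -
  define n where "n = nat (\<lceil>z\<rceil> - 1)"
  have n: "real i < z \<longleftrightarrow> i \<le> n" if "i \<ge> 1" for i :: nat
    using that unfolding n_def by linarith
  have nN: "n \<le> N" using z unfolding n_def by linarith
  have "(\<Sum>i\<in>{1..N}. of_bool (real i < z)) = (\<Sum>i\<in>{1..N}. of_bool (i \<in> {1..n}) :: real)"
    using n by (intro sum.cong) auto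
  also have "\<dots> = (\<Sum>i\<in>{1..n}. 1)"
    using nN by (intro sum.mono_neutral_cong_right) auto
  also have "\<dots> = real n" by simp
  finally have s: "(\<Sum>i\<in>{1..N}. of_bool (real i < z)) = real n" .
  show "(\<Sum>i\<in>{1..N}. of_bool (real i < z)) \<le> z" "z \<le> 1 + (\<Sum>i\<in>{1..N}. of_bool (real i < z))"
    unfolding s using z(1) unfolding n_def by linarith+
qed

lemma integral_step_bounds:
  fixes Q :: "'b::topological_space measure" and g :: "'b \<Rightarrow> real"
  assumes Q: "prob_space Q" "sets Q = sets borel" and g: "continuous_on UNIV g" "\<And>y. 0 \<le> g y" "\<And>y. g y \<le> 1" and N: "N > 0"
  shows "(\<Sum>i\<in>{1..N}. measure Q {y. real i < real N * g y}) \<le> real N * (\<integral>y. g y \<partial>Q)"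
    "real N * (\<integral>y. g y \<partial>Q) \<le> 1 + (\<Sum>i\<in>{1..N}. measure Q {y. real i < real N * g y})"
proof -
  interpret prob_space Q by fact
  note Q(2)[measurable_cong]
  have [measurable]: "g \<in> borel_measurable borel" using g(1) by (rule borel_measurable_continuous_onI)
  have sp: "space Q = UNIV" using sets_eq_imp_space_eq[OF Q(2)] by simp
  have G: "{y. real i < real N * g y} \<in> sets Q" for i
  proof -
    have "{y \<in> space borel. real i < real N * g y} \<in> sets borel" by measurable
    then show ?thesis by (simp add: Q(2))
  qed
  have ig: "integrable Q g"
    using g by (intro integrable_const_bound[of _ 1]) (auto intro!: AE_I2)
  let ?s = "\<lambda>y. \<Sum>i\<in>{1..N}. indicator {y. real i < real N * g y} y :: real"
  have is1: "integrable Q ?s" using G by (intro Bochner_Integration.integrable_sum integrable_real_indicator) (auto simp: emeasure_eq_measure)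
  have is2: "(\<integral>y. ?s y \<partial>Q) = (\<Sum>i\<in>{1..N}. measure Q {y. real i < real N * g y})"
    using G by (subst Bochner_Integration.integral_sum) (auto simp: sp emeasure_eq_measure)
  have s: "?s y = (\<Sum>i\<in>{1..N}. of_bool (real i < real N * g y))" for y
    by (intro sum.cong) (auto simp: indicator_def)
  have b: "?s y \<le> real N * g y" "real N * g y \<le> 1 + ?s y" for y
    unfolding s using g(2,3)[of y] N by (intro step_function_bounds; simp add: mult_left_le)+
  have "(\<integral>y. ?s y \<partial>Q) \<le> (\<integral>y. real N * g y \<partial>Q)"
    using is1 ig b(1) by (intro integral_mono) auto
  then show "(\<Sum>i\<in>{1..N}. measure Q {y. real i < real N * g y}) \<le> real N * (\<integral>y. g y \<partial>Q)"
    unfolding is2 by simp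
  have "(\<integral>y. real N * g y \<partial>Q) \<le> (\<integral>y. 1 + ?s y \<partial>Q)"
    using is1 ig b(2) by (intro integral_mono) auto
  also have "\<dots> = 1 + (\<integral>y. ?s y \<partial>Q)"
    using is1 by (subst Bochner_Integration.integral_add) (auto simp: prob_space)
  finally show "real N * (\<integral>y. g y \<partial>Q) \<le> 1 + (\<Sum>i\<in>{1..N}. measure Q {y. real i < real N * g y})"
    unfolding is2 by simp
qed

text \<open>A discrete layer-cake formula: up to an error \<open>1 / N\<close>, the integral of
  \<open>g\<close> is an average of the measures of its open superlevel sets.\<close>

lemma portmanteau_lower:
  fixes P :: "nat \<Rightarrow> 'b::topological_space measure" and g :: "'b \<Rightarrow> real"
  assumes P: "\<And>n. prob_space (P n)" "\<And>n. sets (P n) = sets borel" and Q: "prob_space Q" "sets Q = sets borel"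
    and lim: "\<And>G t. open G \<Longrightarrow> 0 \<le> t \<Longrightarrow> t < measure Q G \<Longrightarrow> \<forall>\<^sub>F n in sequentially. t \<le> measure (P n) G"
    and g: "continuous_on UNIV g" "\<And>y. 0 \<le> g y" "\<And>y. g y \<le> 1" and e: "e > 0"
  shows "\<forall>\<^sub>F n in sequentially. (\<integral>y. g y \<partial>Q) - e < (\<integral>y. g y \<partial>P n)"
proof -
  \<comment> \<open>The discretization error \<open>1 / N\<close> stays below \<open>e / 2\<close>;
    the other half is spent on the measures of the level sets.\<close>
  obtain N :: nat where N: "2 / e < real N" using reals_Archimedean2 by blast
  then have N0: "N > 0" using e by (auto intro: Nat.gr0I simp: field_simps)
  let ?G = "\<lambda>i. {y. real i < real N * g y}"
  have op: "open (?G i)" for i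
    using g(1) by (intro open_Collect_less continuous_intros)
  have "\<forall>\<^sub>F n in sequentially. measure Q (?G i) - e / 2 \<le> measure (P n) (?G i)" for i
  proof (cases "measure Q (?G i) - e / 2 \<ge> 0")
    case True
    then show ?thesis using e by (intro lim[OF op]) auto
  next
    case False
    then show ?thesis by (intro always_eventually allI) (smt (verit) measure_nonneg)
  qed
  then have "\<forall>\<^sub>F n in sequentially. \<forall>i\<in>{1..N}. measure Q (?G i) - e / 2 \<le> measure (P n) (?G i)"
    by (intro eventually_ball_finite) auto
  then show ?thesis
  proof eventually_elim
    case (elim n)
    have "real N * (\<integral>y. g y \<partial>Q) \<le> 1 + (\<Sum>i\<in>{1..N}. measure Q (?G i))"
      by (rule integral_step_bounds(2)[OF Q g N0])
    also have "(\<Sum>i\<in>{1..N}. measure Q (?G i)) \<le> (\<Sum>i\<in>{1..N}. measure (P n) (?G i) + e / 2)"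
      using elim by (intro sum_mono) force
    also have "\<dots> = (\<Sum>i\<in>{1..N}. measure (P n) (?G i)) + real N * (e / 2)"
      by (simp add: sum.distrib)
    also have "(\<Sum>i\<in>{1..N}. measure (P n) (?G i)) \<le> real N * (\<integral>y. g y \<partial>P n)"
      by (rule integral_step_bounds(1)[OF P g N0])
    finally have "real N * (\<integral>y. g y \<partial>Q) \<le> 1 + real N * (\<integral>y. g y \<partial>P n) + real N * (e / 2)" by simp
    also have "1 < real N * (e / 2)" using N e by (simp add: field_simps)
    finally have "real N * (\<integral>y. g y \<partial>Q) < real N * ((\<integral>y. g y \<partial>P n) + e)"
      by (simp add: algebra_simps)
    then show ?case using N0 by simp
  qed
qed

text \<open>The one-sided bound is used for both \<open>(1 + f / b) / 2\<close> and
  \<open>(1 - f / b) / 2\<close>, which take values in \<open>[0, 1]\<close>.\<close>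

lemma portmanteau:
  fixes P :: "nat \<Rightarrow> 'b::topological_space measure" and f :: "'b \<Rightarrow> real"
  assumes P: "\<And>n. prob_space (P n)" "\<And>n. sets (P n) = sets borel" and Q: "prob_space Q" "sets Q = sets borel"
    and lim: "\<And>G t. open G \<Longrightarrow> 0 \<le> t \<Longrightarrow> t < measure Q G \<Longrightarrow> \<forall>\<^sub>F n in sequentially. t \<le> measure (P n) G"
    and f: "continuous_on UNIV f" "\<And>y. \<bar>f y\<bar> \<le> b" and b: "b > 0"
  shows "(\<lambda>n. \<integral>y. f y \<partial>P n) \<longlonglongrightarrow> (\<integral>y. f y \<partial>Q)"
proof -
  define g where "g s y = (1 + s * f y / b) / 2" for s y
  have g: "continuous_on UNIV (g s)" for s unfolding g_def using f(1) b by (intro continuous_intros) auto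
  have g01: "0 \<le> g s y" "g s y \<le> 1" if "s = 1 \<or> s = - 1" for s y
    using f(2)[of y] b that by (auto simp: g_def field_simps abs_le_iff)
  have int: "(\<integral>y. g s y \<partial>R) = (1 + s * (\<integral>y. f y \<partial>R) / b) / 2" if R: "prob_space R" "sets R = sets borel" for s R
  proof -
    interpret R: prob_space R by fact
    have "f \<in> borel_measurable R"
      using borel_measurable_continuous_onI[OF f(1)] measurable_cong_sets[OF R(2) refl] by blast
    then have "integrable R f" using f(2) by (intro R.integrable_const_bound[of _ b]) (auto intro!: AE_I2)
    then show ?thesis unfolding g_def by (simp add: R.prob_space)
  qed
  show ?thesis
  proof (rule LIMSEQ_I)
    fix e :: real assume e: "e > 0"
    have "\<forall>\<^sub>F n in sequentially. (\<integral>y. g s y \<partial>Q) - e / (2 * b) < (\<integral>y. g s y \<partial>P n)" if "s = 1 \<or> s = - 1" for s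
      using g g01[OF that] e b by (intro portmanteau_lower[OF P Q lim]) auto
    then have "\<forall>\<^sub>F n in sequentially. (\<integral>y. g 1 y \<partial>Q) - e / (2 * b) < (\<integral>y. g 1 y \<partial>P n)"
      "\<forall>\<^sub>F n in sequentially. (\<integral>y. g (- 1) y \<partial>Q) - e / (2 * b) < (\<integral>y. g (- 1) y \<partial>P n)"
      by blast+
    then have "\<forall>\<^sub>F n in sequentially. \<bar>(\<integral>y. f y \<partial>P n) - (\<integral>y. f y \<partial>Q)\<bar> < e"
    proof eventually_elim
      case (elim n)
      have *: "s * A - e < s * A'" if "(1 + s * A / b) / 2 - e / (2 * b) < (1 + s * A' / b) / 2" for s A A' :: real
      proof -
        have halves: "x - y < z" if "(1 + x) / 2 - y / 2 < (1 + z) / 2" for x y z :: real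
          using that by (simp add: field_simps)
        have "e / (2 * b) = (e / b) / 2" by simp
        from halves[OF that[unfolded this]] have "s * A / b - e / b < s * A' / b" .
        then have "(s * A - e) / b < s * A' / b" by (simp only: diff_divide_distrib)
        then show ?thesis using b by (simp only: divide_less_cancel)
      qed
      from *[OF elim(1)[unfolded int[OF Q] int[OF P]]] *[OF elim(2)[unfolded int[OF Q] int[OF P]]]
      show ?case by auto
    qed
    then show "\<exists>no. \<forall>n\<ge>no. norm ((\<integral>y. f y \<partial>P n) - (\<integral>y. f y \<partial>Q)) < e"
      by (simp add: eventually_sequentially)
  qed
qed

subsection \<open>The normalized Hausdorff measure on a convex set\<close>

text \<open>Taken on the Borel sets of the whole space, not of \<open>Y\<close>, so that the
  portmanteau argument can use open sets of the whole space.\<close>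

definition uniform_on :: "'b::euclidean_space set \<Rightarrow> 'b measure" where
  "uniform_on A = density (hausdorff_on (adim A) A) (\<lambda>_. 1 / hausdorff_outer (adim A) A)"

lemma sets_uniform_on [simp, measurable_cong]: "sets (uniform_on A) = sets borel"
  by (simp add: uniform_on_def)

lemma
  fixes A :: "'b::euclidean_space set"
  assumes A: "compact A" "convex A" "A \<noteq> {}"
  shows prob_space_uniform_on: "prob_space (uniform_on A)"
    and emeasure_uniform_on: "B \<in> sets borel \<Longrightarrow>
      emeasure (uniform_on A) B = hausdorff_outer (adim A) (A \<inter> B) / hausdorff_outer (adim A) A"
    and nn_integral_uniform_on: "f \<in> borel_measurable borel \<Longrightarrow>
      (\<integral>\<^sup>+y. f y \<partial>uniform_on A) = (\<integral>\<^sup>+y\<in>A. f y \<partial>hausdorff_measure (adim A)) / hausdorff_outer (adim A) A"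
proof -
  let ?h = "hausdorff_outer (adim A) A"
  have h: "0 < ?h" "?h < top"
    using hausdorff_outer_convex_pos[OF A] hausdorff_outer_convex_finite[OF A] by auto
  have Ab: "A \<in> sets borel" using A(1) by (simp add: compact_imp_closed)
  have nn: "(\<integral>\<^sup>+y. f y \<partial>uniform_on A) = (\<integral>\<^sup>+y\<in>A. f y \<partial>hausdorff_measure (adim A)) / ?h"
    if f: "f \<in> borel_measurable borel" for f
  proof -
    have "(\<integral>\<^sup>+y. f y \<partial>uniform_on A) = (\<integral>\<^sup>+y. 1 / ?h * f y \<partial>hausdorff_on (adim A) A)"
      unfolding uniform_on_def using f by (intro nn_integral_density) auto
    also have "\<dots> = 1 / ?h * (\<integral>\<^sup>+y. f y \<partial>hausdorff_on (adim A) A)"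
      using f by (intro nn_integral_cmult) auto
    finally show ?thesis
      using nn_integral_hausdorff_on[OF Ab f] by (simp add: ennreal_divide_times)
  qed
  then show "f \<in> borel_measurable borel \<Longrightarrow>
      (\<integral>\<^sup>+y. f y \<partial>uniform_on A) = (\<integral>\<^sup>+y\<in>A. f y \<partial>hausdorff_measure (adim A)) / ?h" .
  have em: "emeasure (uniform_on A) B = hausdorff_outer (adim A) (A \<inter> B) / ?h" if B: "B \<in> sets borel" for B
  proof -
    have "emeasure (uniform_on A) B = (\<integral>\<^sup>+y. 1 / ?h * indicator B y \<partial>hausdorff_on (adim A) A)"
      unfolding uniform_on_def using B by (intro emeasure_density) auto
    also have "\<dots> = 1 / ?h * emeasure (hausdorff_on (adim A) A) B"
      using B by (intro nn_integral_cmult_indicator) auto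
    finally show ?thesis using emeasure_hausdorff_on[OF Ab B] by (simp add: ennreal_divide_times)
  qed
  then show "B \<in> sets borel \<Longrightarrow> emeasure (uniform_on A) B = hausdorff_outer (adim A) (A \<inter> B) / ?h" .
  show "prob_space (uniform_on A)"
  proof
    have "space (uniform_on A) = UNIV" by (simp add: uniform_on_def)
    then show "emeasure (uniform_on A) (space (uniform_on A)) = 1"
      using em[of UNIV] h by simp
  qed
qed

lemma AE_uniform_on:
  fixes A :: "'b::euclidean_space set"
  assumes A: "compact A" "convex A" "A \<noteq> {}"
  shows "AE y in uniform_on A. y \<in> A"
proof (rule AE_I[where N="- A"])
  have "- A \<in> sets borel" using A(1) by (simp add: compact_imp_closed)
  then show "emeasure (uniform_on A) (- A) = 0" "- A \<in> sets (uniform_on A)"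
    by (simp_all add: emeasure_uniform_on[OF A])
qed auto

lemma uniform_on_weakly_continuous:
  fixes X :: "'a::metric_space set" and S :: "'a \<Rightarrow> 'b::euclidean_space set" and f :: "'b \<Rightarrow> real"
  assumes S: "\<And>x. x \<in> X \<Longrightarrow> compact (S x)" "\<And>x. x \<in> X \<Longrightarrow> convex (S x)" "\<And>x. x \<in> X \<Longrightarrow> S x \<noteq> {}"
    "\<And>x. x \<in> X \<Longrightarrow> S x \<subseteq> cball 0 B" and x0: "x0 \<in> X"
    and rc: "rectangularly_continuous_at X S x0"
    and \<xi>: "\<And>n. \<xi> n \<in> X" "\<xi> \<longlonglongrightarrow> x0"
    and f: "continuous_on UNIV f" "\<And>y. \<bar>f y\<bar> \<le> b" and b: "b > 0"
  shows "(\<lambda>n. \<integral>y. f y \<partial>uniform_on (S (\<xi> n))) \<longlonglongrightarrow> (\<integral>y. f y \<partial>uniform_on (S x0))"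
proof (rule portmanteau[where b=b])
  let ?h = "\<lambda>x. hausdorff_outer (adim (S x)) (S x)"
  note SX = S(1-3)[OF \<xi>(1)] and S0 = S(1-3)[OF x0]
  show "prob_space (uniform_on (S (\<xi> n)))" for n by (rule prob_space_uniform_on[OF SX])
  show "prob_space (uniform_on (S x0))" by (rule prob_space_uniform_on[OF S0])
  fix G :: "'b set" and t :: real
  assume G: "open G" and t: "0 \<le> t" "t < measure (uniform_on (S x0)) G"
  let ?g = "\<lambda>x. hausdorff_outer (adim (S x)) (S x \<inter> G)"
  have Gb: "G \<in> sets borel" using G by simp
  have meas: "ennreal (measure (uniform_on (S x)) G) = ?g x / ?h x"
    if "x \<in> X" for x
    using emeasure_uniform_on[OF S(1-3)[OF that] Gb] prob_space_uniform_on[OF S(1-3)[OF that]]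
    by (simp add: finite_measure.emeasure_eq_measure prob_space_def)
  have pos: "0 < ?h x" "?h x < top" if "x \<in> X" for x
    using hausdorff_outer_convex_pos[OF S(1-3)[OF that]] hausdorff_outer_convex_finite[OF S(1-3)[OF that]] by auto
  have cancel: "?g x = ennreal (measure (uniform_on (S x)) G) * ?h x"
    if "x \<in> X" for x
    unfolding meas[OF that] using pos[OF that]
    by (metis ennreal_times_divide mult.commute mult_divide_eq_ennreal less_irrefl)
  have "ennreal t * ?h x0 < ?g x0"
    unfolding cancel[OF x0] using pos[OF x0] t
    by (intro ennreal_mult_strict_right_mono) (auto simp: ennreal_less_iff)
  from rectangularly_continuous_liminf[OF S x0 rc G this t(1)]
  have ev: "\<forall>\<^sub>F x in nhds_in X x0. ennreal t * ?h x \<le> ?g x" .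
  \<comment> \<open>The sequence may take the value \<open>x0\<close>, which \<open>nhds_in\<close>
    does not exclude.\<close>
  have "filterlim \<xi> (nhds_in X x0) sequentially"
    unfolding nhds_in_def using \<xi> by (auto simp: filterlim_inf filterlim_principal)
  from eventually_compose_filterlim[OF ev this]
  show "\<forall>\<^sub>F n in sequentially. t \<le> measure (uniform_on (S (\<xi> n))) G"
  proof eventually_elim
    case (elim n)
    have "ennreal t = ennreal t * ?h (\<xi> n) / ?h (\<xi> n)"
      using pos[OF \<xi>(1)[of n]] by (intro mult_divide_eq_ennreal[symmetric]) auto
    also have "\<dots> \<le> ennreal (measure (uniform_on (S (\<xi> n))) G)"
      unfolding meas[OF \<xi>(1)] using elim by (rule divide_right_mono_ennreal)
    finally show ?case by (simp add: measure_nonneg)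
  qed
qed (use f b in simp_all)

lemma compact_closed_subset:
  fixes A :: "'a::t2_space set"
  shows "compact Y \<Longrightarrow> closed A \<Longrightarrow> A \<subseteq> Y \<Longrightarrow> compact A"
  using compact_Int_closed[of Y A] by (simp add: Int_absorb1)

text \<open>The integrand varies together with the measure. Weak convergence handles the fixed
  function \<open>h x0\<close>, and compactness of \<open>Y\<close> makes
  \<open>h (\<xi> n) - h x0\<close> uniformly small on \<open>Y\<close>, which carries all the
  measures.\<close>

lemma uniform_on_uniform_limit:
  fixes X :: "'a::metric_space set" and S :: "'a \<Rightarrow> 'b::euclidean_space set" and h :: "'a \<Rightarrow> 'b \<Rightarrow> real"
  assumes S: "\<And>x. x \<in> X \<Longrightarrow> closed (S x)" "\<And>x. x \<in> X \<Longrightarrow> convex (S x)" "\<And>x. x \<in> X \<Longrightarrow> S x \<noteq> {}"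
    "\<And>x. x \<in> X \<Longrightarrow> S x \<subseteq> Y" and Y: "compact Y" and x0: "x0 \<in> X"
    and rc: "rectangularly_continuous_at X S x0"
    and \<xi>: "\<And>n. \<xi> n \<in> X" "\<xi> \<longlonglongrightarrow> x0"
    and h: "continuous_on (X \<times> Y) (\<lambda>(x, y). h x y)"
  shows "(\<lambda>n. \<integral>y. indicator Y y * h (\<xi> n) y \<partial>uniform_on (S (\<xi> n)))
    \<longlonglongrightarrow> (\<integral>y. indicator Y y * h x0 y \<partial>uniform_on (S x0))"
proof -
  have cS: "compact (S x)" if "x \<in> X" for x
    by (rule compact_closed_subset[OF Y S(1)[OF that] S(4)[OF that]])
  obtain B where "\<And>y. y \<in> Y \<Longrightarrow> norm y \<le> B"
    using compact_imp_bounded[OF Y] unfolding bounded_iff by blast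
  then have B: "Y \<subseteq> cball 0 B" by auto
  have SB: "S x \<subseteq> cball 0 B" if "x \<in> X" for x using S(4)[OF that] B by blast
  have hc: "continuous_on Y (h x)" if "x \<in> X" for x
  proof -
    have "continuous_on Y (\<lambda>y. (x, y))" by (intro continuous_intros)
    from continuous_on_compose2[OF h this] show ?thesis using that by auto
  qed
  have Yb: "Y \<in> sets borel" using Y by (simp add: compact_imp_closed)
  have hm: "(\<lambda>y. indicator Y y * h x y) \<in> borel_measurable borel" if "x \<in> X" for x
    using borel_measurable_continuous_on_indicator[OF Yb hc[OF that]] by simp
  obtain b where b: "b > 0" "\<And>y. y \<in> Y \<Longrightarrow> \<bar>h x0 y\<bar> \<le> b"
    using compact_imp_bounded[OF compact_continuous_image[OF hc[OF x0] Y]] unfolding bounded_pos by auto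
  \<comment> \<open>Test functions for the weak convergence are continuous on the whole space,
    whereas \<open>h x0\<close> is only continuous on \<open>Y\<close>.\<close>
  obtain g where g: "continuous_on UNIV g" "\<And>y. y \<in> Y \<Longrightarrow> g y = h x0 y" "\<And>y. norm (g y) \<le> b"
    using Tietze[OF hc[OF x0], of UNIV b] Y b by (auto simp: compact_imp_closed)
  have gm: "g \<in> borel_measurable borel" using g(1) by (rule borel_measurable_continuous_onI)
  have AEY: "AE y in uniform_on (S x). y \<in> Y" if "x \<in> X" for x
  proof -
    have "AE y in uniform_on (S x). y \<in> S x" using AE_uniform_on[OF cS S(2,3)] that by blast
    then show ?thesis by eventually_elim (use S(4)[OF that] in blast)
  qed
  have lim: "(\<lambda>n. \<integral>y. g y \<partial>uniform_on (S (\<xi> n))) \<longlonglongrightarrow> (\<integral>y. g y \<partial>uniform_on (S x0))"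
    using uniform_on_weakly_continuous[OF cS S(2,3) SB x0 rc \<xi> g(1) _ b(1)] g(3) by simp
  have eq: "(\<integral>y. g y \<partial>uniform_on (S x0)) = (\<integral>y. indicator Y y * h x0 y \<partial>uniform_on (S x0))"
  proof (rule integral_cong_AE)
    show "AE y in uniform_on (S x0). g y = indicator Y y * h x0 y"
      using AEY[OF x0] by eventually_elim (simp add: g(2))
  qed (use gm hm[OF x0] in simp_all)
  let ?J = "\<lambda>n. \<integral>y. indicator Y y * h (\<xi> n) y \<partial>uniform_on (S (\<xi> n))"
  have diff: "(\<lambda>n. ?J n - (\<integral>y. g y \<partial>uniform_on (S (\<xi> n)))) \<longlonglongrightarrow> 0"
  proof (rule LIMSEQ_I)
    fix e :: real assume e: "e > 0"
    have "e / 2 > 0" using e by simp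
    then obtain U where "x0 \<in> U" "open U"
      "\<forall>x\<in>U \<inter> X. \<forall>y\<in>Y. dist (case (x, y) of (x, y) \<Rightarrow> h x y) (case (x0, y) of (x, y) \<Rightarrow> h x y) \<le> e / 2"
      by (rule continuous_on_prod_compactE[OF h Y x0])
    then have U: "x0 \<in> U" "open U" "\<And>x y. x \<in> U \<inter> X \<Longrightarrow> y \<in> Y \<Longrightarrow> dist (h x y) (h x0 y) \<le> e / 2"
      by auto
    have "\<forall>\<^sub>F n in sequentially. \<xi> n \<in> U" by (rule topological_tendstoD[OF \<xi>(2) U(2,1)])
    then obtain no where no: "\<And>n. n \<ge> no \<Longrightarrow> \<xi> n \<in> U" by (auto simp: eventually_sequentially)
    have "norm (?J n - (\<integral>y. g y \<partial>uniform_on (S (\<xi> n))) - 0) < e"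
      if n: "n \<ge> no" for n
    proof -
      let ?P = "uniform_on (S (\<xi> n))" and ?h = "\<lambda>y. indicator Y y * h (\<xi> n) y"
      interpret P: prob_space ?P by (rule prob_space_uniform_on[OF cS S(2,3)]) (rule \<xi>(1))+
      obtain b' where b': "\<And>y. y \<in> Y \<Longrightarrow> \<bar>h (\<xi> n) y\<bar> \<le> b'" "b' > 0"
        using compact_imp_bounded[OF compact_continuous_image[OF hc[OF \<xi>(1)[of n]] Y]] unfolding bounded_pos by auto
      have ih: "integrable ?P ?h"
        using hm[OF \<xi>(1)] b' by (intro P.integrable_const_bound[of _ b']) (auto intro!: AE_I2 simp: indicator_def)
      have ig: "integrable ?P g"
        using gm g(3) by (intro P.integrable_const_bound[of _ b]) (auto intro!: AE_I2)
      have "norm (\<integral>y. ?h y - g y \<partial>?P) \<le> (\<integral>y. norm (?h y - g y) \<partial>?P)"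
        by (rule integral_norm_bound)
      also have "\<dots> \<le> (\<integral>y. e / 2 \<partial>?P)"
      proof (rule integral_mono_AE)
        show "AE y in ?P. norm (?h y - g y) \<le> e / 2"
          using AEY[OF \<xi>(1)[of n]]
        proof eventually_elim
          case (elim y)
          then show ?case using U(3)[of "\<xi> n" y] no[OF n] \<xi>(1)[of n] g(2)[of y] by (simp add: dist_norm)
        qed
      qed (use ih ig in auto)
      also have "\<dots> < e" using e by (simp add: P.prob_space)
      finally show ?thesis using ih ig by (simp add: Bochner_Integration.integral_diff)
    qed
    then show "\<exists>no. \<forall>n\<ge>no. norm (?J n - (\<integral>y. g y \<partial>uniform_on (S (\<xi> n))) - 0) < e"
      by blast
  qed
  from tendsto_add[OF lim diff] show ?thesis by (simp add: eq)
qed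

subsection \<open>Beliefs with a continuous density\<close>

text \<open>Integrals against the belief become quotients of integrals against the uniform
  distribution; the total Hausdorff measure \<open>h\<close> of \<open>A\<close> cancels in the
  quotient.\<close>

lemma
  fixes A Y :: "'b::euclidean_space set" and r f :: "'b \<Rightarrow> real"
  assumes A: "compact A" "convex A" "A \<noteq> {}" "A \<subseteq> Y" and Y: "compact Y"
    and r: "continuous_on Y r" "\<And>y. y \<in> Y \<Longrightarrow> 0 \<le> r y"
    and sets: "sets \<mu> = sets (restrict_space borel Y)"
  defines "H \<equiv> hausdorff_measure (adim A)"
  assumes pos: "0 < (\<integral>\<^sup>+y\<in>A. ennreal (r y) \<partial>H)" and fin: "(\<integral>\<^sup>+y\<in>A. ennreal (r y) \<partial>H) < \<infinity>"
    and em: "\<And>B. B \<in> sets (restrict_space borel Y) \<Longrightarrow>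
      emeasure \<mu> B = (\<integral>\<^sup>+y\<in>B \<inter> A. ennreal (r y) \<partial>H) / (\<integral>\<^sup>+y\<in>A. ennreal (r y) \<partial>H)"
  shows density_integral_pos: "0 < (\<integral>y. indicator Y y * r y \<partial>uniform_on A)"
    and density_integral: "continuous_on Y f \<Longrightarrow>
      (\<integral>y. f y \<partial>\<mu>) = (\<integral>y. indicator Y y * (f y * r y) \<partial>uniform_on A) / (\<integral>y. indicator Y y * r y \<partial>uniform_on A)"
proof -
  let ?U = "uniform_on A" and ?r = "\<lambda>y. indicator Y y * r y"
  define Z where "Z = (\<integral>\<^sup>+y\<in>A. ennreal (r y) \<partial>H)"
  define h where "h = hausdorff_outer (adim A) A"
  have h: "0 < h" "h < top"
    unfolding h_def by (rule hausdorff_outer_convex_pos[OF A(1-3)], rule hausdorff_outer_convex_finite[OF A(1-3)])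
  have Yb: "Y \<in> sets borel" using Y by (simp add: compact_imp_closed)
  have rm[measurable]: "?r \<in> borel_measurable borel"
    using borel_measurable_continuous_on_indicator[OF Yb r(1)] by simp
  have r0: "0 \<le> indicator Y y * r y" for y using r(2) by (auto simp: indicator_def)
  have nn: "(\<integral>\<^sup>+y. ennreal (?r y) * indicator B y \<partial>?U) = (\<integral>\<^sup>+y\<in>B \<inter> A. ennreal (r y) \<partial>H) / h"
    if [measurable]: "B \<in> sets borel" for B
  proof -
    have "(\<integral>\<^sup>+y. ennreal (?r y) * indicator B y \<partial>?U)
        = (\<integral>\<^sup>+y\<in>A. ennreal (?r y) * indicator B y \<partial>H) / h"
      unfolding h_def H_def by (rule nn_integral_uniform_on[OF A(1-3)]) measurable
    also have "(\<integral>\<^sup>+y\<in>A. ennreal (?r y) * indicator B y \<partial>H) = (\<integral>\<^sup>+y\<in>B \<inter> A. ennreal (r y) \<partial>H)"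
      using A(4) by (intro nn_integral_cong) (auto simp: indicator_def)
    finally show ?thesis .
  qed
  define z where "z = (\<integral>y. indicator Y y * r y \<partial>?U)"
  have zZ: "z = enn2real (Z / h)"
    unfolding z_def using nn[of UNIV] r0 by (subst integral_eq_nn_integral) (auto simp: Z_def)
  have Z: "0 < Z" "Z < top" using pos fin by (simp_all add: Z_def)
  obtain Z' where Z': "Z = ennreal Z'" "Z' > 0" using Z by (cases Z) auto
  obtain h' where h': "h = ennreal h'" "h' > 0" using h by (cases h) auto
  have z: "z = Z' / h'" using Z' h' by (simp add: zZ divide_ennreal)
  show zpos: "0 < (\<integral>y. indicator Y y * r y \<partial>?U)"
    unfolding z_def[symmetric] z using Z' h' by simp
  have sp: "space \<mu> = Y" using sets_eq_imp_space_eq[OF sets] by (simp add: space_restrict_space)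
  have idm: "(\<lambda>y. y) \<in> measurable \<mu> borel"
    unfolding measurable_cong_sets[OF sets refl] by (rule measurable_restrict_space1) simp
  \<comment> \<open>\<open>\<mu>\<close> lives on \<open>Y\<close> and the uniform distribution on
    the whole space. Pushing \<open>\<mu>\<close> forward by the inclusion makes the two comparable,
    and the density is \<open>r\<close>, extended by 0, over its mean.\<close>
  have distr: "distr \<mu> borel (\<lambda>y. y) = density ?U (\<lambda>y. ennreal (?r y / z))"
  proof (rule measure_eqI)
    fix B assume "B \<in> sets (distr \<mu> borel (\<lambda>y. y))"
    then have B[measurable]: "B \<in> sets borel" by simp
    let ?I = "\<integral>\<^sup>+y\<in>B \<inter> A. ennreal (r y) \<partial>H"
    have "?I \<le> Z" unfolding Z_def by (intro nn_integral_mono) (auto simp: indicator_def)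
    then have "?I < top" using Z(2) by (rule le_less_trans)
    then obtain i where i: "?I = ennreal i" "i \<ge> 0" by (cases ?I) auto
    have BY: "B \<inter> Y \<in> sets (restrict_space borel Y)" using B Yb by (auto simp: sets_restrict_space_iff)
    have "emeasure (distr \<mu> borel (\<lambda>y. y)) B = emeasure \<mu> (B \<inter> Y)"
      using idm by (subst emeasure_distr) (auto simp: sp)
    also have "\<dots> = (\<integral>\<^sup>+y\<in>(B \<inter> Y) \<inter> A. ennreal (r y) \<partial>H) / Z" using em[OF BY] by (simp add: Z_def)
    also have "(B \<inter> Y) \<inter> A = B \<inter> A" using A(4) by auto
    also have "?I / Z = ennreal (1 / z) * (?I / h)"
      unfolding i(1) Z'(1) h'(1) z using Z'(2) h'(2) i(2) by (simp add: divide_ennreal ennreal_mult'[symmetric])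
    also have "?I / h = (\<integral>\<^sup>+y. ennreal (?r y) * indicator B y \<partial>?U)" by (rule nn[OF B, symmetric])
    also have "ennreal (1 / z) * \<dots> = (\<integral>\<^sup>+y. ennreal (1 / z) * (ennreal (?r y) * indicator B y) \<partial>?U)"
      by (rule nn_integral_cmult[symmetric]) measurable
    also have "\<dots> = (\<integral>\<^sup>+y. ennreal (?r y / z) * indicator B y \<partial>?U)"
    proof (rule nn_integral_cong)
      fix y
      have "ennreal (1 / z) * ennreal (?r y) = ennreal (?r y / z)"
        using zpos r0[of y] unfolding z_def[symmetric] by (simp add: ennreal_mult'[symmetric])
      then show "ennreal (1 / z) * (ennreal (?r y) * indicator B y)
          = ennreal (?r y / z) * indicator B y"
        by (simp only: mult.assoc[symmetric])
    qed
    also have "\<dots> = emeasure (density ?U (\<lambda>y. ennreal (?r y / z))) B"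
    proof (rule emeasure_density[symmetric])
      show "(\<lambda>y. ennreal (?r y / z)) \<in> borel_measurable ?U"
        unfolding measurable_cong_sets[OF sets_uniform_on refl]
        by (rule measurable_compose[OF borel_measurable_divide[OF rm borel_measurable_const] measurable_ennreal])
    qed (use B in simp)
    finally show "emeasure (distr \<mu> borel (\<lambda>y. y)) B = emeasure (density ?U (\<lambda>y. ennreal (?r y / z))) B" .
  qed simp
  show "(\<integral>y. f y \<partial>\<mu>) = (\<integral>y. indicator Y y * (f y * r y) \<partial>?U) / (\<integral>y. indicator Y y * r y \<partial>?U)"
    if f: "continuous_on Y f"
  proof -
    have fm[measurable]: "(\<lambda>y. indicator Y y * f y) \<in> borel_measurable borel"
      using borel_measurable_continuous_on_indicator[OF Yb f] by simp
    have "(\<integral>y. f y \<partial>\<mu>) = (\<integral>y. indicator Y y * f y \<partial>\<mu>)"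
      by (intro Bochner_Integration.integral_cong) (auto simp: sp)
    also have "\<dots> = (\<integral>y. indicator Y y * f y \<partial>distr \<mu> borel (\<lambda>y. y))"
      by (rule integral_distr[OF idm fm, symmetric])
    also have "\<dots> = (\<integral>y. (?r y / z) *\<^sub>R (indicator Y y * f y) \<partial>?U)"
      unfolding distr using r0 zpos
      by (intro integral_density) (auto simp: z_def[symmetric] intro!: AE_I2)
    also have "\<dots> = (\<integral>y. (indicator Y y * (f y * r y)) / z \<partial>?U)"
      by (intro Bochner_Integration.integral_cong) (auto simp: indicator_def)
    also have "\<dots> = (\<integral>y. indicator Y y * (f y * r y) \<partial>?U) / z" by simp
    finally show ?thesis by (simp add: z_def)
  qed
qed

text \<open>Both the integral of \<open>f y * \<rho> x y\<close> and that of
  \<open>\<rho> x y\<close> converge, and the limit of the denominator is positive.\<close>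

lemma weak_continuous_at_density:
  fixes X :: "'a::metric_space set" and Y :: "'b::euclidean_space set"
  assumes Y: "compact Y" and S: "\<And>x. x \<in> X \<Longrightarrow> S x \<subseteq> Y" "\<And>x. x \<in> X \<Longrightarrow> S x \<noteq> {}"
    "\<And>x. x \<in> X \<Longrightarrow> closed (S x)" "\<And>x. x \<in> X \<Longrightarrow> convex (S x)"
    and x0: "x0 \<in> X" and \<beta>: "belief X Y S \<beta>" and dens: "has_density X Y S \<beta> \<rho>"
    and \<rho>: "continuous_on (X \<times> Y) (\<lambda>(x, y). \<rho> x y)" and rc: "rectangularly_continuous_at X S x0"
  shows "weak_continuous_at X Y \<beta> x0"
  unfolding weak_continuous_at_def weakly_converges_def
proof (intro allI impI)
  fix \<xi> :: "nat \<Rightarrow> 'a" and f :: "'b \<Rightarrow> real"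
  assume "(\<forall>n. \<xi> n \<in> X) \<and> \<xi> \<longlonglongrightarrow> x0" and "continuous_on Y f \<and> bounded {y \<in> Y. f y \<noteq> 0}"
  then have \<xi>: "\<And>n. \<xi> n \<in> X" "\<xi> \<longlonglongrightarrow> x0" and f: "continuous_on Y f" by auto
  have cS: "compact (S x)" if "x \<in> X" for x
    by (rule compact_closed_subset[OF Y S(3)[OF that] S(1)[OF that]])
  let ?J = "\<lambda>h x. \<integral>y. indicator Y y * h x y \<partial>uniform_on (S x)"
  have int: "0 < ?J \<rho> x \<and> (\<integral>y. f y \<partial>\<beta> x) = ?J (\<lambda>x y. f y * \<rho> x y) x / ?J \<rho> x" if x: "x \<in> X" for x
  proof -
    have "continuous_on Y (\<lambda>y. (x, y))" by (intro continuous_intros)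
    from continuous_on_compose2[OF \<rho> this] have rc: "continuous_on Y (\<rho> x)" using x by auto
    have r0: "0 \<le> \<rho> x y" if "y \<in> Y" for y using dens x that by (auto simp: has_density_def)
    have sets: "sets (\<beta> x) = sets (restrict_space borel Y)"
      using \<beta> x by (auto simp: belief_def borel_probs_def)
    note d = dens[unfolded has_density_def Let_def, THEN conjunct2, rule_format, OF x]
    note A = cS[OF x] S(4)[OF x] S(2)[OF x] S(1)[OF x] Y
    show ?thesis
      using density_integral_pos[OF A rc r0 sets] density_integral[OF A rc r0 sets _ _ _ f] d by blast
  qed
  have "(\<lambda>n. ?J (\<lambda>x y. f y * \<rho> x y) (\<xi> n) / ?J \<rho> (\<xi> n)) \<longlonglongrightarrow> ?J (\<lambda>x y. f y * \<rho> x y) x0 / ?J \<rho> x0"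
  proof (intro tendsto_divide)
    have "continuous_on (X \<times> Y) (\<lambda>z. f (snd z))"
      by (rule continuous_on_compose2[OF f continuous_on_snd[OF continuous_on_id]]) auto
    then have "continuous_on (X \<times> Y) (\<lambda>z. f (snd z) * (case z of (x, y) \<Rightarrow> \<rho> x y))"
      using \<rho> by (rule continuous_on_mult)
    then have c: "continuous_on (X \<times> Y) (\<lambda>(x, y). f y * \<rho> x y)"
      by (simp add: case_prod_unfold)
    show "(\<lambda>n. ?J (\<lambda>x y. f y * \<rho> x y) (\<xi> n)) \<longlonglongrightarrow> ?J (\<lambda>x y. f y * \<rho> x y) x0"
      by (rule uniform_on_uniform_limit[OF S(3,4,2,1) Y x0 rc \<xi> c])
    show "(\<lambda>n. ?J \<rho> (\<xi> n)) \<longlonglongrightarrow> ?J \<rho> x0"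
      by (rule uniform_on_uniform_limit[OF S(3,4,2,1) Y x0 rc \<xi> \<rho>])
    show "?J \<rho> x0 \<noteq> 0" using int[OF x0] by simp
  qed
  then show "(\<lambda>n. \<integral>y. f y \<partial>\<beta> (\<xi> n)) \<longlonglongrightarrow> (\<integral>y. f y \<partial>\<beta> x0)"
    using int[OF \<xi>(1)] int[OF x0] by simp
qed

text \<open>\<open>measure_of\<close> returns the zero measure unless the given set function is a
  measure. Identification with a restriction of \<open>uniform_on\<close> shows that it is
  one.\<close>

lemma neutral_belief_eq:
  fixes Y :: "'b::euclidean_space set"
  assumes S: "compact (S x)" "convex (S x)" "S x \<noteq> {}" and Y: "Y \<in> sets borel"
  shows "neutral_belief Y S x = restrict_space (uniform_on (S x)) Y"
proof -
  let ?R = "restrict_space (uniform_on (S x)) Y"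
  have sets: "sets ?R = sets (restrict_space borel Y)" by (rule sets_restrict_space_cong) simp
  have space: "space ?R = Y" by (simp add: space_restrict_space uniform_on_def)
  have Sb: "S x \<in> sets borel" using S(1) by (simp add: compact_imp_closed)
  have "neutral_belief Y S x = measure_of Y (sets ?R) (emeasure ?R)"
    unfolding neutral_belief_def sets[symmetric]
  proof (rule measure_of_eq)
    show "sets ?R \<subseteq> Pow Y" using sets.space_closed[of ?R] space by simp
    fix B assume "B \<in> sigma_sets Y (sets ?R)"
    then have "B \<in> sets ?R" using sets.sigma_sets_eq[of ?R] space by simp
    then have B: "B \<in> sets borel" "B \<subseteq> Y" using Y unfolding sets by (auto simp: sets_restrict_space_iff)
    have "emeasure ?R B = emeasure (uniform_on (S x)) B"
      using B(2) Y by (intro emeasure_restrict_space) (auto simp: uniform_on_def)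
    also have "\<dots> = hausdorff_outer (adim (S x)) (S x \<inter> B) / hausdorff_outer (adim (S x)) (S x)"
      by (rule emeasure_uniform_on[OF S B(1)])
    finally show "emeasure (hausdorff_measure (adim (S x))) (B \<inter> S x) / emeasure (hausdorff_measure (adim (S x))) (S x) = emeasure ?R B"
      using B(1) Sb by (simp add: emeasure_hausdorff_measure borel_sets_hausdorff Int_commute)
  qed
  also have "\<dots> = ?R" using measure_of_of_measure[of ?R] space by simp
  finally show ?thesis .
qed

lemma
  fixes X :: "'a set" and Y :: "'b::euclidean_space set"
  assumes Y: "compact Y" and S: "\<And>x. x \<in> X \<Longrightarrow> S x \<subseteq> Y" "\<And>x. x \<in> X \<Longrightarrow> S x \<noteq> {}"
    "\<And>x. x \<in> X \<Longrightarrow> closed (S x)" "\<And>x. x \<in> X \<Longrightarrow> convex (S x)"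
  shows belief_neutral_belief: "belief X Y S (neutral_belief Y S)"
    and has_density_neutral_belief: "has_density X Y S (neutral_belief Y S) (\<lambda>_ _. 1)"
proof -
  let ?h = "\<lambda>x. hausdorff_outer (adim (S x)) (S x)" and ?H = "\<lambda>x. hausdorff_measure (adim (S x))"
  have cS: "compact (S x)" if "x \<in> X" for x
    by (rule compact_closed_subset[OF Y S(3)[OF that] S(1)[OF that]])
  have Yb: "Y \<in> sets borel" using Y by (simp add: compact_imp_closed)
  have Sb: "S x \<in> sets borel" if "x \<in> X" for x using S(3)[OF that] by simp
  have eq: "neutral_belief Y S x = restrict_space (uniform_on (S x)) Y" if "x \<in> X" for x
    by (rule neutral_belief_eq[where S=S, OF cS[OF that] S(4)[OF that] S(2)[OF that] Yb])
  have sets: "sets (neutral_belief Y S x) = sets (restrict_space borel Y)" if "x \<in> X" for x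
    unfolding eq[OF that] by (rule sets_restrict_space_cong) simp
  have h: "0 < ?h x" "?h x < top" if "x \<in> X" for x
    using hausdorff_outer_convex_pos[OF cS S(4,2)] hausdorff_outer_convex_finite[OF cS S(4,2)] that by blast+
  have em: "emeasure (neutral_belief Y S x) B = hausdorff_outer (adim (S x)) (B \<inter> S x) / ?h x"
    if x: "x \<in> X" and B: "B \<in> sets borel" "B \<subseteq> Y" for x B
  proof -
    have "emeasure (neutral_belief Y S x) B = emeasure (uniform_on (S x)) B"
      unfolding eq[OF x] using B(2) Yb by (intro emeasure_restrict_space) (auto simp: uniform_on_def)
    also have "\<dots> = hausdorff_outer (adim (S x)) (S x \<inter> B) / ?h x"
      by (rule emeasure_uniform_on[OF cS[OF x] S(4)[OF x] S(2)[OF x] B(1)])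
    finally show ?thesis by (simp add: Int_commute)
  qed
  have one: "emeasure (neutral_belief Y S x) B = 1" if "x \<in> X" "B \<in> sets borel" "B \<subseteq> Y" "S x \<subseteq> B" for x B
    using em[OF that(1-3)] that(4) h[OF that(1)] by (simp add: Int_absorb1)
  show "belief X Y S (neutral_belief Y S)"
    unfolding belief_def borel_probs_def
  proof (intro ballI conjI CollectI)
    fix x assume x: "x \<in> X"
    show "sets (neutral_belief Y S x) = sets (restrict_space borel Y)" by (rule sets[OF x])
    have "space (neutral_belief Y S x) = Y"
      using sets_eq_imp_space_eq[OF sets[OF x]] by (simp add: space_restrict_space)
    then show "prob_space (neutral_belief Y S x)"
      using one[OF x Yb order_refl S(1)[OF x]] by (intro prob_spaceI) simp
    show "emeasure (neutral_belief Y S x) (S x) = 1"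
      by (rule one[OF x Sb[OF x] S(1)[OF x] order_refl])
  qed
  show "has_density X Y S (neutral_belief Y S) (\<lambda>_ _. 1)"
    unfolding has_density_def Let_def
  proof (intro conjI ballI)
    fix x assume x: "x \<in> X"
    have nn: "(\<integral>\<^sup>+y\<in>B. ennreal 1 \<partial>?H x) = hausdorff_outer (adim (S x)) B"
      if "B \<in> sets borel" for B
      using borel_sets_hausdorff[OF that] by (simp add: emeasure_hausdorff_measure)
    show "0 < (\<integral>\<^sup>+y\<in>S x. ennreal 1 \<partial>?H x)"
      "(\<integral>\<^sup>+y\<in>S x. ennreal 1 \<partial>?H x) < \<infinity>"
      unfolding nn[OF Sb[OF x]] using h[OF x] by simp_all
    fix B assume "B \<in> sets (restrict_space borel Y)"
    then have B: "B \<in> sets borel" "B \<subseteq> Y" using Yb by (auto simp: sets_restrict_space_iff)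
    have BS: "B \<inter> S x \<in> sets borel" using B(1) Sb[OF x] by blast
    show "emeasure (neutral_belief Y S x) B = (\<integral>\<^sup>+y\<in>B \<inter> S x. ennreal 1 \<partial>?H x) /
        (\<integral>\<^sup>+y\<in>S x. ennreal 1 \<partial>?H x)"
      unfolding nn[OF Sb[OF x]] nn[OF BS] by (rule em[OF x B])
  qed auto
qed

theorem theorem5:
  fixes X :: "'a::euclidean_space set" and Y :: "'b::euclidean_space set"
    and S :: "'a \<Rightarrow> 'b set" and x0 :: 'a
  assumes "X \<noteq> {}" and "Y \<noteq> {}" and "compact Y"
    and "\<And>x. x \<in> X \<Longrightarrow> S x \<subseteq> Y"
    and "\<And>x. x \<in> X \<Longrightarrow> S x \<noteq> {}"
    and "\<And>x. x \<in> X \<Longrightarrow> closed (S x)"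
    and "\<And>x. x \<in> X \<Longrightarrow> convex (S x)"
    and "x0 \<in> X"
  shows
    "(\<forall>\<beta> \<rho>. belief X Y S \<beta> \<and> has_density X Y S \<beta> \<rho> \<and>
        continuous_on (X \<times> Y) (\<lambda>(x, y). \<rho> x y) \<and> rectangularly_continuous_at X S x0
        \<longrightarrow> weak_continuous_at X Y \<beta> x0) \<and>
     belief X Y S (neutral_belief Y S) \<and>
     (rectangularly_continuous_at X S x0 \<longrightarrow> weak_continuous_at X Y (neutral_belief Y S) x0) \<and>
     (rectangularly_continuous_on X S \<longrightarrow>
        (\<forall>x\<in>X. weak_continuous_at X Y (neutral_belief Y S) x))"
proof -
  note hyps = assms(3-7)
  \<comment> \<open>The neutral belief has the constant density 1, which is continuous.\<close>
  have neutral: "weak_continuous_at X Y (neutral_belief Y S) x"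
    if "x \<in> X" "rectangularly_continuous_at X S x" for x
    using weak_continuous_at_density[OF hyps that(1) belief_neutral_belief[OF hyps] has_density_neutral_belief[OF hyps] _ that(2)]
    by simp
  show ?thesis
    using weak_continuous_at_density[OF hyps assms(8)] belief_neutral_belief[OF hyps] neutral assms(8)
    by (auto simp: rectangularly_continuous_on_def)
qed

end
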